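(* Let $k$ be a field of characteristic $0$, and let $g\ge 1$ be an integer. Assume that the birational Grothendieck anabelian section conjecture (BGASC) holds true for all proper, smooth, and geometrically connected curves of genus $g$ over $k$. Then the BGASC holds true for the projective line $\mathbb{P}^1_k$ over $k$.
   Context: Let $k$ be a field of characteristic $0$ and $X$ a proper, smooth, geometrically connected algebraic curve over $k$ (of any genus) with function field $K_X$. Fix a separable closure $K_X^{\mathrm{sep}}$ of $K_X$, let $\bar k$ be the algebraic closure of $k$ in $K_X^{\mathrm{sep}}$, and put $G_k=\mathrm{Gal}(\bar k/k)$, $G_X=\mathrm{Gal}(K_X^{\mathrm{sep}}/K_X)$, $G_{\overline X}=\mathrm{Gal}(K_X^{\mathrm{sep}}/K_X\bar k)$. There is an exact sequence of profinite groups $1\to G_{\overline X}\to G_X\xrightarrow{\mathrm{pr}_X} G_k\to 1$. A section of $\mathrm{pr}_X$ is a continuous homomorphism $s:G_k\to G_X$ with $\mathrm{pr}_X\circ s=\mathrm{id}_{G_k}$. For $x\in X(k)$, a decomposition subgroup $D_x\subset G_X$ associated to $x$ is the decomposition group of an extension to $K_X^{\mathrm{sep}}$ of the discrete valuation of $K_X$ defined by $x$; it is well defined up to conjugation by elements of $G_{\overline X}$. "The BGASC holds true for the $k$-curve $X$" means: for every section $s:G_k\to G_X$ of $\mathrm{pr}_X$, there is a unique rational point $x\in X(k)$ such that $s(G_k)$ is contained in a decomposition subgroup $D_x\subset G_X$ associated to $x$. *)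

theory Defs
  imports
    "HOL-Algebra.Algebraic_Closure_Type"
    "HOL-Algebra.Generated_Fields"
    "HOL-Analysis.Abstract_Topology"
begin

text \<open>
  All fields are subfields of one field of characteristic 0, the type \<open>'a\<close>, which plays the
  role of the separable closure \<open>K_X^sep\<close>.  Every field \<open>k\<close> of characteristic 0 occurs as
  such a subfield (take \<open>'a\<close> to be an algebraic closure of \<open>k(t)\<close>).  The function field of any
  curve over \<open>k\<close> is finite over some \<open>k(t)\<close>, so all these function fields have isomorphic
  algebraic closures over \<open>k\<close>, and every one of them has a model inside the same \<open>'a\<close>.
\<close>

abbreviation ambient :: "'a::field_char_0 ring"  (\<open>\<Omega>\<close>)
  where "\<Omega> \<equiv> ring_of_type_algebra"

definition adjoin :: "'a::field_char_0 set \<Rightarrow> 'a set \<Rightarrow> 'a set"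
  where "adjoin F S = generate_field \<Omega> (F \<union> S)"

definition algebraic_elements :: "'a::field_char_0 set \<Rightarrow> 'a set"
  where "algebraic_elements F = {a. (ring.algebraic \<Omega> over F) a}"


section \<open>Curves\<close>

text \<open>
  A proper, smooth, geometrically connected curve over \<open>k\<close> is given by its function field \<open>K\<close>:
  a finitely generated extension of transcendence degree 1 in which \<open>k\<close> is algebraically closed
  (this is geometric connectedness, \<open>H^0(X, O_X) = k\<close>).  The curve is recovered as the abstract
  nonsingular curve of \<open>K / k\<close>: its closed points are the discrete valuation rings
  of \<open>K / k\<close>, a point being identified with its local ring.  The last conjunct fixes \<open>'a\<close> as a
  separable (in characteristic 0, algebraic) closure of \<open>K\<close>.
\<close>

definition curve :: "'a::field_char_0 set \<Rightarrow> 'a set \<Rightarrow> bool"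
  where "curve k K \<longleftrightarrow>
    subfield k \<Omega> \<and> subfield K \<Omega> \<and> k \<subseteq> K \<and>
    (\<exists>t\<in>K. ring.transcendental \<Omega> k t \<and> ring.finite_dimension \<Omega> (adjoin k {t}) K) \<and>
    K \<inter> algebraic_elements k = k \<and>
    algebraic_closure \<Omega> K"

definition projective_line :: "'a::field_char_0 set \<Rightarrow> 'a set \<Rightarrow> bool"
  where "projective_line k K \<longleftrightarrow>
    curve k K \<and> (\<exists>t. ring.transcendental \<Omega> k t \<and> K = adjoin k {t})"

definition maximal_ideal :: "'a::field_char_0 set \<Rightarrow> 'a set"
  where "maximal_ideal R = {a \<in> R. a = 0 \<or> inverse a \<notin> R}"

definition uniformizer :: "'a::field_char_0 set \<Rightarrow> 'a \<Rightarrow> bool"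
  where "uniformizer R t \<longleftrightarrow> t \<noteq> 0 \<and> maximal_ideal R = (\<lambda>a. t * a) ` R"

definition closed_points :: "'a::field_char_0 set \<Rightarrow> 'a set \<Rightarrow> 'a set set"
  where "closed_points k K = {x. subring x \<Omega> \<and> k \<subseteq> x \<and> x \<subseteq> K \<and>
    (\<exists>t. uniformizer x t \<and>
      (\<forall>f\<in>K - {0}. \<exists>n::int. \<exists>u\<in>x - maximal_ideal x. f = u * t powi n))}"

definition valuation :: "'a::field_char_0 set \<Rightarrow> 'a \<Rightarrow> int"
  where "valuation x f =
    (THE n. \<exists>t u. uniformizer x t \<and> u \<in> x - maximal_ideal x \<and> f = u * t powi n)"

definition residue_field :: "'a::field_char_0 set \<Rightarrow> 'a set ring"
  where "residue_field x = (\<Omega>\<lparr>carrier := x\<rparr>) Quot maximal_ideal x"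

definition point_degree :: "'a::field_char_0 set \<Rightarrow> 'a set \<Rightarrow> nat"
  where "point_degree k x =
    (ring.dim (residue_field x) over ((\<lambda>c. maximal_ideal x +>\<^bsub>\<Omega>\<lparr>carrier := x\<rparr>\<^esub> c) ` k))
      (carrier (residue_field x))"

definition rational_points :: "'a::field_char_0 set \<Rightarrow> 'a set \<Rightarrow> 'a set set"
  where "rational_points k K = {x \<in> closed_points k K. point_degree k x = 1}"


section \<open>Genus\<close>

definition divisors :: "'a::field_char_0 set \<Rightarrow> 'a set \<Rightarrow> ('a set \<Rightarrow> int) set"
  where "divisors k K = {D. finite {x. D x \<noteq> 0} \<and> {x. D x \<noteq> 0} \<subseteq> closed_points k K}"

definition divisor_degree :: "'a::field_char_0 set \<Rightarrow> ('a set \<Rightarrow> int) \<Rightarrow> int"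
  where "divisor_degree k D = (\<Sum>x | D x \<noteq> 0. D x * int (point_degree k x))"

definition riemann_roch_space ::
    "'a::field_char_0 set \<Rightarrow> 'a set \<Rightarrow> ('a set \<Rightarrow> int) \<Rightarrow> 'a set"
  where "riemann_roch_space k K D =
    {f \<in> K. f = 0 \<or> (\<forall>x\<in>closed_points k K. valuation x f \<ge> - D x)}"

text \<open>The genus of a function field in one variable, as defined via Riemann's theorem:
  the maximum of \<open>deg D - l(D) + 1\<close> over all divisors \<open>D\<close>.\<close>

definition genus :: "'a::field_char_0 set \<Rightarrow> 'a set \<Rightarrow> int"
  where "genus k K =
    (GREATEST n. \<exists>D\<in>divisors k K.
       n = divisor_degree k D - int ((ring.dim \<Omega> over k) (riemann_roch_space k K D)) + 1)"


section \<open>Galois groups and sections\<close>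

definition gal :: "'a::field_char_0 set \<Rightarrow> 'a set \<Rightarrow> ('a \<Rightarrow> 'a) monoid"
  where "gal L F =
    \<lparr>carrier = {\<sigma> \<in> extensional L. \<sigma> \<in> ring_iso (\<Omega>\<lparr>carrier := L\<rparr>) (\<Omega>\<lparr>carrier := L\<rparr>) \<and>
       (\<forall>a\<in>F. \<sigma> a = a)},
     monoid.mult = compose L,
     monoid.one = (\<lambda>a\<in>L. a)\<rparr>"

definition krull_topology :: "'a::field_char_0 set \<Rightarrow> 'a set \<Rightarrow> ('a \<Rightarrow> 'a) topology"
  where "krull_topology L F = topology_generated_by
    {\<sigma> <#\<^bsub>gal L F\<^esub> carrier (gal L E) |\<sigma> E.
       \<sigma> \<in> carrier (gal L F) \<and>
       subfield E \<Omega> \<and> F \<subseteq> E \<and> E \<subseteq> L \<and> ring.finite_dimension \<Omega> F E}"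

abbreviation G_base :: "'a::field_char_0 set \<Rightarrow> ('a \<Rightarrow> 'a) monoid"
  where "G_base k \<equiv> gal (algebraic_elements k) k"

abbreviation G_curve :: "'a::field_char_0 set \<Rightarrow> ('a \<Rightarrow> 'a) monoid"
  where "G_curve K \<equiv> gal UNIV K"

definition pr :: "'a::field_char_0 set \<Rightarrow> ('a \<Rightarrow> 'a) \<Rightarrow> 'a \<Rightarrow> 'a"
  where "pr k \<sigma> = restrict \<sigma> (algebraic_elements k)"

definition is_section ::
    "'a::field_char_0 set \<Rightarrow> 'a set \<Rightarrow> (('a \<Rightarrow> 'a) \<Rightarrow> 'a \<Rightarrow> 'a) \<Rightarrow> bool"
  where "is_section k K s \<longleftrightarrow>
    s \<in> hom (G_base k) (G_curve K) \<and>
    continuous_map (krull_topology (algebraic_elements k) k) (krull_topology UNIV K) s \<and>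
    (\<forall>\<tau>\<in>carrier (G_base k). pr k (s \<tau>) = \<tau>)"


section \<open>Decomposition groups and the section conjecture\<close>

text \<open>Extensions to \<open>'a\<close> of the valuation of \<open>K\<close> with valuation ring \<open>x\<close>, each given by its
  valuation ring.\<close>

definition valuation_extensions :: "'a::field_char_0 set \<Rightarrow> 'a set \<Rightarrow> 'a set set"
  where "valuation_extensions K x =
    {W. subring W \<Omega> \<and> (\<forall>a. a \<in> W \<or> inverse a \<in> W) \<and> W \<inter> K = x}"

definition decomposition_group :: "'a::field_char_0 set \<Rightarrow> 'a set \<Rightarrow> ('a \<Rightarrow> 'a) set"
  where "decomposition_group K W = {\<sigma> \<in> carrier (G_curve K). \<sigma> ` W = W}"

definition BGASC :: "'a::field_char_0 set \<Rightarrow> 'a set \<Rightarrow> bool"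
  where "BGASC k K \<longleftrightarrow>
    (\<forall>s. is_section k K s \<longrightarrow>
      (\<exists>!x. x \<in> rational_points k K \<and>
        (\<exists>W\<in>valuation_extensions K x. s ` carrier (G_base k) \<subseteq> decomposition_group K W)))"

end

(*
  Let s be a section for P = k(t), let f be the product of t - i for 1 <= i <= 2g+1, and let y be a
  square root of f in the separable closure.  The automorphisms s(tau) send y to chi(tau) y for a
  continuous quadratic character chi of G_k, and by Kummer theory chi(tau) = tau(c) / c for some
  algebraic c with c^2 in k.  So s(G_k) fixes y / c and hence the function field K = P(y / c) of the
  hyperelliptic curve v^2 = c^(-2) f(t), which has genus g; in other words s is also a section for K.
  A valuation ring W of the separable closure that is stable under s(G_k) and induces a closed point
  on K (equivalently, on P) induces a rational one: the residue of an element of W fixed by s(G_k)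
  is algebraic over k and invariant under G_k.  Hence intersecting with P matches the rational points given
  by the conjecture for K with those wanted for P.

  The genus comes from a cofinal family of divisors D, namely the zeros of q(t) plus n times the
  poles of t, for which L(D) is the space of all (a + b y) / q(t) with polynomials a, b of bounded
  degree.
*)
theory Submission
  imports Defs
begin

text \<open>The odd degree 2g+1 of f makes the curve computable: at a pole of t, 2 v(y) = (2g+1)
  v(t), so 2 v(p(t)) and 2 v(r(t) y) are an even and an odd multiple of v(t), the two terms never
  cancel, and the condition at infinity is a matter of degrees. The roots 1, ..., 2g+1 lie in every
  k and are distinct in characteristic 0, so f is square-free and k[t] + k[t] y is integrally
  closed. Since deg D - l(D) does not decrease when D grows, the maximum that defines the genus is
  decided on a cofinal family. There l(D) is an exact count, while deg D is bounded from above by a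
  growth argument: independent residues at the zeros of a function h, made simultaneous by weak
  approximation and multiplied by powers of h, must fit into spaces of polynomials whose dimension
  grows linearly. Points are valuation rings throughout. Passing between K and P is then plain
  intersection; the work lies in showing that discreteness survives in both directions of a
  quadratic extension, and in producing enough places, which is done by a Zorn argument.\<close>

lemma ambient_simps [simp]:
  "carrier \<Omega> = UNIV" "(\<otimes>\<^bsub>\<Omega>\<^esub>) = (*)" "(\<oplus>\<^bsub>\<Omega>\<^esub>) = (+)" "\<one>\<^bsub>\<Omega>\<^esub> = 1" "\<zero>\<^bsub>\<Omega>\<^esub> = 0"
  by (auto simp: ring_of_type_algebra_def fun_eq_iff)

lemma field_ambient: "field (\<Omega> :: 'a::field_char_0 ring)"
  by (rule field_from_type_algebra)

interpretation Om: domain "\<Omega> :: 'a::field_char_0 ring"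
  using field_ambient field.axioms(1) by blast

lemma ambient_a_inv [simp]: "\<ominus>\<^bsub>\<Omega>\<^esub> a = - (a::'a::field_char_0)"
  by (rule Om.minus_equality) auto

lemma ambient_m_inv: "(a::'a::field_char_0) \<noteq> 0 \<Longrightarrow> inv\<^bsub>\<Omega>\<^esub> a = inverse a"
  by (rule Om.inv_char) auto

lemma ambient_pow [simp]: "(a::'a::field_char_0) [^]\<^bsub>\<Omega>\<^esub> (n::nat) = a ^ n"
  by (induction n) auto

section \<open>Subrings and subfields of the ambient field\<close>

context fixes R :: "'a::field_char_0 set" assumes R: "subring R \<Omega>"
begin
lemma subring_0: "0 \<in> R" and subring_1: "1 \<in> R"
  and subring_add: "a \<in> R \<Longrightarrow> b \<in> R \<Longrightarrow> a + b \<in> R"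
  and subring_mult: "a \<in> R \<Longrightarrow> b \<in> R \<Longrightarrow> a * b \<in> R"
  and subring_uminus: "a \<in> R \<Longrightarrow> - a \<in> R"
  using subringE[OF R] by auto
lemma subring_diff: "a \<in> R \<Longrightarrow> b \<in> R \<Longrightarrow> a - b \<in> R"
  using subring_add[of a "- b"] subring_uminus by auto
lemma subring_power: "a \<in> R \<Longrightarrow> a ^ n \<in> R"
  by (induction n) (auto simp: subring_1 subring_mult)
lemma subring_sum: "(\<And>i. i \<in> I \<Longrightarrow> f i \<in> R) \<Longrightarrow> sum f I \<in> R"
  by (induction I rule: infinite_finite_induct) (auto simp: subring_0 subring_add)
lemma subring_prod: "(\<And>i. i \<in> I \<Longrightarrow> f i \<in> R) \<Longrightarrow> prod f I \<in> R"
  by (induction I rule: infinite_finite_induct) (auto simp: subring_1 subring_mult)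
lemma subring_of_nat: "of_nat n \<in> R"
  by (induction n) (auto simp: subring_0 subring_1 subring_add)
end

lemmas subring_closed = subring_0 subring_1 subring_add subring_mult subring_uminus subring_diff
  subring_power subring_sum subring_of_nat

lemma ambient_subringI:
  fixes R :: "'a::field_char_0 set"
  assumes "1 \<in> R" "\<And>a. a \<in> R \<Longrightarrow> - a \<in> R"
    "\<And>a b. a \<in> R \<Longrightarrow> b \<in> R \<Longrightarrow> a + b \<in> R" "\<And>a b. a \<in> R \<Longrightarrow> b \<in> R \<Longrightarrow> a * b \<in> R"
  shows "subring R \<Omega>"
  by (rule Om.subringI) (use assms in auto)

lemma subfield_subring: "subfield k \<Omega> \<Longrightarrow> subring k \<Omega>"
  by (rule subfieldE(1))

context fixes k :: "'a::field_char_0 set" assumes k: "subfield k \<Omega>"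
begin
lemma subfield_inverse: "a \<in> k \<Longrightarrow> inverse a \<in> k"
proof (cases "a = 0")
  case False assume "a \<in> k"
  thus ?thesis using Om.subfield_m_inv(1)[OF k, of a] False by (simp add: ambient_m_inv)
qed auto
lemma subfield_divide: "a \<in> k \<Longrightarrow> b \<in> k \<Longrightarrow> a / b \<in> k"
  using subfield_inverse subring_mult[OF subfield_subring[OF k]] by (simp add: divide_inverse)
lemma subfield_powi: "a \<in> k \<Longrightarrow> a powi n \<in> k"
  using subfield_inverse subring_power[OF subfield_subring[OF k]] by (simp add: power_int_def)
lemma subfield_of_rat: "of_nat n / of_nat m \<in> k"
  using subfield_divide subring_of_nat[OF subfield_subring[OF k]] by auto
end

lemmas subfield_closed = subfield_subring[THEN subring_0] subfield_subring[THEN subring_1]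
  subfield_subring[THEN subring_add] subfield_subring[THEN subring_mult]
  subfield_subring[THEN subring_uminus] subfield_subring[THEN subring_diff]
  subfield_subring[THEN subring_power] subfield_subring[THEN subring_of_nat]
  subfield_inverse subfield_divide subfield_powi
lemmas subfield_sum = subfield_subring[THEN subring_sum]

lemma ambient_subfieldI:
  fixes R :: "'a::field_char_0 set"
  assumes "1 \<in> R" "\<And>a. a \<in> R \<Longrightarrow> - a \<in> R" "\<And>a. a \<in> R \<Longrightarrow> a \<noteq> 0 \<Longrightarrow> inverse a \<in> R"
    "\<And>a b. a \<in> R \<Longrightarrow> b \<in> R \<Longrightarrow> a + b \<in> R" "\<And>a b. a \<in> R \<Longrightarrow> b \<in> R \<Longrightarrow> a * b \<in> R"
  shows "subfield R \<Omega>"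
  by (rule field.subfieldI'[OF field_ambient]) (use assms in \<open>auto simp: ambient_m_inv intro!: ambient_subringI\<close>)

section \<open>Polynomials over a subring\<close>

definition poly_over :: "'a::field_char_0 set \<Rightarrow> 'a poly set"
  where "poly_over k = {p. \<forall>i. coeff p i \<in> k}"

lemma poly_overD: "p \<in> poly_over k \<Longrightarrow> coeff p i \<in> k"
  by (simp add: poly_over_def)

context fixes R :: "'a::field_char_0 set" assumes R: "subring R \<Omega>"
begin
lemma poly_over_0: "0 \<in> poly_over R" and poly_over_1: "1 \<in> poly_over R"
  and poly_over_add: "p \<in> poly_over R \<Longrightarrow> q \<in> poly_over R \<Longrightarrow> p + q \<in> poly_over R"
  and poly_over_diff: "p \<in> poly_over R \<Longrightarrow> q \<in> poly_over R \<Longrightarrow> p - q \<in> poly_over R"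
  and poly_over_uminus: "p \<in> poly_over R \<Longrightarrow> - p \<in> poly_over R"
  and poly_over_smult: "c \<in> R \<Longrightarrow> p \<in> poly_over R \<Longrightarrow> smult c p \<in> poly_over R"
  and poly_over_monom: "c \<in> R \<Longrightarrow> monom c n \<in> poly_over R"
  using R by (auto simp: poly_over_def subring_closed one_pCons coeff_pCons split: nat.splits)
lemma poly_over_mult: "p \<in> poly_over R \<Longrightarrow> q \<in> poly_over R \<Longrightarrow> p * q \<in> poly_over R"
  using R by (auto simp: poly_over_def coeff_mult intro!: subring_sum subring_mult)
lemma poly_over_pCons: "pCons c p \<in> poly_over R \<longleftrightarrow> c \<in> R \<and> p \<in> poly_over R"
  by (auto simp: poly_over_def coeff_pCons split: nat.splits)
lemma poly_over_power: "p \<in> poly_over R \<Longrightarrow> p ^ n \<in> poly_over R"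
  by (induction n) (auto simp: poly_over_1 poly_over_mult)
lemma poly_over_prod: "(\<And>i. i \<in> I \<Longrightarrow> f i \<in> poly_over R) \<Longrightarrow> prod f I \<in> poly_over R"
  by (induction I rule: infinite_finite_induct) (auto simp: poly_over_1 poly_over_mult)
lemma poly_in_subring: "p \<in> poly_over R \<Longrightarrow> a \<in> R \<Longrightarrow> poly p a \<in> R"
  using R by (auto simp: poly_altdef poly_over_def intro!: subring_sum subring_mult subring_power)
end

lemma poly_over_mono: "R \<subseteq> S \<Longrightarrow> poly_over R \<subseteq> poly_over S"
  by (auto simp: poly_over_def)

lemmas poly_over_closed = poly_over_0 poly_over_1 poly_over_add poly_over_diff poly_over_uminus
  poly_over_smult poly_over_monom poly_over_mult poly_over_power

lemma poly_over_division:
  fixes k :: "'a::field_char_0 set"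
  assumes k: "subfield k \<Omega>" and m: "m \<in> poly_over k" "m \<noteq> 0" and p: "p \<in> poly_over k"
  obtains q r where "q \<in> poly_over k" "r \<in> poly_over k" "p = q * m + r" "r = 0 \<or> degree r < degree m"
proof -
  note kr = subfield_subring[OF k]
  have "\<exists>q r. q \<in> poly_over k \<and> r \<in> poly_over k \<and> p = q * m + r \<and> (r = 0 \<or> degree r < degree m)"
    using p
  \<comment> \<open>The measure puts 0 strictly below the nonzero constants, so cancelling a
    constant dividend also counts as progress.\<close>
  proof (induction "if p = 0 then 0 else Suc (degree p)" arbitrary: p rule: less_induct)
    case less
    show ?case
    proof (cases "p = 0 \<or> degree p < degree m")
      case True
      thus ?thesis using less.prems kr by (intro exI[of _ 0] exI[of _ p]) (auto simp: poly_over_0)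
    next
      case False
      define s where "s = monom (lead_coeff p / lead_coeff m) (degree p - degree m)"
      have s: "s \<in> poly_over k" unfolding s_def
        by (intro poly_over_monom kr subfield_divide k) (use less.prems m in \<open>auto simp: poly_over_def\<close>)
      define p' where "p' = p - s * m"
      have p': "p' \<in> poly_over k" unfolding p'_def using s m less.prems kr by (intro poly_over_closed)
      have cf: "lead_coeff p / lead_coeff m \<noteq> 0" using False m by auto
      have dsm: "degree (s * m) = degree p"
        using False m cf by (auto simp: s_def degree_mult_eq degree_monom_eq monom_eq_0_iff)
      have lsm: "lead_coeff (s * m) = lead_coeff p"
        using False m cf by (subst lead_coeff_mult) (auto simp: s_def lead_coeff_monom degree_monom_eq)
      have "p' = 0 \<or> degree p' < degree p"
      proof (cases "degree p = 0")
        case True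
        hence "degree p' = 0" "coeff p' 0 = 0"
          using dsm lsm True degree_diff_le[of p 0 "s*m"] unfolding p'_def by auto
        thus ?thesis by (auto elim!: degree_eq_zeroE)
      next
        case dp: False
        have "degree p' \<le> degree p" unfolding p'_def using dsm by (intro degree_diff_le) auto
        moreover have "coeff p' (degree p) = 0" unfolding p'_def using dsm lsm by simp
        ultimately show ?thesis by (metis eq_zero_or_degree_less)
      qed
      hence lt: "(if p' = 0 then 0 else Suc (degree p')) < (if p = 0 then 0 else Suc (degree p))"
        using False by auto
      obtain q r where "q \<in> poly_over k" "r \<in> poly_over k" "p' = q * m + r" "r = 0 \<or> degree r < degree m"
        using less.hyps[OF lt p'] by blast
      thus ?thesis using s kr by (intro exI[of _ "q + s"] exI[of _ r])
        (auto simp: p'_def algebra_simps poly_over_add)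
    qed
  qed
  thus ?thesis using that by blast
qed

text \<open>HOL-Algebra polynomials are coefficient lists with the leading coefficient first, hence
  \<open>rev\<close>.\<close>

lemma eval_eq_poly: "ring.eval \<Omega> p (a::'a::field_char_0) = poly (Poly (rev p)) a"
proof (induction p)
  case (Cons c p)
  thus ?case by (simp add: Poly_append poly_monom)
qed simp

lemma list_poly_over:
  fixes k :: "'a::field_char_0 set" assumes "subring k \<Omega>" "set p \<subseteq> k"
  shows "Poly p \<in> poly_over k"
  using assms by (auto simp: poly_over_def coeff_Poly_eq nth_default_def subring_0)

section \<open>Algebraic and transcendental elements\<close>

lemma transcendental_iff:
  fixes F :: "'a::field_char_0 set" assumes F: "subfield F \<Omega>"
  shows "ring.transcendental \<Omega> F a \<longleftrightarrow> (\<forall>p\<in>poly_over F. poly p a = 0 \<longrightarrow> p = 0)"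
proof
  assume tr: "ring.transcendental \<Omega> F a"
  show "\<forall>p\<in>poly_over F. poly p a = 0 \<longrightarrow> p = 0"
  proof (intro ballI impI, rule ccontr)
    fix p assume p: "p \<in> poly_over F" "poly p a = 0" "p \<noteq> 0"
    define l where "l = rev (coeffs p)"
    have "l \<in> carrier (univ_poly \<Omega> F)"
      using p by (auto simp: l_def univ_poly_def polynomial_def hd_rev last_coeffs_eq_coeff_degree
          coeffs_def poly_over_def)
    moreover have "Om.eval l a = 0" using p by (simp add: eval_eq_poly l_def)
    ultimately have "l = []" using Om.eval_transcendental[of F a l] tr by (simp add: over_def)
    thus False using p by (simp add: l_def)
  qed
next
  assume R: "\<forall>p\<in>poly_over F. poly p a = 0 \<longrightarrow> p = 0"
  show "ring.transcendental \<Omega> F a"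
  proof (rule ccontr)
    assume "\<not> Om.transcendental F a"
    then obtain l where l: "l \<in> carrier (univ_poly \<Omega> F)" "l \<noteq> []" "Om.eval l a = 0"
      using Om.algebraicE[of F a] subfield_subring[OF F] by (auto simp: over_def)
    hence s: "set l \<subseteq> F" "hd l \<noteq> 0" by (auto simp: univ_poly_def polynomial_def)
    have "Poly (rev l) \<in> poly_over F" using s list_poly_over[of F "rev l"] subfield_subring[OF F] by auto
    hence "Poly (rev l) = 0" using R l by (auto simp: eval_eq_poly)
    moreover have "coeff (Poly (rev l)) (length l - 1) = hd l" using l(2)
      by (simp add: coeff_Poly_eq nth_default_def rev_nth hd_conv_nth)
    ultimately show False using s by simp
  qed
qed

lemma algebraic_iff:
  fixes F :: "'a::field_char_0 set" assumes F: "subfield F \<Omega>"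
  shows "a \<in> algebraic_elements F \<longleftrightarrow> (\<exists>p\<in>poly_over F. p \<noteq> 0 \<and> poly p a = 0)"
  using transcendental_iff[OF F, of a] by (auto simp: algebraic_elements_def over_def)

lemma subfield_algebraic_elements:
  fixes F :: "'a::field_char_0 set" assumes F: "subfield F \<Omega>"
  shows "subfield (algebraic_elements F) \<Omega>"
  using field.subfield_of_algebraics[OF field_ambient F] by (simp add: algebraic_elements_def)

lemma subset_algebraic_elements:
  fixes F :: "'a::field_char_0 set" assumes F: "subfield F \<Omega>"
  shows "F \<subseteq> algebraic_elements F"
  using Om.algebraic_self[OF subfield_subring[OF F]] by (auto simp: algebraic_elements_def)

lemma adjoin_eqI:
  fixes k :: "'a::field_char_0 set"
  assumes "subfield E \<Omega>" "k \<subseteq> E" "t \<in> E" "\<And>K. subfield K \<Omega> \<Longrightarrow> k \<subseteq> K \<Longrightarrow> t \<in> K \<Longrightarrow> E \<subseteq> K"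
  shows "adjoin k {t} = E"
  unfolding adjoin_def by (rule field.generate_fieldI[OF field_ambient, symmetric]) (use assms in auto)

lemma adjoin_transcendental:
  fixes k :: "'a::field_char_0 set"
  assumes k: "subfield k \<Omega>" and t: "ring.transcendental \<Omega> k t"
  shows "adjoin k {t} = {poly p t / poly q t | p q. p \<in> poly_over k \<and> q \<in> poly_over k \<and> q \<noteq> 0}"
    (is "_ = ?E")
proof (rule adjoin_eqI)
  note kr = subfield_subring[OF k]
  have tr: "poly q t \<noteq> 0" if "q \<in> poly_over k" "q \<noteq> 0" for q
    using that t transcendental_iff[OF k] by auto
  show sub: "k \<subseteq> ?E"
  proof
    fix c assume "c \<in> k"
    thus "c \<in> ?E" using kr
      by (intro CollectI exI[of _ "[:c:]"] exI[of _ 1]) (auto simp: poly_over_closed poly_over_pCons)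
  qed
  show "t \<in> ?E" using kr
    by (intro CollectI exI[of _ "[:0, 1:]"] exI[of _ 1]) (auto simp: poly_over_closed poly_over_pCons subring_closed)
  show "subfield ?E \<Omega>"
  proof (rule ambient_subfieldI)
    show "1 \<in> ?E" using sub k subfield_closed by blast
    fix a assume "a \<in> ?E"
    then obtain p q where pq: "a = poly p t / poly q t" "p \<in> poly_over k" "q \<in> poly_over k" "q \<noteq> 0" by auto
    have "- a = poly (- p) t / poly q t" using pq by simp
    thus "- a \<in> ?E" using poly_over_uminus[OF kr pq(2)] pq(3,4) by blast
    have "inverse a = poly q t / poly p t" using pq by simp
    thus "inverse a \<in> ?E" if "a \<noteq> 0" using pq that by fastforce
    fix b assume "b \<in> ?E"
    then obtain p' q' where pq': "b = poly p' t / poly q' t" "p' \<in> poly_over k" "q' \<in> poly_over k" "q' \<noteq> 0" by auto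
    have qq: "q * q' \<in> poly_over k" "q * q' \<noteq> 0" using poly_over_mult[OF kr pq(3) pq'(3)] pq pq' by auto
    have "a * b = poly (p * p') t / poly (q * q') t" using pq pq' by simp
    thus "a * b \<in> ?E" using poly_over_mult[OF kr pq(2) pq'(2)] qq by blast
    have "a + b = poly (p * q' + p' * q) t / poly (q * q') t"
      using pq(1) pq'(1) tr[OF pq(3,4)] tr[OF pq'(3,4)] by (simp add: add_frac_eq)
    moreover have "p * q' + p' * q \<in> poly_over k"
      by (intro poly_over_add poly_over_mult kr pq pq')
    ultimately show "a + b \<in> ?E" using qq by blast
  qed
  fix K assume K: "subfield K \<Omega>" "k \<subseteq> K" "t \<in> K"
  show "?E \<subseteq> K"
  proof
    fix a assume "a \<in> ?E"
    then obtain p q where pq: "a = poly p t / poly q t" "p \<in> poly_over K" "q \<in> poly_over K"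
      using poly_over_mono[OF K(2)] by auto
    thus "a \<in> K"
      using subfield_divide[OF K(1)] poly_in_subring[OF subfield_subring[OF K(1)] _ K(3)] by auto
  qed
qed

lemma algebraic_closure_imp_closed:
  assumes "algebraic_closure L k" shows "algebraically_closed L"
proof -
  interpret algebraic_closure L k by fact
  show ?thesis by (rule algebraically_closed_axioms)
qed

lemma algebraically_closed_root:
  fixes k :: "'a::field_char_0 set" and p :: "'a poly"
  assumes "algebraic_closure \<Omega> k" "degree p > 0"
  shows "\<exists>x. poly p x = 0"
proof -
  define l where "l = rev (coeffs p)"
  have "set l \<subseteq> UNIV" "hd l \<noteq> 0"
    using assms(2) last_coeffs_eq_coeff_degree[of p] by (cases "p = 0"; simp add: l_def hd_rev)+
  hence l: "l \<in> carrier (poly_ring \<Omega>)" by (simp add: univ_poly_def polynomial_def)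
  have "Om.splitted l" by (rule algebraically_closed.roots_over_carrier[OF algebraic_closure_imp_closed[OF assms(1)] l])
  moreover have "Polynomials.degree l = degree p" by (simp add: l_def degree_eq_length_coeffs)
  ultimately have "Om.roots l \<noteq> {#}" using assms(2) unfolding Om.splitted_def by auto
  then obtain x where "x \<in># Om.roots l" by blast
  hence "Om.is_root l x" using Om.roots_mem_iff_is_root[OF l] by auto
  thus ?thesis using eval_eq_poly[of l x] by (auto simp: Om.is_root_def l_def)
qed

lemma algebraic_closure_extend:
  fixes k :: "'a::field_char_0 set"
  assumes a: "algebraic_closure \<Omega> k" and K: "subfield K \<Omega>" "k \<subseteq> K"
  shows "algebraic_closure \<Omega> K"
proof -
  show ?thesis
  proof (intro algebraic_closure.intro algebraic_closure_axioms.intro)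
    show "field \<Omega>" by (rule field_ambient)
    show "subfield K \<Omega>" by fact
    show "(Om.algebraic over K) x" for x
      using algebraic_closure.algebraic_extension[OF a, of x] Om.transcendental_mono[OF K(2)]
      by (auto simp: over_def)
    show "Om.splitted P" if "P \<in> carrier (K [X]\<^bsub>\<Omega>\<^esub>)" for P
      using that by (intro algebraically_closed.roots_over_carrier[OF algebraic_closure_imp_closed[OF a]]) (auto simp: univ_poly_def polynomial_def)
  qed
qed

section \<open>Finite-dimensional extensions as spans\<close>

lemma finite_dimension_Span:
  fixes F :: "'a::field_char_0 set" assumes F: "subfield F \<Omega>"
  shows "ring.finite_dimension \<Omega> F E \<longleftrightarrow> (\<exists>xs. E = ring.Span \<Omega> F xs)"
proof
  assume "Om.finite_dimension F E"
  thus "\<exists>xs. E = Om.Span F xs" using Om.exists_base[OF F] by (auto simp: Om.finite_dimension_def)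
next
  assume "\<exists>xs. E = Om.Span F xs"
  then obtain xs where xs: "E = Om.Span F xs" by blast
  obtain ys where "Om.independent F ys" "Om.Span F ys = Om.Span F xs"
    using Om.filter_base[OF F, of xs thesis] by simp
  hence "E = Om.Span F ys" "Om.independent F ys" using xs by auto
  thus "Om.finite_dimension F E"
    using Om.dimension_independent by (auto simp: Om.finite_dimension_def)
qed

lemma (in ring) combine_map_eq_finsum:
  "distinct xs \<Longrightarrow> c ` set xs \<subseteq> carrier R \<Longrightarrow> u ` set xs \<subseteq> carrier R \<Longrightarrow>
   combine (map c xs) (map u xs) = (\<Oplus>j\<in>set xs. c j \<otimes> u j)"
proof (induction xs)
  case (Cons x xs)
  thus ?case by (subst list.set(2), subst finsum_insert) (auto simp: image_subset_iff Pi_iff)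
qed simp

lemma finsum_ambient: "finite I \<Longrightarrow> finsum \<Omega> f I = (sum f I :: 'a::field_char_0)"
  by (induction I rule: finite_induct) auto

lemma combine_ambient:
  "distinct xs \<Longrightarrow> ring.combine \<Omega> (map c xs) (map u xs) = (\<Sum>j\<in>set xs. c j * (u j::'a::field_char_0))"
  by (subst Om.combine_map_eq_finsum) (auto simp: finsum_ambient)

lemma mem_Span_iff:
  fixes F :: "'a::field_char_0 set" assumes F: "subfield F \<Omega>"
  shows "a \<in> ring.Span \<Omega> F xs \<longleftrightarrow> (\<exists>c. (\<forall>i<length xs. c i \<in> F) \<and> a = (\<Sum>i<length xs. c i * xs ! i))"
proof -
  have eq: "Om.combine Ks xs = (\<Sum>i<length xs. Ks ! i * xs ! i)" if "length Ks = length xs" for Ks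
  proof -
    have "Om.combine Ks xs = Om.combine (map ((!) Ks) [0..<length xs]) (map ((!) xs) [0..<length xs])"
      using that by (metis map_nth)
    also have "\<dots> = (\<Sum>i<length xs. Ks ! i * xs ! i)"
      by (subst combine_ambient) (simp_all add: atLeast0LessThan)
    finally show ?thesis .
  qed
  show ?thesis
  proof
    assume "a \<in> Om.Span F xs"
    then obtain Ks where "set Ks \<subseteq> F" "length Ks = length xs" "a = Om.combine Ks xs"
      using Om.Span_mem_iff_length_version[OF F, of xs a] by auto
    thus "\<exists>c. (\<forall>i<length xs. c i \<in> F) \<and> a = (\<Sum>i<length xs. c i * xs ! i)"
      by (intro exI[of _ "(!) Ks"]) (use eq in auto)
  next
    assume "\<exists>c. (\<forall>i<length xs. c i \<in> F) \<and> a = (\<Sum>i<length xs. c i * xs ! i)"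
    then obtain c where c: "\<forall>i<length xs. c i \<in> F" "a = (\<Sum>i<length xs. c i * xs ! i)" by blast
    have "a = Om.combine (map c [0..<length xs]) xs" by (subst eq) (use c in auto)
    thus "a \<in> Om.Span F xs"
      using Om.Span_mem_iff_length_version[OF F, of xs a] c
      by (auto intro!: exI[of _ "map c [0..<length xs]"])
  qed
qed

section \<open>Linear algebra modulo a subspace\<close>

definition k_subspace :: "'a::field_char_0 set \<Rightarrow> 'a set \<Rightarrow> bool"
  where "k_subspace k B \<longleftrightarrow> 0 \<in> B \<and> (\<forall>a\<in>B. \<forall>b\<in>B. a + b \<in> B) \<and> (\<forall>c\<in>k. \<forall>a\<in>B. c * a \<in> B)"

text \<open>Linear algebra relative to a subspace B serves three purposes without forming quotients:
  B = {0} for the spaces L(D), B the maximal ideal for residue fields, and B = L(D) for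
  L(E)/L(D).\<close>

definition indep_mod :: "'a::field_char_0 set \<Rightarrow> 'a set \<Rightarrow> 'i set \<Rightarrow> ('i \<Rightarrow> 'a) \<Rightarrow> bool"
  where "indep_mod k B I u \<longleftrightarrow>
    (\<forall>c. (\<forall>i\<in>I. c i \<in> k) \<longrightarrow> (\<Sum>i\<in>I. c i * u i) \<in> B \<longrightarrow> (\<forall>i\<in>I. c i = 0))"

definition gen_mod :: "'a::field_char_0 set \<Rightarrow> 'a set \<Rightarrow> 'i set \<Rightarrow> ('i \<Rightarrow> 'a) \<Rightarrow> 'a set \<Rightarrow> bool"
  where "gen_mod k B I u A \<longleftrightarrow> (\<forall>a\<in>A. \<exists>c. (\<forall>i\<in>I. c i \<in> k) \<and> a - (\<Sum>i\<in>I. c i * u i) \<in> B)"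

definition basis_mod :: "'a::field_char_0 set \<Rightarrow> 'a set \<Rightarrow> 'a set \<Rightarrow> 'i set \<Rightarrow> ('i \<Rightarrow> 'a) \<Rightarrow> bool"
  where "basis_mod k B A I u \<longleftrightarrow> finite I \<and> u ` I \<subseteq> A \<and> indep_mod k B I u \<and> gen_mod k B I u A"

lemma k_subspace_sum:
  assumes "k_subspace k B" "\<And>i. i \<in> I \<Longrightarrow> c i \<in> k" "\<And>i. i \<in> I \<Longrightarrow> u i \<in> B"
  shows "(\<Sum>i\<in>I. c i * u i) \<in> B"
  using assms by (induction I rule: infinite_finite_induct) (auto simp: k_subspace_def)

lemma k_subspace_0: "subfield k \<Omega> \<Longrightarrow> k_subspace k {0}"
  by (auto simp: k_subspace_def)

lemma indep_modD:
  "indep_mod k B I u \<Longrightarrow> (\<And>i. i \<in> I \<Longrightarrow> c i \<in> k) \<Longrightarrow> (\<Sum>i\<in>I. c i * u i) \<in> B \<Longrightarrow> i \<in> I \<Longrightarrow> c i = 0"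
  unfolding indep_mod_def by blast

lemma indep_mod_subset:
  fixes k :: "'a::field_char_0 set"
  assumes k: "subfield k \<Omega>" and u: "indep_mod k B I u" and J: "J \<subseteq> I" "finite I"
  shows "indep_mod k B J u"
  unfolding indep_mod_def
proof (intro allI impI ballI)
  fix c j assume c: "\<forall>i\<in>J. c i \<in> k" "(\<Sum>i\<in>J. c i * u i) \<in> B" "j \<in> J"
  have "(\<Sum>i\<in>I. (if i \<in> J then c i else 0) * u i) = (\<Sum>i\<in>J. c i * u i)"
    using J by (intro sum.mono_neutral_cong_right) auto
  hence "(\<Sum>i\<in>I. (if i \<in> J then c i else 0) * u i) \<in> B" using c by simp
  hence "(if j \<in> J then c j else 0) = 0"
    by (rule indep_modD[OF u, rotated]) (use c J subfield_closed(1)[OF k] in auto)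
  thus "c j = 0" using c by simp
qed

text \<open>Gaussian elimination, by induction on the number of equations: an unknown with nonzero
  coefficient in equation j is eliminated from the others, and the smaller system still has more
  unknowns than equations.\<close>

lemma homogeneous_system:
  fixes k :: "'a::field_char_0 set" and a :: "'i \<Rightarrow> 'j \<Rightarrow> 'a"
  assumes k: "subfield k \<Omega>" and "finite J" "finite I" "card J < card I" "\<And>i j. i \<in> I \<Longrightarrow> j \<in> J \<Longrightarrow> a i j \<in> k"
  shows "\<exists>c. (\<forall>i\<in>I. c i \<in> k) \<and> (\<exists>i\<in>I. c i \<noteq> 0) \<and> (\<forall>j\<in>J. (\<Sum>i\<in>I. c i * a i j) = 0)"
  using assms(2-)
proof (induction J arbitrary: I a rule: finite_induct)
  case empty
  then obtain i where "i \<in> I" by fastforce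
  thus ?case using k subfield_closed by (intro exI[of _ "\<lambda>_. 1"]) auto
next
  case (insert j J)
  show ?case
  proof (cases "\<forall>i\<in>I. a i j = 0")
    case True
    have "\<exists>c. (\<forall>i\<in>I. c i \<in> k) \<and> (\<exists>i\<in>I. c i \<noteq> 0) \<and> (\<forall>j\<in>J. (\<Sum>i\<in>I. c i * a i j) = 0)"
      using insert by (intro insert.IH) auto
    then obtain c where c: "\<forall>i\<in>I. c i \<in> k" "\<exists>i\<in>I. c i \<noteq> 0" "\<forall>j\<in>J. (\<Sum>i\<in>I. c i * a i j) = 0" by blast
    show ?thesis using c True by (intro exI[of _ c]) auto
  next
    case False
    then obtain i0 where i0: "i0 \<in> I" "a i0 j \<noteq> 0" by blast
    define a' where "a' i l = a i l - a i j / a i0 j * a i0 l" for i l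
    have "\<exists>c. (\<forall>i\<in>I-{i0}. c i \<in> k) \<and> (\<exists>i\<in>I-{i0}. c i \<noteq> 0) \<and> (\<forall>j\<in>J. (\<Sum>i\<in>I-{i0}. c i * a' i j) = 0)"
    proof (rule insert.IH)
      show "card J < card (I - {i0})" using insert i0 by auto
      show "a' i l \<in> k" if "i \<in> I - {i0}" "l \<in> J" for i l
        unfolding a'_def using that insert.prems i0
        by (intro subfield_closed k) auto
    qed (use insert in auto)
    then obtain c where c: "\<forall>i\<in>I-{i0}. c i \<in> k" "\<exists>i\<in>I-{i0}. c i \<noteq> 0"
      "\<forall>j\<in>J. (\<Sum>i\<in>I-{i0}. c i * a' i j) = 0" by blast
    define s where "s = (\<Sum>i\<in>I-{i0}. c i * a i j)"
    \<comment> \<open>The eliminated unknown is recovered from equation j.\<close>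
    define c' where "c' = c(i0 := - s / a i0 j)"
    have sk: "s \<in> k" unfolding s_def using c insert.prems k by (intro subfield_sum subfield_closed) auto
    have c'k: "c' i \<in> k" if "i \<in> I" for i
      using that c sk i0 insert.prems k by (auto simp: c'_def intro!: subfield_closed)
    have split: "(\<Sum>i\<in>I. c' i * a i l) = - s / a i0 j * a i0 l + (\<Sum>i\<in>I-{i0}. c i * a i l)" for l
    proof -
      have "(\<Sum>i\<in>I. c' i * a i l) = c' i0 * a i0 l + (\<Sum>i\<in>I-{i0}. c' i * a i l)"
        using i0 insert.prems by (intro sum.remove) auto
      also have "(\<Sum>i\<in>I-{i0}. c' i * a i l) = (\<Sum>i\<in>I-{i0}. c i * a i l)"
        by (intro sum.cong) (auto simp: c'_def)
      finally show ?thesis by (simp add: c'_def)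
    qed
    have "(\<Sum>i\<in>I. c' i * a i l) = 0" if l: "l \<in> insert j J" for l
    proof (cases "l = j")
      case True thus ?thesis using split[of j] i0 by (simp add: s_def)
    next
      case False
      hence "0 = (\<Sum>i\<in>I-{i0}. c i * a' i l)" using l c by auto
      also have "\<dots> = (\<Sum>i\<in>I-{i0}. c i * a i l) - s / a i0 j * a i0 l"
      proof -
        have "(\<Sum>i\<in>I-{i0}. c i * a' i l)
            = (\<Sum>i\<in>I-{i0}. c i * a i l - (c i * a i j) * (a i0 l / a i0 j))"
          by (intro sum.cong) (auto simp: a'_def algebra_simps)
        also have "\<dots> = (\<Sum>i\<in>I-{i0}. c i * a i l) - s * (a i0 l / a i0 j)"
          unfolding s_def sum_distrib_right sum_subtractf ..
        finally show ?thesis by simp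
      qed
      finally show ?thesis using split[of l] by simp
    qed
    moreover have "\<exists>i\<in>I. c' i \<noteq> 0" using c(2) by (auto simp: c'_def)
    ultimately show ?thesis using c'k by blast
  qed
qed

text \<open>Expand each v in the u modulo B. If there were more v than u, the matrix of coefficients
  would have a nontrivial kernel vector, and this is a forbidden relation among the v.\<close>

lemma steinitz:
  fixes k :: "'a::field_char_0 set"
  assumes k: "subfield k \<Omega>" and B: "k_subspace k B"
    and v: "indep_mod k B I v" "v ` I \<subseteq> A" "finite I" and u: "gen_mod k B J u A" "finite J"
  shows "card I \<le> card J"
proof (rule ccontr)
  assume "\<not> card I \<le> card J"
  have "\<forall>i\<in>I. \<exists>c. (\<forall>j\<in>J. c j \<in> k) \<and> v i - (\<Sum>j\<in>J. c j * u j) \<in> B"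
    using u(1) v(2) by (auto simp: gen_mod_def)
  then obtain a where a: "\<And>i j. i \<in> I \<Longrightarrow> j \<in> J \<Longrightarrow> a i j \<in> k"
    "\<And>i. i \<in> I \<Longrightarrow> v i - (\<Sum>j\<in>J. a i j * u j) \<in> B" by metis
  obtain c where c: "\<forall>i\<in>I. c i \<in> k" "\<exists>i\<in>I. c i \<noteq> 0" "\<forall>j\<in>J. (\<Sum>i\<in>I. c i * a i j) = 0"
    using homogeneous_system[OF k u(2) v(3), of a] a(1) \<open>\<not> card I \<le> card J\<close> by auto
  have "(\<Sum>i\<in>I. c i * (v i - (\<Sum>j\<in>J. a i j * u j))) \<in> B"
    using B c a by (intro k_subspace_sum) auto
  also have "(\<Sum>i\<in>I. c i * (v i - (\<Sum>j\<in>J. a i j * u j)))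
      = (\<Sum>i\<in>I. c i * v i) - (\<Sum>i\<in>I. \<Sum>j\<in>J. c i * a i j * u j)"
    by (simp add: right_diff_distrib sum_subtractf sum_distrib_left mult.assoc)
  also have "(\<Sum>i\<in>I. \<Sum>j\<in>J. c i * a i j * u j) = (\<Sum>j\<in>J. (\<Sum>i\<in>I. c i * a i j) * u j)"
    by (subst sum.swap) (simp add: sum_distrib_right)
  also have "\<dots> = 0" using c by simp
  finally have "(\<Sum>i\<in>I. c i * v i) \<in> B" by simp
  thus False using v(1) c unfolding indep_mod_def by blast
qed

text \<open>An independent family of maximal length generates: adjoining any further a creates a
  relation in which a has a nonzero coefficient. The bound N ensures that a maximal length
  exists.\<close>

lemma exists_basis_mod:
  fixes k :: "'a::field_char_0 set"
  assumes k: "subfield k \<Omega>" and B: "k_subspace k B"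
    and bound: "\<And>n (u :: nat \<Rightarrow> 'a). indep_mod k B {..<n} u \<Longrightarrow> u ` {..<n} \<subseteq> A \<Longrightarrow> n \<le> N"
  obtains n u where "n \<le> N" "basis_mod k B A {..<n::nat} u"
proof -
  define P where "P n \<longleftrightarrow> (\<exists>u. indep_mod k B {..<n} u \<and> u ` {..<n::nat} \<subseteq> A)" for n
  have P0: "P 0" by (auto simp: P_def indep_mod_def)
  have PN: "\<And>n. P n \<Longrightarrow> n \<le> N" using bound by (auto simp: P_def)
  define n where "n = (GREATEST n. P n)"
  have Pn: "P n" unfolding n_def by (rule GreatestI_nat[of P 0 N]) (use P0 PN in auto)
  have max: "\<And>m. P m \<Longrightarrow> m \<le> n" unfolding n_def by (rule Greatest_le_nat[of P _ N]) (use PN in auto)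
  from Pn obtain u where u: "indep_mod k B {..<n} u" "u ` {..<n} \<subseteq> A" by (auto simp: P_def)
  have "gen_mod k B {..<n} u A"
    unfolding gen_mod_def
  proof
    fix a assume a: "a \<in> A"
    have "\<not> P (Suc n)" using max by force
    moreover have "(u(n := a)) ` {..<Suc n} \<subseteq> A" using u a by (auto simp: less_Suc_eq)
    ultimately have "\<not> indep_mod k B {..<Suc n} (u(n := a))" unfolding P_def by blast
    then obtain c i where c: "\<forall>i<Suc n. c i \<in> k" "(\<Sum>i<Suc n. c i * (u(n := a)) i) \<in> B" "i < Suc n" "c i \<noteq> 0"
      by (auto simp: indep_mod_def)
    have eq: "(\<Sum>i<Suc n. c i * (u(n := a)) i) = (\<Sum>i<n. c i * u i) + c n * a" by simp
    have cn: "c n \<noteq> 0"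
    proof
      assume "c n = 0"
      hence "(\<Sum>i<n. c i * u i) \<in> B" using c(2) eq by simp
      hence "\<forall>i\<in>{..<n}. c i = 0" using u(1) c(1) unfolding indep_mod_def by simp
      thus False using c \<open>c n = 0\<close> by (auto simp: less_Suc_eq)
    qed
    have "inverse (c n) * ((\<Sum>i<n. c i * u i) + c n * a) \<in> B"
      using B c eq k subfield_inverse[OF k] by (auto simp: k_subspace_def)
    also have "inverse (c n) * ((\<Sum>i<n. c i * u i) + c n * a) = inverse (c n) * (\<Sum>i<n. c i * u i) + a"
      using cn by (simp add: algebra_simps)
    also have "\<dots> = a - (\<Sum>i<n. (- c i / c n) * u i)"
      by (simp add: sum_negf sum_distrib_left divide_inverse mult_ac)
    finally show "\<exists>c. (\<forall>i\<in>{..<n}. c i \<in> k) \<and> a - (\<Sum>i<n. c i * u i) \<in> B"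
      using c by (intro exI[of _ "\<lambda>i. - c i / c n"]) (auto intro!: subfield_closed k)
  qed
  thus ?thesis using that[of n u] u PN[OF Pn] by (auto simp: basis_mod_def)
qed

text \<open>An upper bound for dim A/B. The generators may lie outside A, so that a set A which is
  not even a subspace can be measured by a larger space containing it.\<close>

definition codim_le :: "'a::field_char_0 set \<Rightarrow> 'a set \<Rightarrow> 'a set \<Rightarrow> nat \<Rightarrow> bool"
  where "codim_le k A B n \<longleftrightarrow> (\<exists>m\<le>n. \<exists>u. gen_mod k B {..<m::nat} u A)"

lemma gen_mod_reindex:
  assumes u: "gen_mod k B I u A" and h: "bij_betw h J I"
  shows "gen_mod k B J (u \<circ> h) A"
  unfolding gen_mod_def
proof
  fix a assume "a \<in> A"
  then obtain c where c: "\<forall>i\<in>I. c i \<in> k" "a - (\<Sum>i\<in>I. c i * u i) \<in> B" using u by (auto simp: gen_mod_def)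
  have "(\<Sum>i\<in>J. (c \<circ> h) i * (u \<circ> h) i) = (\<Sum>i\<in>I. c i * u i)"
    using sum.reindex_bij_betw[OF h, of "\<lambda>i. c i * u i"] by simp
  thus "\<exists>c. (\<forall>i\<in>J. c i \<in> k) \<and> a - (\<Sum>i\<in>J. c i * (u \<circ> h) i) \<in> B"
    using c h by (intro exI[of _ "c \<circ> h"]) (auto simp: bij_betw_def)
qed

lemma codim_leI:
  assumes "gen_mod k B I u A" "finite I" "card I \<le> n"
  shows "codim_le k A B n"
proof -
  obtain h where h: "bij_betw h {..<card I} I"
    using ex_bij_betw_nat_finite[OF assms(2)] by (auto simp: atLeast0LessThan)
  show ?thesis using gen_mod_reindex[OF assms(1) h] assms(3) by (auto simp: codim_le_def)
qed

lemma gen_mod_trans: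
  assumes u: "gen_mod k B I u A" "finite I" and v: "gen_mod k C J v B" "finite J"
  shows "gen_mod k C (I <+> J) (case_sum u v) A"
  unfolding gen_mod_def
proof
  fix a assume "a \<in> A"
  then obtain c where c: "\<forall>i\<in>I. c i \<in> k" "a - (\<Sum>i\<in>I. c i * u i) \<in> B" using u by (auto simp: gen_mod_def)
  then obtain d where d: "\<forall>i\<in>J. d i \<in> k" "a - (\<Sum>i\<in>I. c i * u i) - (\<Sum>i\<in>J. d i * v i) \<in> C"
    using v unfolding gen_mod_def by blast
  have "(\<Sum>i\<in>I <+> J. case_sum c d i * case_sum u v i) = (\<Sum>i\<in>I. c i * u i) + (\<Sum>i\<in>J. d i * v i)"
    using u v by (subst sum.Plus) auto
  thus "\<exists>c. (\<forall>i\<in>I <+> J. c i \<in> k) \<and> a - (\<Sum>i\<in>I <+> J. c i * case_sum u v i) \<in> C"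
    using c d by (intro exI[of _ "case_sum c d"]) (auto simp: algebra_simps)
qed

lemma codim_le_trans:
  assumes "codim_le k A B m" "codim_le k B C n" shows "codim_le k A C (m + n)"
proof -
  obtain m' u n' v where "m' \<le> m" "gen_mod k B {..<m'::nat} u A" "n' \<le> n" "gen_mod k C {..<n'::nat} v B"
    using assms by (auto simp: codim_le_def)
  thus ?thesis using gen_mod_trans[of k B "{..<m'}" u A C "{..<n'}" v]
    by (intro codim_leI[of k C "{..<m'} <+> {..<n'}" "case_sum u v"]) (auto simp: card_Plus)
qed

lemma codim_le_refl: "k_subspace k A \<Longrightarrow> codim_le k A A n"
  unfolding codim_le_def gen_mod_def by (intro exI[of _ 0]) auto

lemma codim_le_basis:
  fixes k :: "'a::field_char_0 set"
  assumes k: "subfield k \<Omega>" "k_subspace k C" and "codim_le k A B n"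
    and "basis_mod k C A I u" "basis_mod k C B J v"
  shows "card I \<le> n + card J"
proof -
  obtain m w where m: "m \<le> n" "gen_mod k B {..<m::nat} w A" using assms(3) by (auto simp: codim_le_def)
  have "card I \<le> card ({..<m} <+> J)"
    using steinitz[OF k, of I u A "{..<m} <+> J" "case_sum w v"] gen_mod_trans[OF m(2), of C J v] assms(4,5)
    by (auto simp: basis_mod_def)
  thus ?thesis using m assms(5) by (auto simp: card_Plus basis_mod_def)
qed

lemma basis_mod_subset:
  fixes k :: "'a::field_char_0 set"
  assumes k: "subfield k \<Omega>" "k_subspace k C" and A: "basis_mod k C A I u" and "B \<subseteq> A"
  obtains n v where "n \<le> card I" "basis_mod k C B {..<n::nat} v"
proof (rule exists_basis_mod[OF k])
  show "n \<le> card I" if "indep_mod k C {..<n} u" "u ` {..<n} \<subseteq> B" for n and u :: "nat \<Rightarrow> 'a"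
    using steinitz[OF k that(1), of A I] that A assms(4) by (auto simp: basis_mod_def)
qed (use that in blast)

section \<open>Dimensions in the sense of HOL-Algebra\<close>

text \<open>One computation for both dimensions in the definitions: with h the quotient map of a
  valuation ring it yields the degree of a point, with h the identity it yields dim L(D). The kernel
  of h on x is N, so bases modulo N become bases in A.\<close>

lemma dim_quotient:
  fixes k :: "'a::field_char_0 set" and u :: "'i \<Rightarrow> 'a"
  assumes x: "subring x \<Omega>" "k \<subseteq> x" and k: "subfield k \<Omega>" and A: "ring A" "\<one>\<^bsub>A\<^esub> \<noteq> \<zero>\<^bsub>A\<^esub>"
    and h: "h \<in> ring_hom (\<Omega>\<lparr>carrier := x\<rparr>) A" and N: "\<And>a. a \<in> x \<Longrightarrow> h a = \<zero>\<^bsub>A\<^esub> \<longleftrightarrow> a \<in> N"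
    and V: "V \<subseteq> x" "k_subspace k V" and u: "basis_mod k N V I u"
  shows "ring.dim A (h ` k) (h ` V) = card I"
proof -
  interpret A: ring A by fact
  interpret X: ring "\<Omega>\<lparr>carrier := x\<rparr>" by (rule Om.subring_is_ring[OF x(1)])
  interpret H: ring_hom_ring "\<Omega>\<lparr>carrier := x\<rparr>" A h
    by (unfold_locales) (rule h)
  have kx: "subfield k (\<Omega>\<lparr>carrier := x\<rparr>)"
  proof (rule X.subfield_iff(1))
    show "field ((\<Omega>\<lparr>carrier := x\<rparr>)\<lparr>carrier := k\<rparr>)" using Om.subfield_iff(2)[OF k] by simp
  qed (use x in simp)
  have K: "subfield (h ` k) A" using H.img_is_subfield(2)[OF kx] A(2) by simp
  have hcar: "h a \<in> carrier A" if "a \<in> x" for a using H.hom_closed[of a] that by simp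
  have hadd: "h (a + b) = h a \<oplus>\<^bsub>A\<^esub> h b" if "a \<in> x" "b \<in> x" for a b using H.hom_add[of a b] that by simp
  have hmult: "h (a * b) = h a \<otimes>\<^bsub>A\<^esub> h b" if "a \<in> x" "b \<in> x" for a b using H.hom_mult[of a b] that by simp
  have heq: "h a = h b \<longleftrightarrow> a - b \<in> N" if "a \<in> x" "b \<in> x" for a b
  proof -
    have d: "a - b \<in> x" by (rule subring_diff[OF x(1) that])
    have "h a = h (a - b) \<oplus>\<^bsub>A\<^esub> h b" using hadd[OF d that(2)] by simp
    hence "h a = h b \<longleftrightarrow> h (a - b) = \<zero>\<^bsub>A\<^esub>"
      using hcar[OF that(2)] hcar[OF d] by (metis A.add.r_cancel_one A.l_zero)
    thus ?thesis using N[OF d] by simp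
  qed
  have comb: "A.combine (map (h \<circ> c) xs) (map (h \<circ> u) xs) = h (\<Sum>j\<in>set xs. c j * u j)"
    if "distinct xs" "c ` set xs \<subseteq> k" "set xs \<subseteq> I" for xs c
    using that
  proof (induction xs)
    case Nil
    have "h 0 = \<zero>\<^bsub>A\<^esub>" using heq[of 0 0] N[of 0] subring_0[OF x(1)] H.hom_zero by simp
    thus ?case by simp
  next
    case (Cons y xs)
    have cx: "c j \<in> x" "u j \<in> x" if "j \<in> set (y # xs)" for j
      using Cons.prems that x V u by (auto simp: basis_mod_def image_subset_iff)
    hence "(\<Sum>j\<in>set xs. c j * u j) \<in> x" using x(1) by (intro subring_sum subring_mult) auto
    thus ?case using Cons cx x(1) by (auto simp: hadd hmult subring_mult)
  qed
  have coeffs: "\<exists>c. Ks = map (h \<circ> c) xs \<and> c ` set xs \<subseteq> k"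
    if len: "length Ks = length xs" and sub: "set Ks \<subseteq> h ` k" and dis: "distinct xs" for Ks and xs :: "'i list"
  proof -
    obtain cs where cs: "Ks = map h cs" "set cs \<subseteq> k"
    proof -
      have "Ks = map h (map (inv_into k h) Ks)" using sub
        by (auto simp: list_eq_iff_nth_eq f_inv_into_f subset_iff)
      moreover have "set (map (inv_into k h) Ks) \<subseteq> k" using sub by (auto simp: inv_into_into subset_iff)
      ultimately show ?thesis using that by blast
    qed
    hence "length cs = length xs" using len by auto
    define c where "c = (\<lambda>j. the (map_of (zip xs cs) j))"
    have "map c xs = cs"
      using \<open>length cs = length xs\<close> dis by (auto simp: c_def list_eq_iff_nth_eq map_of_zip_nth)
    hence "c ` set xs = set cs" "Ks = map (h \<circ> c) xs" using cs(1) by (auto simp: o_def)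
    thus ?thesis using cs(2) by blast
  qed
  obtain xs where xs: "set xs = I" "distinct xs"
    using u finite_distinct_list[of I] unfolding basis_mod_def by blast
  have ucar: "set (map (h \<circ> u) ys) \<subseteq> carrier A" if "set ys \<subseteq> I" for ys
  proof -
    have "u y \<in> x" if "y \<in> I" for y using that u V by (auto simp: basis_mod_def image_subset_iff)
    thus ?thesis using that hcar by auto
  qed
  have "A.independent (h ` k) (map (h \<circ> u) ys)" if "set ys \<subseteq> I" "distinct ys" for ys
    using that
  proof (induction ys)
    case (Cons y ys)
    have "h (u y) \<notin> A.Span (h ` k) (map (h \<circ> u) ys)"
    proof
      assume "h (u y) \<in> A.Span (h ` k) (map (h \<circ> u) ys)"
      then obtain Ks where Ks: "set Ks \<subseteq> h ` k" "length Ks = length ys" "h (u y) = A.combine Ks (map (h \<circ> u) ys)"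
        using A.Span_mem_iff_length_version[OF K, of "map (h \<circ> u) ys"] ucar[of ys] Cons.prems by auto
      obtain c where c: "Ks = map (h \<circ> c) ys" "c ` set ys \<subseteq> k" using coeffs[OF Ks(2,1)] Cons.prems by auto
      have "h (u y) = h (\<Sum>j\<in>set ys. c j * u j)" using comb[of ys c] Ks c Cons.prems by auto
      moreover have "u y \<in> x" "(\<Sum>j\<in>set ys. c j * u j) \<in> x"
        using Cons.prems u V x(2) c(2)
        by (auto simp: basis_mod_def image_subset_iff intro!: subring_sum subring_mult x(1))
      ultimately have N: "u y - (\<Sum>j\<in>set ys. c j * u j) \<in> N" using heq by blast
      \<comment> \<open>The relation is written with coefficient 1 at the new index y, which
        independence modulo N would force to be 0.\<close>
      define c' where "c' = (\<lambda>j. if j = y then 1 else - c j)"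
      have "(\<Sum>j\<in>set ys. c' j * u j) = (\<Sum>j\<in>set ys. - (c j * u j))"
        using Cons.prems by (intro sum.cong) (auto simp: c'_def)
      hence sum: "(\<Sum>j\<in>set (y # ys). c' j * u j) = u y - (\<Sum>j\<in>set ys. c j * u j)"
        using Cons.prems by (simp add: sum_negf c'_def)
      have ind: "indep_mod k N (set (y # ys)) u"
        using indep_mod_subset[OF k, of N I u "set (y # ys)"] u Cons.prems by (auto simp: basis_mod_def)
      have ck: "c' j \<in> k" if "j \<in> set (y # ys)" for j
        using that c(2) by (auto simp: c'_def intro!: subfield_closed k)
      have "c' y = 0" by (rule indep_modD[OF ind ck]) (simp_all only: sum N list.set_intros)
      hence "(1::'a) = 0" by (simp add: c'_def)
      thus False by simp
    qed
    moreover have "h (u y) \<in> carrier A" using ucar[of "y # ys"] Cons.prems by simp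
    moreover have "A.independent (h ` k) (map (h \<circ> u) ys)" by (rule Cons.IH) (use Cons.prems in auto)
    ultimately have "A.independent (h ` k) (h (u y) # map (h \<circ> u) ys)" by (intro A.li_Cons)
    moreover have eq: "map (h \<circ> u) (y # ys) = h (u y) # map (h \<circ> u) ys" by simp
    ultimately show ?case unfolding eq by blast
  qed simp
  hence ind: "A.independent (h ` k) (map (h \<circ> u) xs)" using xs by blast
  have "A.Span (h ` k) (map (h \<circ> u) xs) = h ` V"
  proof (rule equalityI; rule subsetI)
    fix b assume "b \<in> A.Span (h ` k) (map (h \<circ> u) xs)"
    then obtain Ks where Ks: "set Ks \<subseteq> h ` k" "length Ks = length xs" "b = A.combine Ks (map (h \<circ> u) xs)"
      using A.Span_mem_iff_length_version[OF K, of "map (h \<circ> u) xs"] ucar[of xs] xs by auto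
    obtain c where c: "Ks = map (h \<circ> c) xs" "c ` set xs \<subseteq> k" using coeffs[OF Ks(2,1)] xs by auto
    have "b = h (\<Sum>j\<in>I. c j * u j)" using comb[of xs c] Ks c xs by auto
    moreover have "(\<Sum>j\<in>I. c j * u j) \<in> V"
      using V(2) c xs u by (intro k_subspace_sum) (auto simp: basis_mod_def)
    ultimately show "b \<in> h ` V" by blast
  next
    fix b assume "b \<in> h ` V"
    then obtain a where a: "b = h a" "a \<in> V" by blast
    then obtain c where c: "\<forall>i\<in>I. c i \<in> k" "a - (\<Sum>i\<in>I. c i * u i) \<in> N"
      using u by (auto simp: basis_mod_def gen_mod_def)
    have "(\<Sum>i\<in>I. c i * u i) \<in> V"
      using V(2) c u by (intro k_subspace_sum) (auto simp: basis_mod_def)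
    hence "b = h (\<Sum>i\<in>I. c i * u i)" using heq a c V(1) by blast
    also have "\<dots> = A.combine (map (h \<circ> c) xs) (map (h \<circ> u) xs)"
    proof -
      have "c ` set xs \<subseteq> k" using c xs by auto
      thus ?thesis using comb[OF xs(2), of c] xs(1) by (metis subset_refl)
    qed
    finally show "b \<in> A.Span (h ` k) (map (h \<circ> u) xs)"
      using A.Span_mem_iff_length_version[OF K, of "map (h \<circ> u) xs"] ucar[of xs] xs c
      by (auto intro!: exI[of _ "map (h \<circ> c) xs"])
  qed
  hence "A.dimension (card I) (h ` k) (h ` V)"
    using A.dimensionI[OF K ind] xs distinct_card[of xs] by auto
  thus ?thesis using A.dimension_is_inj[OF K] unfolding A.dim_def by blast
qed

lemma dim_ambient:
  fixes k :: "'a::field_char_0 set"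
  assumes k: "subfield k \<Omega>" and V: "k_subspace k V" and u: "basis_mod k {0} V I u"
  shows "(ring.dim \<Omega> over k) V = card I"
proof -
  have "ring.dim \<Omega> ((\<lambda>a. a) ` k) ((\<lambda>a. a) ` V) = card I"
  proof (rule dim_quotient[of UNIV k \<Omega> _ "{0}"])
    show "subring UNIV (\<Omega> :: 'a ring)" by (rule ambient_subringI) auto
    show "(\<lambda>a. a) \<in> ring_hom (\<Omega>\<lparr>carrier := UNIV\<rparr>) (\<Omega> :: 'a ring)" by (auto simp: ring_hom_def)
  qed (use assms Om.ring_axioms in auto)
  thus ?thesis by (simp add: over_def)
qed

section \<open>Valuation rings and closed points\<close>

definition valuation_ring :: "'a::field_char_0 set \<Rightarrow> 'a set \<Rightarrow> bool"
  where "valuation_ring K W \<longleftrightarrow> subring W \<Omega> \<and> W \<subseteq> K \<and> (\<forall>a\<in>K. a \<in> W \<or> inverse a \<in> W)"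

definition units_of_ring :: "'a::field_char_0 set \<Rightarrow> 'a set"
  where "units_of_ring W = W - maximal_ideal W"

lemma units_of_ring_iff: "a \<in> units_of_ring W \<longleftrightarrow> a \<in> W \<and> a \<noteq> 0 \<and> inverse a \<in> W"
  by (auto simp: units_of_ring_def maximal_ideal_def)

lemma maximal_ideal_iff: "a \<in> maximal_ideal W \<longleftrightarrow> a \<in> W \<and> (a = 0 \<or> inverse a \<notin> W)"
  by (auto simp: maximal_ideal_def)

context fixes K W :: "'a::field_char_0 set" assumes K: "subfield K \<Omega>" and W: "valuation_ring K W"
begin
lemma valuation_ring_subring: "subring W \<Omega>" and valuation_ring_subset: "W \<subseteq> K"
  using W by (auto simp: valuation_ring_def)
lemma valuation_ring_cases: "a \<in> K \<Longrightarrow> a \<in> W \<or> inverse a \<in> W"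
  using W by (auto simp: valuation_ring_def)
lemma one_in_units: "1 \<in> units_of_ring W"
  using subring_1[OF valuation_ring_subring] by (auto simp: units_of_ring_iff)
lemma units_mult: "a \<in> units_of_ring W \<Longrightarrow> b \<in> units_of_ring W \<Longrightarrow> a * b \<in> units_of_ring W"
  using subring_mult[OF valuation_ring_subring] by (auto simp: units_of_ring_iff)
lemma units_inverse: "a \<in> units_of_ring W \<Longrightarrow> inverse a \<in> units_of_ring W"
  by (auto simp: units_of_ring_iff)
lemma units_divide: "a \<in> units_of_ring W \<Longrightarrow> b \<in> units_of_ring W \<Longrightarrow> a / b \<in> units_of_ring W"
  by (simp add: divide_inverse units_mult units_inverse)
lemma units_uminus: "a \<in> units_of_ring W \<Longrightarrow> - a \<in> units_of_ring W"
  using subring_uminus[OF valuation_ring_subring] by (auto simp: units_of_ring_iff)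
lemma units_power: "a \<in> units_of_ring W \<Longrightarrow> a ^ n \<in> units_of_ring W"
  by (induction n) (auto simp: units_mult one_in_units)
lemma units_powi: "a \<in> units_of_ring W \<Longrightarrow> a powi n \<in> units_of_ring W"
  by (auto simp: power_int_def intro: units_power units_inverse)
lemma maximal_ideal_mult:
  assumes "a \<in> maximal_ideal W" "b \<in> W" shows "a * b \<in> maximal_ideal W"
proof (cases "a * b = 0")
  case False
  show ?thesis
  proof (rule ccontr)
    assume "a * b \<notin> maximal_ideal W"
    hence "inverse (a * b) \<in> W" using assms subring_mult[OF valuation_ring_subring] False
      by (auto simp: maximal_ideal_iff)
    hence "b * inverse (a * b) \<in> W" using assms subring_mult[OF valuation_ring_subring] by blast
    moreover have "b * inverse (a * b) = inverse a" using False by (simp add: field_simps)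
    ultimately have "inverse a \<in> W" by metis
    thus False using assms False by (auto simp: maximal_ideal_iff)
  qed
qed (use assms subring_0[OF valuation_ring_subring] in \<open>auto simp: maximal_ideal_iff\<close>)
lemma maximal_ideal_zero: "0 \<in> maximal_ideal W"
  using subring_0[OF valuation_ring_subring] by (auto simp: maximal_ideal_iff)
lemma one_notin_maximal_ideal: "1 \<notin> maximal_ideal W"
  using subring_1[OF valuation_ring_subring] by (auto simp: maximal_ideal_iff)
lemma maximal_ideal_subset: "maximal_ideal W \<subseteq> W"
  by (auto simp: maximal_ideal_iff)
text \<open>One of a/b and b/a lies in W, so the sum is one of the two summands times 1 plus an
  element of W.\<close>

lemma maximal_ideal_add:
  assumes "a \<in> maximal_ideal W" "b \<in> maximal_ideal W" shows "a + b \<in> maximal_ideal W"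
proof -
  have main: "c + d \<in> maximal_ideal W"
    if c: "c \<in> maximal_ideal W" and d: "d \<in> maximal_ideal W" "d \<noteq> 0" and cd: "c / d \<in> W" for c d
  proof -
    have "d * (1 + c / d) \<in> maximal_ideal W"
      using maximal_ideal_mult[OF d(1)] subring_add[OF valuation_ring_subring subring_1[OF valuation_ring_subring] cd] by blast
    moreover have "d * (1 + c / d) = c + d" using d(2) by (simp add: distrib_left)
    ultimately show ?thesis by metis
  qed
  show ?thesis
  proof (cases "a = 0 \<or> b = 0")
    case False
    have "a / b \<in> K" using assms maximal_ideal_subset valuation_ring_subset K by (auto intro!: subfield_divide)
    hence "a / b \<in> W \<or> b / a \<in> W" using valuation_ring_cases[of "a / b"] by simp
    thus ?thesis using main[of a b] main[of b a] assms False by (auto simp: add.commute)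
  qed (use assms in auto)
qed
lemma maximal_ideal_uminus: "a \<in> maximal_ideal W \<Longrightarrow> - a \<in> maximal_ideal W"
  using subring_uminus[OF valuation_ring_subring, of "inverse (- a)"] subring_uminus[OF valuation_ring_subring]
  by (auto simp: maximal_ideal_iff)
lemma maximal_ideal_diff: "a \<in> maximal_ideal W \<Longrightarrow> b \<in> maximal_ideal W \<Longrightarrow> a - b \<in> maximal_ideal W"
  using maximal_ideal_add[of a "- b"] maximal_ideal_uminus by simp
lemma ring_cases: "a \<in> W \<Longrightarrow> a \<in> units_of_ring W \<or> a \<in> maximal_ideal W"
  by (auto simp: units_of_ring_def)
lemma units_notin: "a \<in> units_of_ring W \<Longrightarrow> a \<notin> maximal_ideal W"
  by (auto simp: units_of_ring_def)
lemma units_subset: "units_of_ring W \<subseteq> W"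
  by (auto simp: units_of_ring_def)
lemma units_add: "a \<in> units_of_ring W \<Longrightarrow> b \<in> maximal_ideal W \<Longrightarrow> a + b \<in> units_of_ring W"
  using maximal_ideal_diff[of "a + b" b] subring_add[OF valuation_ring_subring, of a b]
  by (auto simp: units_of_ring_def maximal_ideal_iff)
lemma maximal_ideal_power: "a \<in> maximal_ideal W \<Longrightarrow> n > 0 \<Longrightarrow> a ^ n \<in> maximal_ideal W"
  by (induction n) (use maximal_ideal_mult maximal_ideal_subset subring_power[OF valuation_ring_subring] in auto)
lemma inverse_in_maximal_ideal: "a \<in> K \<Longrightarrow> a \<notin> W \<Longrightarrow> inverse a \<in> maximal_ideal W"
  using valuation_ring_cases[of a] by (auto simp: maximal_ideal_iff)
lemma powi_unit_imp_zero:
  assumes "t \<in> maximal_ideal W" "t powi n \<in> units_of_ring W" shows "n = 0"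
proof (rule ccontr)
  assume "n \<noteq> 0"
  hence "t powi \<bar>n\<bar> \<in> units_of_ring W"
    using assms(2) units_inverse[of "t powi n"] by (auto simp: abs_if power_int_minus)
  moreover have "t powi \<bar>n\<bar> = t ^ nat \<bar>n\<bar>" by (simp add: power_int_def)
  ultimately show False using maximal_ideal_power[OF assms(1), of "nat \<bar>n\<bar>"] units_notin \<open>n \<noteq> 0\<close> by auto
qed
lemma power_unit_imp_unit:
  assumes "a \<in> K" "a ^ n \<in> units_of_ring W" "n > 0" shows "a \<in> units_of_ring W"
proof (rule ccontr)
  assume na: "a \<notin> units_of_ring W"
  have "a \<in> maximal_ideal W \<or> inverse a \<in> maximal_ideal W"
    using na valuation_ring_cases[OF assms(1)] inverse_in_maximal_ideal[OF assms(1)] ring_cases[of a] by blast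
  moreover have "inverse a ^ n \<in> units_of_ring W" using units_inverse[OF assms(2)] by (simp add: power_inverse)
  ultimately show False using maximal_ideal_power[of _ n] units_notin assms by blast
qed
text \<open>It suffices to write every nonzero element as a unit times a power of t. That t
  generates the maximal ideal then follows: an element of the ideal with exponent at most 0 would
  put 1 into the ideal.\<close>

lemma closed_pointI:
  assumes "k \<subseteq> W" and t: "t \<in> maximal_ideal W" "t \<noteq> 0"
    and f: "\<And>f. f \<in> K \<Longrightarrow> f \<noteq> 0 \<Longrightarrow> \<exists>n u. u \<in> units_of_ring W \<and> f = u * t powi n"
  shows "W \<in> closed_points k K" "uniformizer W t"
proof -
  show "uniformizer W t" unfolding uniformizer_def
  proof (intro conjI equalityI subsetI)
    fix a assume a: "a \<in> maximal_ideal W"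
    show "a \<in> (*) t ` W"
    proof (cases "a = 0")
      case False
      have "a \<in> K" using a maximal_ideal_subset valuation_ring_subset by blast
      then obtain n u where nu: "u \<in> units_of_ring W" "a = u * t powi n" using f False by blast
      have "n > 0"
      proof (rule ccontr)
        assume "\<not> n > 0"
        hence "t powi n = inverse (t ^ nat (- n))" by (simp add: power_int_def power_inverse)
        hence "inverse u * a * t ^ nat (- n) = 1" using nu t by (simp add: units_of_ring_iff field_simps)
        moreover have "a * (inverse u * t ^ nat (- n)) \<in> maximal_ideal W"
          using a nu t by (intro maximal_ideal_mult subring_mult[OF valuation_ring_subring] subring_power[OF valuation_ring_subring])
            (auto simp: units_of_ring_iff maximal_ideal_iff)
        ultimately show False using one_notin_maximal_ideal by (simp add: mult_ac)
      qed
      hence "t powi n = t * t ^ nat (n - 1)" using power_int_add[of t 1 "n - 1"] t by (simp add: power_int_def)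
      hence "a = t * (u * t ^ nat (n - 1))" using nu by simp
      moreover have "u * t ^ nat (n - 1) \<in> W" using nu t
        by (intro subring_mult[OF valuation_ring_subring] subring_power[OF valuation_ring_subring])
          (auto simp: units_of_ring_iff maximal_ideal_iff)
      ultimately show ?thesis by blast
    qed (use subring_0[OF valuation_ring_subring] in force)
  qed (use t maximal_ideal_mult in auto)
  moreover have "\<forall>f\<in>K - {0}. \<exists>n::int. \<exists>u\<in>W - maximal_ideal W. f = u * t powi n"
    using f unfolding units_of_ring_def by blast
  ultimately show "W \<in> closed_points k K"
    using assms(1) valuation_ring_subring valuation_ring_subset unfolding closed_points_def by blast
qed
end

section \<open>The discrete valuation at a closed point\<close>

context fixes k K x :: "'a::field_char_0 set"
  assumes K: "subfield K \<Omega>" and x: "x \<in> closed_points k K"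
begin
lemma closed_point_valuation_ring: "valuation_ring K x"
proof -
  from x obtain t where t: "uniformizer x t" "\<And>f. f \<in> K - {0} \<Longrightarrow> \<exists>n::int. \<exists>u\<in>x - maximal_ideal x. f = u * t powi n"
    and s: "subring x \<Omega>" "x \<subseteq> K"
    by (auto simp: closed_points_def)
  have tx: "t \<in> x" using t(1) subring_1[OF s(1)] by (auto simp: uniformizer_def maximal_ideal_def)
  have "a \<in> x \<or> inverse a \<in> x" if aK: "a \<in> K" for a
  proof (cases "a = 0")
    case False
    then obtain n u where nu: "u \<in> x" "u \<notin> maximal_ideal x" "a = u * t powi n"
      using t(2)[of a] aK by blast
    have "inverse u \<in> x" using nu by (auto simp: maximal_ideal_def)
    hence "inverse a \<in> x" if "n < 0"
    proof -
      have "inverse a = inverse u * t ^ nat (- n)" using nu that by (simp add: power_int_def power_inverse)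
      thus ?thesis using \<open>inverse u \<in> x\<close> tx s subring_mult subring_power by metis
    qed
    moreover have "a \<in> x" if "n \<ge> 0"
    proof -
      have "a = u * t ^ nat n" using nu that by (simp add: power_int_def)
      thus ?thesis using nu tx s subring_mult subring_power by metis
    qed
    ultimately show ?thesis by linarith
  qed (use s subring_0 in auto)
  thus ?thesis using s by (auto simp: valuation_ring_def)
qed
lemmas cp_ring = valuation_ring_subring[OF K closed_point_valuation_ring]
lemmas cp_subset = valuation_ring_subset[OF K closed_point_valuation_ring]

lemma cp_scalars: "k \<subseteq> x"
  using x by (auto simp: closed_points_def)

lemma obtain_uniformizer:
  obtains t where "uniformizer x t" "t \<noteq> 0" "t \<in> maximal_ideal x" "t \<in> K"
    "\<And>f. f \<in> K \<Longrightarrow> f \<noteq> 0 \<Longrightarrow> \<exists>n u. u \<in> units_of_ring x \<and> f = u * t powi n"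
proof -
  from x obtain t where t: "uniformizer x t" "\<forall>f\<in>K - {0}. \<exists>n::int. \<exists>u\<in>x - maximal_ideal x. f = u * t powi n"
    and s: "subring x \<Omega>" "x \<subseteq> K"
    by (auto simp: closed_points_def)
  have "t = t * 1" by simp
  hence tx: "t \<in> maximal_ideal x" using t(1) subring_1[OF s(1)] unfolding uniformizer_def by blast
  show ?thesis
  proof (rule that[OF t(1)])
    show "\<exists>n u. u \<in> units_of_ring x \<and> f = u * t powi n" if "f \<in> K" "f \<noteq> 0" for f
      using t(2) that unfolding units_of_ring_def by blast
  qed (use t tx s in \<open>auto simp: uniformizer_def maximal_ideal_def\<close>)
qed

text \<open>Two uniformizers differ by a unit, so the exponent does not depend on the choice and the
  definite description in \<open>valuation\<close> is justified.\<close>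

lemma valuation_eqI:
  assumes t: "uniformizer x t" and u: "u \<in> units_of_ring x"
  shows "valuation x (u * t powi n) = n"
  unfolding valuation_def
proof (rule the_equality)
  show "\<exists>t' u'. uniformizer x t' \<and> u' \<in> x - maximal_ideal x \<and> u * t powi n = u' * t' powi n"
    using t u unfolding units_of_ring_def by blast
next
  note V = K closed_point_valuation_ring
  have um: "s \<in> maximal_ideal x" "s \<noteq> 0" if "uniformizer x s" for s
  proof -
    have "s = s * 1" by simp
    thus "s \<in> maximal_ideal x" using that subring_1[OF cp_ring] unfolding uniformizer_def by blast
  qed (use that in \<open>auto simp: uniformizer_def\<close>)
  fix m assume "\<exists>t' u'. uniformizer x t' \<and> u' \<in> x - maximal_ideal x \<and> u * t powi n = u' * t' powi m"
  then obtain t' u' where t': "uniformizer x t'" and u': "u' \<in> units_of_ring x" and eq: "u * t powi n = u' * t' powi m"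
    unfolding units_of_ring_def by blast
  have "t' \<in> (*) t ` x" "t \<in> (*) t' ` x" using um[OF t] um[OF t'] t t' by (auto simp: uniformizer_def)
  then obtain a b where ab: "t' = t * a" "t = t' * b" "a \<in> x" "b \<in> x" by blast
  hence "t * 1 = t * (a * b)" by (simp add: mult_ac)
  hence "a * b = 1" using um[OF t] by simp
  hence a: "a \<in> units_of_ring x" using ab by (auto simp: units_of_ring_iff inverse_unique)
  have "t powi (n - m) = u' * a powi m / u"
    using eq um[OF t] u unfolding ab(1) by (auto simp: power_int_diff power_int_mult_distrib field_simps units_of_ring_iff)
  moreover have "u' * a powi m / u \<in> units_of_ring x"
    using a u u' by (intro units_divide[OF V] units_mult[OF V] units_powi[OF V])
  ultimately show "m = n" using powi_unit_imp_zero[OF V um(1)[OF t], of "n - m"] by simp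
qed

lemma valuation_mult:
  assumes "f \<in> K" "f \<noteq> 0" "g \<in> K" "g \<noteq> 0"
  shows "valuation x (f * g) = valuation x f + valuation x g"
proof -
  note V = K closed_point_valuation_ring
  obtain t where t: "uniformizer x t" "t \<noteq> 0" "\<And>f. f \<in> K \<Longrightarrow> f \<noteq> 0 \<Longrightarrow> \<exists>n u. u \<in> units_of_ring x \<and> f = u * t powi n"
    using obtain_uniformizer by blast
  obtain n u where f: "u \<in> units_of_ring x" "f = u * t powi n" using t(3)[OF assms(1,2)] by blast
  obtain m w where g: "w \<in> units_of_ring x" "g = w * t powi m" using t(3)[OF assms(3,4)] by blast
  have "f * g = (u * w) * t powi (n + m)" using f g t by (simp add: power_int_add)
  thus ?thesis using valuation_eqI[OF t(1)] f g units_mult[OF V f(1) g(1)] by metis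
qed
lemma valuation_one: "valuation x 1 = 0"
  using valuation_mult[of 1 1] subfield_closed(2)[OF K] by simp
lemma valuation_inverse: "f \<in> K \<Longrightarrow> f \<noteq> 0 \<Longrightarrow> valuation x (inverse f) = - valuation x f"
  using valuation_mult[of f "inverse f"] valuation_one subfield_inverse[OF K] by simp
lemma valuation_divide: "f \<in> K \<Longrightarrow> f \<noteq> 0 \<Longrightarrow> g \<in> K \<Longrightarrow> g \<noteq> 0 \<Longrightarrow> valuation x (f / g) = valuation x f - valuation x g"
  using valuation_mult[of f "inverse g"] valuation_inverse subfield_inverse[OF K] by (simp add: divide_inverse)
lemma valuation_power: "f \<in> K \<Longrightarrow> f \<noteq> 0 \<Longrightarrow> valuation x (f ^ n) = int n * valuation x f"
  by (induction n) (auto simp: valuation_one valuation_mult subfield_closed K algebra_simps)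
lemma valuation_nonneg_iff: 
  assumes "f \<in> K" "f \<noteq> 0" 
  shows "f \<in> x \<longleftrightarrow> 0 \<le> valuation x f" and "f \<in> maximal_ideal x \<longleftrightarrow> 0 < valuation x f"
proof -
  note V = K closed_point_valuation_ring
  obtain t where t: "uniformizer x t" "t \<noteq> 0" "t \<in> maximal_ideal x" "\<And>f. f \<in> K \<Longrightarrow> f \<noteq> 0 \<Longrightarrow> \<exists>n u. u \<in> units_of_ring x \<and> f = u * t powi n"
    using obtain_uniformizer by blast
  have pos: "f \<in> maximal_ideal x" if f: "f \<in> K" "f \<noteq> 0" "0 < valuation x f" for f
  proof -
    obtain n u where nu: "u \<in> units_of_ring x" "f = u * t powi n" using t(4)[OF f(1,2)] by blast
    hence "n > 0" using valuation_eqI[OF t(1)] f by auto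
    thus ?thesis using maximal_ideal_mult[OF V maximal_ideal_power[OF V t(3), of "nat n"], of u] nu
      units_subset[OF V] by (auto simp: power_int_def mult.commute)
  qed
  have zero: "f \<in> units_of_ring x" if "valuation x f = 0"
  proof -
    obtain n u where nu: "u \<in> units_of_ring x" "f = u * t powi n" using t(4)[OF assms] by blast
    thus ?thesis using valuation_eqI[OF t(1)] that by auto
  qed
  have neg: "f \<notin> x" if "valuation x f < 0"
    using pos[of "inverse f"] that assms valuation_inverse[OF assms] subfield_inverse[OF K]
    by (auto simp: maximal_ideal_iff)
  show "f \<in> x \<longleftrightarrow> 0 \<le> valuation x f"
    using pos[OF assms] zero neg units_subset[OF V] maximal_ideal_subset[OF V] by force
  show "f \<in> maximal_ideal x \<longleftrightarrow> 0 < valuation x f"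
    using pos[OF assms] zero neg units_notin[OF V] maximal_ideal_subset[OF V] by force
qed
lemma valuation_uniformizer: "uniformizer x t \<Longrightarrow> valuation x t = 1"
  using valuation_eqI[of t 1 1] one_in_units[OF K closed_point_valuation_ring] by simp
end

text \<open>The n-th power of the maximal ideal, for any integer n. The element 0 is added by hand
  because \<open>valuation x 0\<close> carries no meaning.\<close>

definition frac_ideal :: "'a::field_char_0 set \<Rightarrow> 'a set \<Rightarrow> int \<Rightarrow> 'a set"
  where "frac_ideal K x n = {f \<in> K. f = 0 \<or> n \<le> valuation x f}"

context fixes k K x :: "'a::field_char_0 set"
  assumes K: "subfield K \<Omega>" and x: "x \<in> closed_points k K"
begin
text \<open>Turns a valuation inequality into membership in the ring \<open>x\<close>; the
  ultrametric inequality is then closure of \<open>x\<close> under addition.\<close>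

lemma frac_ideal_iff:
  assumes "uniformizer x t" "t \<in> K" "f \<in> K"
  shows "f \<in> frac_ideal K x n \<longleftrightarrow> f * t powi (- n) \<in> x"
proof (cases "f = 0")
  case False
  have t: "t \<noteq> 0" using assms by (auto simp: uniformizer_def)
  have "valuation x (t powi (- n)) = - n"
    using valuation_eqI[OF K x assms(1), of 1 "- n"] one_in_units[OF K closed_point_valuation_ring[OF K x]] by simp
  hence "valuation x (f * t powi (- n)) = valuation x f - n"
    using valuation_mult[OF K x, of f "t powi (- n)"] assms False t subfield_powi[OF K] by auto
  thus ?thesis using valuation_nonneg_iff(1)[OF K x, of "f * t powi (- n)"] assms False t
    subfield_powi[OF K assms(2)] subfield_closed(4)[OF K] by (auto simp: frac_ideal_def)
qed (use subring_0[OF cp_ring[OF K x]] assms in \<open>auto simp: frac_ideal_def\<close>)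

lemma frac_ideal_0: "frac_ideal K x 0 = x" and frac_ideal_1: "frac_ideal K x 1 = maximal_ideal x"
  using valuation_nonneg_iff[OF K x] cp_subset[OF K x] subring_0[OF cp_ring[OF K x]]
  by (auto simp: frac_ideal_def maximal_ideal_iff) (force simp: maximal_ideal_iff)+

lemma k_subspace_frac_ideal: "k_subspace k (frac_ideal K x n)"
proof -
  obtain t where t: "uniformizer x t" "t \<in> K" using obtain_uniformizer[OF K x] by blast
  note R = cp_ring[OF K x]
  have kK: "k \<subseteq> K" using cp_scalars[OF K x] cp_subset[OF K x] by blast
  have FK: "frac_ideal K x n \<subseteq> K" by (auto simp: frac_ideal_def)
  show ?thesis unfolding k_subspace_def
  proof (intro conjI ballI)
    show "0 \<in> frac_ideal K x n" using subfield_closed(1)[OF K] by (auto simp: frac_ideal_def)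
  next
    fix a b assume ab: "a \<in> frac_ideal K x n" "b \<in> frac_ideal K x n"
    hence "a * t powi (- n) + b * t powi (- n) \<in> x" using frac_ideal_iff[OF t] FK by (auto intro!: subring_add[OF R])
    thus "a + b \<in> frac_ideal K x n" using frac_ideal_iff[OF t, of "a + b" n] ab FK subfield_closed(3)[OF K]
      by (auto simp: distrib_right)
  next
    fix a c assume ac: "c \<in> k" "a \<in> frac_ideal K x n"
    hence "a * t powi (- n) \<in> x" "c \<in> x" using frac_ideal_iff[OF t, of a n] FK cp_scalars[OF K x] by auto
    hence "c * (a * t powi (- n)) \<in> x" using subring_mult[OF R, of c "a * t powi (- n)"] by blast
    thus "c * a \<in> frac_ideal K x n" using frac_ideal_iff[OF t, of "c * a" n] ac FK kK subfield_closed(4)[OF K]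
      by (auto simp: mult.assoc)
  qed
qed
lemma frac_ideal_mult: "a \<in> frac_ideal K x m \<Longrightarrow> b \<in> frac_ideal K x n \<Longrightarrow> a * b \<in> frac_ideal K x (m + n)"
  using valuation_mult[OF K x, of a b] subfield_closed(4)[OF K, of a b]
  by (cases "a = 0 \<or> b = 0") (auto simp: frac_ideal_def)
lemma frac_ideal_add: "a \<in> frac_ideal K x n \<Longrightarrow> b \<in> frac_ideal K x n \<Longrightarrow> a + b \<in> frac_ideal K x n"
  using k_subspace_frac_ideal by (auto simp: k_subspace_def)
lemma frac_ideal_uminus: "a \<in> frac_ideal K x n \<Longrightarrow> - a \<in> frac_ideal K x n"
proof -
  obtain t where t: "uniformizer x t" "t \<in> K" using obtain_uniformizer[OF K x] by blast
  assume a: "a \<in> frac_ideal K x n"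
  hence "a \<in> K" by (auto simp: frac_ideal_def)
  thus ?thesis using frac_ideal_iff[OF t, of a n] frac_ideal_iff[OF t, of "- a" n] a
    subring_uminus[OF cp_ring[OF K x], of "a * t powi (- n)"] subfield_closed(5)[OF K] by auto
qed
lemma frac_ideal_diff: "a \<in> frac_ideal K x n \<Longrightarrow> b \<in> frac_ideal K x n \<Longrightarrow> a - b \<in> frac_ideal K x n"
  using frac_ideal_add[of a n "- b"] frac_ideal_uminus by simp
lemma frac_ideal_mono: "m \<le> n \<Longrightarrow> frac_ideal K x n \<subseteq> frac_ideal K x m"
  by (auto simp: frac_ideal_def)
lemma valuation_add_ge:
  assumes "f \<in> K" "f \<noteq> 0" "g \<in> K" "g \<noteq> 0" "f + g \<noteq> 0"
  shows "min (valuation x f) (valuation x g) \<le> valuation x (f + g)"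
  using frac_ideal_add[of f "min (valuation x f) (valuation x g)" g] assms by (auto simp: frac_ideal_def)
lemma valuation_add_eq:
  assumes "f \<in> K" "f \<noteq> 0" "g \<in> K" "g \<noteq> 0" "valuation x f < valuation x g"
  shows "f + g \<noteq> 0" "valuation x (f + g) = valuation x f"
proof -
  have neg: "valuation x (- f) = valuation x f" if "f \<in> K" "f \<noteq> 0" for f
    using frac_ideal_uminus[of f "valuation x f"] frac_ideal_uminus[of "- f" "valuation x (- f)"] that
      subfield_closed(5)[OF K] by (auto simp: frac_ideal_def)
  show nz: "f + g \<noteq> 0"
  proof
    assume "f + g = 0"
    hence "g = - f" by (simp add: eq_neg_iff_add_eq_0 add.commute)
    thus False using neg[of f] assms by simp
  qed
  have "valuation x f \<le> valuation x (f + g)" using valuation_add_ge assms nz by fastforce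
  moreover have "min (valuation x (f + g)) (valuation x (- g)) \<le> valuation x (f + g + - g)"
    using assms nz subfield_closed(3,5)[OF K] by (intro valuation_add_ge) auto
  hence "valuation x (f + g) \<le> valuation x f" using neg[of g] assms by auto
  ultimately show "valuation x (f + g) = valuation x f" by simp
qed
end

section \<open>The degree of a point\<close>

lemma point_degree_eq:
  fixes k K x :: "'a::field_char_0 set"
  assumes k: "subfield k \<Omega>" and K: "subfield K \<Omega>" and x: "x \<in> closed_points k K"
    and u: "basis_mod k (maximal_ideal x) x I u"
  shows "point_degree k x = card I"
proof -
  note V = K closed_point_valuation_ring[OF K x]
  note R = cp_ring[OF K x]
  define Rx :: "'a ring" where "Rx = ring_of_type_algebra\<lparr>carrier := x\<rparr>"
  interpret X: ring Rx unfolding Rx_def by (rule Om.subring_is_ring[OF R])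
  have Xs: "carrier Rx = x" "(\<otimes>\<^bsub>Rx\<^esub>) = (*)" "(\<oplus>\<^bsub>Rx\<^esub>) = (+)" "\<one>\<^bsub>Rx\<^esub> = 1" "\<zero>\<^bsub>Rx\<^esub> = 0"
    by (auto simp: Rx_def)
  have neg: "\<ominus>\<^bsub>Rx\<^esub> a = - a" if "a \<in> x" for a
    using that subring_uminus[OF R that] by (intro X.minus_equality) (auto simp: Xs)
  have I: "ideal (maximal_ideal x) Rx"
  proof (rule idealI)
    show "subgroup (maximal_ideal x) (add_monoid Rx)"
    proof
      fix a assume a: "a \<in> maximal_ideal x"
      hence "inv\<^bsub>add_monoid Rx\<^esub> a = - a"
        using neg[of a] maximal_ideal_subset[OF V] by (auto simp: a_inv_def)
      thus "inv\<^bsub>add_monoid Rx\<^esub> a \<in> maximal_ideal x" using a maximal_ideal_uminus[OF V] by simp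
    qed (use maximal_ideal_subset[OF V] maximal_ideal_add[OF V] maximal_ideal_zero[OF V] in \<open>auto simp: Xs\<close>)
  qed (use maximal_ideal_mult[OF V] in \<open>auto simp: Xs X.ring_axioms mult.commute\<close>)
  interpret I: ideal "maximal_ideal x" Rx by (rule I)
  let ?h = "\<lambda>a. maximal_ideal x +>\<^bsub>Rx\<^esub> a"
  have zero: "\<zero>\<^bsub>residue_field x\<^esub> = maximal_ideal x" and one: "\<one>\<^bsub>residue_field x\<^esub> = ?h 1"
    by (auto simp: residue_field_def FactRing_def Xs simp flip: Rx_def)
  have h0: "?h a = maximal_ideal x \<longleftrightarrow> a \<in> maximal_ideal x" if "a \<in> x" for a
    using I.a_rcos_const[of a] I.a_rcos_self[of a] that by (auto simp: Xs)
  have "ring.dim (residue_field x) (?h ` k) (?h ` x) = card I"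
  proof (rule dim_quotient[OF R cp_scalars[OF K x] k])
    show "ring (residue_field x)" unfolding residue_field_def Rx_def[symmetric] by (rule I.quotient_is_ring)
    show "\<one>\<^bsub>residue_field x\<^esub> \<noteq> \<zero>\<^bsub>residue_field x\<^esub>"
      unfolding zero one using h0[of 1] one_notin_maximal_ideal[OF V] subring_1[OF R] by auto
    show "?h \<in> ring_hom (\<Omega>\<lparr>carrier := x\<rparr>) (residue_field x)"
      unfolding residue_field_def Rx_def[symmetric] by (rule I.rcos_ring_hom)
    show "?h a = \<zero>\<^bsub>residue_field x\<^esub> \<longleftrightarrow> a \<in> maximal_ideal x" if "a \<in> x" for a
      unfolding zero using h0[OF that] .
    show "k_subspace k x" using k_subspace_frac_ideal[OF K x, of 0] frac_ideal_0[OF K x] by simp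
  qed (use u in auto)
  moreover have "carrier (residue_field x) = ?h ` x"
    by (auto simp: residue_field_def FactRing_def A_RCOSETS_def' Xs simp flip: Rx_def)
  ultimately show ?thesis by (simp add: point_degree_def over_def Rx_def)
qed

section \<open>Weak approximation\<close>

text \<open>Discrete valuation rings are maximal among proper subrings of K: an element a outside x
  has negative valuation, so f / a^n lies in x for n large, and a ring containing both x and a
  contains every f.\<close>

lemma closed_points_maximal:
  fixes k K x x' :: "'a::field_char_0 set"
  assumes K: "subfield K \<Omega>" and x: "x \<in> closed_points k K" and x': "x' \<in> closed_points k K" and "x \<subseteq> x'"
  shows "x = x'"
proof (rule ccontr)
  note V' = K closed_point_valuation_ring[OF K x']
  assume "x \<noteq> x'"
  then obtain a where a: "a \<in> x'" "a \<notin> x" using assms by blast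
  have aK: "a \<in> K" "a \<noteq> 0" using a cp_subset[OF K x'] subring_0[OF cp_ring[OF K x]] by auto
  have va: "valuation x a < 0" using valuation_nonneg_iff(1)[OF K x aK] a by auto
  have "f \<in> x'" if f: "f \<in> K" "f \<noteq> 0" for f
  proof -
    define n where "n = nat \<bar>valuation x f\<bar>"
    have "valuation x (f / a ^ n) = valuation x f - int n * valuation x a"
      using f aK valuation_divide[OF K x f, of "a ^ n"] valuation_power[OF K x aK] subfield_closed(7)[OF K] by auto
    also have "\<dots> \<ge> 0" using va mult_left_mono[of "valuation x a" "-1" "int n"] by (auto simp: n_def)
    finally have "0 \<le> valuation x (f / a ^ n)" .
    moreover have "f / a ^ n \<in> K" "f / a ^ n \<noteq> 0" using f aK by (auto intro!: subfield_closed[OF K])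
    ultimately have "f / a ^ n \<in> x" using valuation_nonneg_iff(1)[OF K x] by blast
    hence "f / a ^ n * a ^ n \<in> x'" using assms a cp_ring[OF K x'] subring_mult subring_power by blast
    thus ?thesis using aK by simp
  qed
  moreover obtain t where "t \<noteq> 0" "t \<in> maximal_ideal x'" "t \<in> K" using obtain_uniformizer[OF K x'] by blast
  ultimately show False using subfield_inverse[OF K] by (auto simp: maximal_ideal_iff)
qed

text \<open>Induction on S. When w fails at the new point y, take v = a / b with a zero at x and a
  pole at y, and replace w by w + v^r: the high power dominates w wherever v has a pole and stays
  harmless elsewhere.\<close>

lemma separating_element:
  fixes k K x :: "'a::field_char_0 set"
  assumes K: "subfield K \<Omega>" and S: "finite S" "S \<subseteq> closed_points k K" and x: "x \<in> closed_points k K" "x \<notin> S"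
  shows "\<exists>w\<in>K. w \<noteq> 0 \<and> 0 < valuation x w \<and> (\<forall>y\<in>S. valuation y w < 0)"
  using S x(2)
proof (induction S rule: finite_induct)
  case empty
  thus ?case using obtain_uniformizer[OF K x(1)] valuation_uniformizer[OF K x(1)] by (metis zero_less_one empty_iff)
next
  case (insert y S)
  then obtain w where w: "w \<in> K" "w \<noteq> 0" "0 < valuation x w" "\<forall>y\<in>S. valuation y w < 0" by auto
  have y: "y \<in> closed_points k K" "y \<noteq> x" using insert by auto
  obtain a b where ab: "a \<in> x" "a \<notin> y" "b \<in> y" "b \<notin> x"
    using closed_points_maximal[OF K x(1) y(1)] closed_points_maximal[OF K y(1) x(1)] y(2) by blast
  hence abK: "a \<in> K" "a \<noteq> 0" "b \<in> K" "b \<noteq> 0"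
    using cp_subset[OF K x(1)] cp_subset[OF K y(1)] subring_0[OF cp_ring[OF K x(1)]] subring_0[OF cp_ring[OF K y(1)]] by auto
  define v where "v = a / b"
  have vK: "v \<in> K" "v \<noteq> 0" using abK by (auto simp: v_def intro!: subfield_closed[OF K])
  have vv: "0 < valuation x v" "valuation y v < 0"
    using valuation_divide[OF K x(1) abK] valuation_divide[OF K y(1) abK] ab
      valuation_nonneg_iff(1)[OF K x(1) abK(1,2)] valuation_nonneg_iff(1)[OF K x(1) abK(3,4)]
      valuation_nonneg_iff(1)[OF K y(1) abK(1,2)] valuation_nonneg_iff(1)[OF K y(1) abK(3,4)]
    by (auto simp: v_def)
  show ?case
  proof (cases "valuation y w < 0")
    case True thus ?thesis using w by auto
  next
    case False
    \<comment> \<open>With r above every |v_z(w)|, the two summands have different valuations at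
      each z in S, so no pole can cancel.\<close>
    define r where "r = Suc (\<Sum>z\<in>S. nat \<bar>valuation z w\<bar>)"
    have r: "\<bar>valuation z w\<bar> < int r" if "z \<in> S" for z
    proof -
      have "nat \<bar>valuation z w\<bar> \<le> (\<Sum>z\<in>S. nat \<bar>valuation z w\<bar>)"
        using member_le_sum[of z S "\<lambda>z. nat \<bar>valuation z w\<bar>"] that insert(1) by auto
      thus ?thesis unfolding r_def by linarith
    qed
    have vr: "v ^ r \<in> K" "v ^ r \<noteq> 0" using vK subfield_closed(7)[OF K] by auto
    have "r > 0" by (simp add: r_def)
    hence rp: "int r > 0" by simp
    have y1: "w + v ^ r \<noteq> 0" "valuation y (w + v ^ r) < 0"
    proof -
      have l: "valuation y (v ^ r) < 0" unfolding valuation_power[OF K y(1) vK] using rp vv(2) by (rule mult_pos_neg)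
      show "w + v ^ r \<noteq> 0" "valuation y (w + v ^ r) < 0"
        using valuation_add_eq[OF K y(1) vr w(1,2)] l False by (auto simp: add.commute)
    qed
    have "valuation x (v ^ r) > 0" unfolding valuation_power[OF K x(1) vK] using rp vv(1) by (rule mult_pos_pos)
    hence x1: "0 < valuation x (w + v ^ r)" using valuation_add_ge[OF K x(1) w(1,2) vr y1(1)] w(3) by linarith
    have z1: "valuation z (w + v ^ r) < 0" if z: "z \<in> S" for z
    proof -
      have zc: "z \<in> closed_points k K" using z insert by auto
      have e: "valuation z (v ^ r) = int r * valuation z v" by (rule valuation_power[OF K zc vK])
      have wz: "valuation z w < 0" using w z by auto
      show ?thesis
      proof (cases "valuation z v < 0")
        case True
        hence "int r * valuation z v \<le> - int r" using mult_left_mono[of "valuation z v" "-1" "int r"] by auto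
        hence "valuation z (v ^ r) < valuation z w" using r[OF z] e by auto
        thus ?thesis using valuation_add_eq[OF K zc vr w(1,2)] wz by (auto simp: add.commute)
      next
        case False
        hence "int r * valuation z v \<ge> 0" by simp
        hence "valuation z w < valuation z (v ^ r)" using e wz by linarith
        thus ?thesis using valuation_add_eq[OF K zc w(1,2) vr] wz by auto
      qed
    qed
    show ?thesis using y1 x1 z1 w vr by (intro bexI[of _ "w + v ^ r"]) (auto intro!: subfield_closed[OF K])
  qed
qed

text \<open>The function 1 / (1 + w^m) is close to 1 where w has a zero and close to 0 where w has a
  pole.\<close>

lemma approximate_indicator:
  fixes k K x :: "'a::field_char_0 set"
  assumes K: "subfield K \<Omega>" and S: "finite S" "S \<subseteq> closed_points k K" and x: "x \<in> closed_points k K" "x \<notin> S"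
  shows "\<exists>e\<in>K. e - 1 \<in> frac_ideal K x (int n) \<and> (\<forall>y\<in>S. e \<in> frac_ideal K y (int n))"
proof -
  obtain w where w: "w \<in> K" "w \<noteq> 0" "0 < valuation x w" "\<forall>y\<in>S. valuation y w < 0"
    using separating_element[OF assms] by blast
  \<comment> \<open>\<open>Suc n\<close> keeps the valuations of 1 and w^m distinct even when n =
    0.\<close>
  define m where "m = Suc n"
  have wm: "w ^ m \<in> K" "w ^ m \<noteq> 0" using w subfield_closed(7)[OF K] by auto
  have o: "(1::'a) \<in> K" "(1::'a) \<noteq> 0" using subfield_closed(2)[OF K] by auto
  have vx: "valuation x (w ^ m) \<ge> int m"
    using valuation_power[OF K x(1) w(1,2), of m] mult_left_mono[of 1 "valuation x w" "int m"] w by auto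
  have vy: "valuation y (w ^ m) \<le> - int m" if "y \<in> S" for y
  proof -
    have y: "y \<in> closed_points k K" using that S by auto
    show ?thesis using valuation_power[OF K y w(1,2), of m] mult_left_mono[of "valuation y w" "-1" "int m"] w that by auto
  qed
  have nz: "1 + w ^ m \<noteq> 0" and v1: "valuation x (1 + w ^ m) = 0"
    using valuation_add_eq[OF K x(1) o wm] vx valuation_one[OF K x(1)] by (auto simp: m_def)
  have nzK: "1 + w ^ m \<in> K" using wm(1) o(1) subfield_closed(3)[OF K] by blast
  define e where "e = inverse (1 + w ^ m)"
  have eK: "e \<in> K" "e \<noteq> 0" using nz nzK by (auto simp: e_def intro!: subfield_closed[OF K])
  have "e - 1 = - (w ^ m / (1 + w ^ m))" using nz by (simp add: e_def field_simps)
  moreover have "w ^ m / (1 + w ^ m) \<in> frac_ideal K x (int n)"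
    using valuation_divide[OF K x(1) wm nzK nz] v1 vx wm nzK
    by (auto simp: frac_ideal_def m_def intro!: subfield_closed[OF K])
  ultimately have "e - 1 \<in> frac_ideal K x (int n)" using frac_ideal_uminus[OF K x(1)] by metis
  moreover have "e \<in> frac_ideal K y (int n)" if "y \<in> S" for y
  proof -
    have y: "y \<in> closed_points k K" using that S by auto
    have "valuation y (w ^ m + 1) = valuation y (w ^ m)"
      using valuation_add_eq[OF K y wm o] vy[OF that] valuation_one[OF K y] by (auto simp: m_def)
    hence "valuation y e \<ge> int n"
      using valuation_inverse[OF K y nzK nz] vy[OF that] by (simp add: e_def add.commute m_def)
    thus ?thesis using eK by (auto simp: frac_ideal_def)
  qed
  ultimately show ?thesis using eK by blast
qed

text \<open>Expansion in powers of h: read modulo h A, a relation loses its coefficients at h^0;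
  dividing by h then reduces n by one.\<close>

lemma indep_mod_powers:
  fixes k A :: "'a::field_char_0 set"
  assumes A: "k_subspace k A" "\<And>a. a \<in> A \<Longrightarrow> h * a \<in> A" "h \<noteq> 0" and k: "subfield k \<Omega>"
    and z: "indep_mod k ((*) h ` A) J z" "z ` J \<subseteq> A"
  shows "indep_mod k ((*) (h ^ n) ` A) (J \<times> {..<n}) (\<lambda>(j, l). z j * h ^ l)"
proof (induction n)
  case 0 show ?case by (auto simp: indep_mod_def)
next
  case (Suc n)
  have hp: "h ^ l * a \<in> A" if "a \<in> A" for l a
    using that A(2) by (induction l) (auto simp: mult.assoc)
  show ?case unfolding indep_mod_def
  proof (rule allI, rule impI, rule impI)
    fix c assume c: "\<forall>i\<in>J \<times> {..<Suc n}. c i \<in> k"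
      and sum: "(\<Sum>i\<in>J \<times> {..<Suc n}. c i * (case i of (j, l) \<Rightarrow> z j * h ^ l)) \<in> (*) (h ^ Suc n) ` A"
    define s0 where "s0 = (\<Sum>j\<in>J. c (j, 0) * z j)"
    define s1 where "s1 = (\<Sum>i\<in>J \<times> {..<n}. c (fst i, Suc (snd i)) * (case i of (j, l) \<Rightarrow> z j * h ^ l))"
    have "(\<Sum>i\<in>J \<times> {..<Suc n}. c i * (case i of (j, l) \<Rightarrow> z j * h ^ l))
        = (\<Sum>j\<in>J. \<Sum>l<Suc n. c (j, l) * (z j * h ^ l))"
      by (simp only: sum.cartesian_product) (auto intro!: sum.cong)
    also have "\<dots> = (\<Sum>j\<in>J. c (j, 0) * z j + (\<Sum>l<n. h * (c (j, Suc l) * (z j * h ^ l))))"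
      by (intro sum.cong refl) (simp only: sum.lessThan_Suc_shift, simp add: mult_ac)
    also have "\<dots> = s0 + h * (\<Sum>j\<in>J. \<Sum>l<n. c (j, Suc l) * (z j * h ^ l))"
      by (simp add: sum.distrib s0_def sum_distrib_left)
    also have "(\<Sum>j\<in>J. \<Sum>l<n. c (j, Suc l) * (z j * h ^ l)) = s1"
      unfolding s1_def by (simp only: sum.cartesian_product) (auto intro!: sum.cong)
    finally have eq: "(\<Sum>i\<in>J \<times> {..<Suc n}. c i * (case i of (j, l) \<Rightarrow> z j * h ^ l)) = s0 + h * s1" .
    then obtain a where a: "a \<in> A" "s0 + h * s1 = h ^ Suc n * a" using sum by auto
    have s1: "s1 \<in> A" unfolding s1_def
    proof (rule k_subspace_sum[OF A(1)])
      fix i assume i: "i \<in> J \<times> {..<n}"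
      show "c (fst i, Suc (snd i)) \<in> k" using c i by auto
      show "(case i of (j, l) \<Rightarrow> z j * h ^ l) \<in> A" using i z(2) hp[of "z (fst i)" "snd i"] by (auto simp: mult.commute)
    qed
    have "s0 = h * (h ^ n * a + (- 1) * s1)" using a by (simp add: algebra_simps)
    moreover have "(- 1) * s1 \<in> A" using A(1) s1 subfield_closed(5)[OF k subfield_closed(2)[OF k]]
      unfolding k_subspace_def by blast
    hence "h ^ n * a + (- 1) * s1 \<in> A" using A(1) hp[OF a(1), of n] unfolding k_subspace_def by blast
    ultimately have "s0 \<in> (*) h ` A" by blast
    hence c0: "c (j, 0) = 0" if "j \<in> J" for j
      using indep_modD[OF z(1), of "\<lambda>j. c (j, 0)" j] c that by (auto simp: s0_def)
    hence "s0 = 0" by (simp add: s0_def)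
    hence "s1 = h ^ n * a" using a A(3) by simp
    hence s1': "s1 \<in> (*) (h ^ n) ` A" using a by blast
    have c1: "c (j, Suc l) = 0" if "j \<in> J" "l < n" for j l
    proof -
      have "c (fst (j, l), Suc (snd (j, l))) = 0"
        by (rule indep_modD[OF Suc.IH, of "\<lambda>i. c (fst i, Suc (snd i))"]) (use c that s1' in \<open>auto simp: s1_def\<close>)
      thus ?thesis by simp
    qed
    show "\<forall>i\<in>J \<times> {..<Suc n}. c i = 0"
    proof
      fix i assume i: "i \<in> J \<times> {..<Suc n}"
      obtain j l where jl: "i = (j, l)" by (cases i)
      show "c i = 0" using i c0 c1 jl by (cases l) auto
    qed
  qed
qed

text \<open>The intersection with K gives the empty S the value K.\<close>

definition semilocal_ring :: "'a::field_char_0 set \<Rightarrow> 'a set set \<Rightarrow> 'a set"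
  where "semilocal_ring K S = K \<inter> \<Inter> S"

text \<open>The lower bound in the Chinese remainder theorem for A / h A, A semilocal: the local
  pieces x / m_x^v(h) contribute v(h) times the residue degree each. Local elements u t_x^l are made
  global by multiplication with approximate indicators of the points.\<close>

lemma independent_at_points:
  fixes k K :: "'a::field_char_0 set" and u :: "'a set \<Rightarrow> 'i \<Rightarrow> 'a"
  assumes k: "subfield k \<Omega>" and K: "subfield K \<Omega>" and S: "finite S" "S \<subseteq> closed_points k K"
    and h: "h \<in> K" "h \<noteq> 0" "\<And>x. x \<in> S \<Longrightarrow> 0 \<le> valuation x h"
    and u: "\<And>x. x \<in> S \<Longrightarrow> finite (I x)" "\<And>x. x \<in> S \<Longrightarrow> u x ` I x \<subseteq> x"
      "\<And>x. x \<in> S \<Longrightarrow> indep_mod k (maximal_ideal x) (I x) (u x)"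
  shows "\<exists>z. z ` (SIGMA x:S. I x \<times> {..<nat (valuation x h)}) \<subseteq> semilocal_ring K S \<and>
    indep_mod k ((*) h ` semilocal_ring K S) (SIGMA x:S. I x \<times> {..<nat (valuation x h)}) z"
proof -
  define v where "v x = nat (valuation x h)" for x
  define J where "J x = I x \<times> {..<v x}" for x
  have cp: "x \<in> closed_points k K" if "x \<in> S" for x using S that by auto
  have "\<exists>t. uniformizer x t \<and> t \<noteq> 0 \<and> t \<in> maximal_ideal x \<and> t \<in> K" if "x \<in> S" for x
    using obtain_uniformizer[OF K cp[OF that]] by metis
  then obtain t where t: "\<And>x. x \<in> S \<Longrightarrow> uniformizer x (t x)" "\<And>x. x \<in> S \<Longrightarrow> t x \<noteq> 0"
    "\<And>x. x \<in> S \<Longrightarrow> t x \<in> maximal_ideal x" "\<And>x. x \<in> S \<Longrightarrow> t x \<in> K" by metis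
  define b where "b x = (\<lambda>(i, l). u x i * t x ^ l)" for x
  have finJ: "finite (J x)" if "x \<in> S" for x using u(1)[OF that] by (auto simp: J_def)
  have bx: "b x i \<in> x" if "x \<in> S" "i \<in> J x" for x i
    using that u(2)[OF that(1)] t(3)[OF that(1)] cp_ring[OF K cp[OF that(1)]]
    by (auto simp: b_def J_def maximal_ideal_iff intro!: subring_mult subring_power)
  have bK: "b x i \<in> K" if "x \<in> S" "i \<in> J x" for x i
    using bx[OF that] cp_subset[OF K cp[OF that(1)]] by blast
  have indb: "indep_mod k (frac_ideal K x (int (v x))) (J x) (b x)" if x: "x \<in> S" for x
  proof -
    have "indep_mod k ((*) (t x ^ v x) ` x) (J x) (b x)" unfolding J_def b_def
    proof (rule indep_mod_powers)
      show "k_subspace k x" using k_subspace_frac_ideal[OF K cp[OF x], of 0] frac_ideal_0[OF K cp[OF x]] by simp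
      show "t x * a \<in> x" if "a \<in> x" for a
        using that t(3)[OF x] cp_ring[OF K cp[OF x]] by (auto simp: maximal_ideal_iff intro!: subring_mult)
      show "indep_mod k ((*) (t x) ` x) (I x) (u x)"
        using u(3)[OF x] t(1)[OF x] by (simp add: uniformizer_def)
    qed (use t u x k in auto)
    moreover have "frac_ideal K x (int (v x)) \<subseteq> (*) (t x ^ v x) ` x"
    proof
      fix f assume f: "f \<in> frac_ideal K x (int (v x))"
      hence "f \<in> K" by (simp add: frac_ideal_def)
      hence "f * t x powi (- int (v x)) \<in> x"
        using f frac_ideal_iff[OF K cp[OF x] t(1)[OF x] t(4)[OF x], of f "int (v x)"] by simp
      moreover have "f = t x ^ v x * (f * t x powi (- int (v x)))"
        using t(2)[OF x] by (simp add: power_int_minus)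
      ultimately show "f \<in> (*) (t x ^ v x) ` x" by blast
    qed
    ultimately show ?thesis unfolding indep_mod_def by blast
  qed
  \<comment> \<open>Accuracy n for the indicators beats all poles of the local elements: a factor in
    m_y^n sends each of them into m_y^v(h).\<close>
  define n where "n = (\<Sum>y\<in>S. \<Sum>x\<in>S. \<Sum>i\<in>J x. v y + nat \<bar>valuation y (b x i)\<bar>)"
  have n: "v y + nat \<bar>valuation y (b x i)\<bar> \<le> n" if "y \<in> S" "x \<in> S" "i \<in> J x" for x y i
  proof -
    have "v y + nat \<bar>valuation y (b x i)\<bar> \<le> (\<Sum>i\<in>J x. v y + nat \<bar>valuation y (b x i)\<bar>)"
      by (rule member_le_sum[OF that(3)]) (use finJ that in auto)
    also have "\<dots> \<le> (\<Sum>x\<in>S. \<Sum>i\<in>J x. v y + nat \<bar>valuation y (b x i)\<bar>)"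
      by (rule member_le_sum[OF that(2)]) (use S in auto)
    also have "\<dots> \<le> n" unfolding n_def by (rule member_le_sum[OF that(1)]) (use S in auto)
    finally show ?thesis .
  qed
  have bn: "a * b x i \<in> frac_ideal K y (int (v y))"
    if "y \<in> S" "x \<in> S" "i \<in> J x" "a \<in> frac_ideal K y (int n)" for x y i a
  proof -
    have "b x i \<in> frac_ideal K y (- int (nat \<bar>valuation y (b x i)\<bar>))" using bK[OF that(2,3)] by (auto simp: frac_ideal_def)
    hence "a * b x i \<in> frac_ideal K y (int n + - int (nat \<bar>valuation y (b x i)\<bar>))"
      using frac_ideal_mult[OF K cp[OF that(1)] that(4)] by blast
    moreover have "int (v y) \<le> int n + - int (nat \<bar>valuation y (b x i)\<bar>)" using n[OF that(1-3)] by linarith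
    ultimately show ?thesis using frac_ideal_mono[OF K cp[OF that(1)], of "int (v y)" "int n + - int (nat \<bar>valuation y (b x i)\<bar>)"] by blast
  qed
  have "\<exists>e\<in>K. e - 1 \<in> frac_ideal K x (int n) \<and> (\<forall>y\<in>S - {x}. e \<in> frac_ideal K y (int n))" if "x \<in> S" for x
    using approximate_indicator[of K "S - {x}" k x n] K S that by auto
  then obtain e where e: "\<And>x. x \<in> S \<Longrightarrow> e x \<in> K" "\<And>x. x \<in> S \<Longrightarrow> e x - 1 \<in> frac_ideal K x (int n)"
    "\<And>x y. x \<in> S \<Longrightarrow> y \<in> S \<Longrightarrow> y \<noteq> x \<Longrightarrow> e x \<in> frac_ideal K y (int n)" by (metis Diff_iff empty_iff insert_iff)
  define z where "z = (\<lambda>(x, i). e x * b x i)"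
  have vS: "int (v x) = valuation x h" if "x \<in> S" for x using h(3)[OF that] by (simp add: v_def)
  have zS: "z j \<in> semilocal_ring K S" if j: "j \<in> Sigma S J" for j
  proof -
    obtain x i where xi: "j = (x, i)" "x \<in> S" "i \<in> J x" using j by auto
    have "e x * b x i \<in> y" if y: "y \<in> S" for y
    proof (cases "y = x")
      case True
      have "(e x - 1) * b x i \<in> frac_ideal K x (int (v x))" using bn[OF xi(2) xi(2,3) e(2)[OF xi(2)]] .
      hence "(e x - 1) * b x i \<in> x"
        using frac_ideal_mono[OF K cp[OF xi(2)], of 0 "int (v x)"] frac_ideal_0[OF K cp[OF xi(2)]] by auto
      hence "(e x - 1) * b x i + b x i \<in> x" using bx[OF xi(2,3)] cp_ring[OF K cp[OF xi(2)]] subring_add by blast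
      thus ?thesis using True by (simp add: algebra_simps)
    next
      case False
      thus ?thesis using bn[OF y xi(2,3) e(3)[OF xi(2) y False]]
        frac_ideal_mono[OF K cp[OF y], of 0 "int (v y)"] frac_ideal_0[OF K cp[OF y]] by auto
    qed
    thus ?thesis using e(1)[OF xi(2)] bK[OF xi(2,3)] by (auto simp: semilocal_ring_def z_def xi intro!: subfield_closed[OF K])
  qed
  have "indep_mod k ((*) h ` semilocal_ring K S) (Sigma S J) z"
    unfolding indep_mod_def
  proof (rule allI, rule impI, rule impI, rule ballI)
    fix c j assume c: "\<forall>j\<in>Sigma S J. c j \<in> k" and sum: "(\<Sum>j\<in>Sigma S J. c j * z j) \<in> (*) h ` semilocal_ring K S"
      and j: "j \<in> Sigma S J"
    obtain x i where xi: "j = (x, i)" "x \<in> S" "i \<in> J x" using j by auto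
    let ?F = "frac_ideal K x (int (v x))"
    note sub = k_subspace_frac_ideal[OF K cp[OF xi(2)], of "int (v x)"]
    have "(\<Sum>j\<in>Sigma S J. c j * z j) \<in> ?F"
    proof -
      obtain a where a: "a \<in> K" "a \<in> x" "(\<Sum>j\<in>Sigma S J. c j * z j) = h * a"
        using sum xi by (auto simp: semilocal_ring_def)
      have "h \<in> ?F" using vS[OF xi(2)] h by (auto simp: frac_ideal_def)
      hence "h * a \<in> frac_ideal K x (int (v x) + 0)"
        using frac_ideal_mult[OF K cp[OF xi(2)]] a frac_ideal_0[OF K cp[OF xi(2)]] by blast
      thus ?thesis using a by simp
    qed
    also have "(\<Sum>j\<in>Sigma S J. c j * z j) = (\<Sum>y\<in>S. \<Sum>i\<in>J y. c (y, i) * (e y * b y i))"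
      using S finJ by (subst sum.Sigma) (auto simp: z_def intro!: sum.cong)
    also have "\<dots> = (\<Sum>i\<in>J x. c (x, i) * (e x * b x i)) + (\<Sum>y\<in>S-{x}. \<Sum>i\<in>J y. c (y, i) * (e y * b y i))"
      using S xi by (intro sum.remove) auto
    finally have 1: "(\<Sum>i\<in>J x. c (x, i) * (e x * b x i)) + (\<Sum>y\<in>S-{x}. \<Sum>i\<in>J y. c (y, i) * (e y * b y i)) \<in> ?F" .
    \<comment> \<open>Modulo m_x^v(h) the other points drop out and the indicator at x becomes 1,
      which leaves the local relation at x.\<close>
    have 2: "(\<Sum>y\<in>S-{x}. 1 * (\<Sum>i\<in>J y. c (y, i) * (e y * b y i))) \<in> ?F"
    proof (intro k_subspace_sum[OF sub])
      fix y i assume "y \<in> S - {x}" "i \<in> J y"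
      thus "e y * b y i \<in> ?F" using bn[OF xi(2), of y i "e y"] e(3)[of y x] xi by auto
    qed (use c subfield_closed(2)[OF k] in auto)
    have 3: "(\<Sum>i\<in>J x. c (x, i) * ((e x - 1) * b x i)) \<in> ?F"
    proof (intro k_subspace_sum[OF sub])
      fix i assume "i \<in> J x"
      thus "(e x - 1) * b x i \<in> ?F" using bn[OF xi(2) xi(2) _ e(2)[OF xi(2)]] by blast
    qed (use c xi in auto)
    have "(\<Sum>i\<in>J x. c (x, i) * (e x * b x i)) - (\<Sum>i\<in>J x. c (x, i) * ((e x - 1) * b x i)) \<in> ?F"
      using frac_ideal_diff[OF K cp[OF xi(2)] frac_ideal_diff[OF K cp[OF xi(2)] 1 2] 3] by simp
    also have "(\<Sum>i\<in>J x. c (x, i) * (e x * b x i)) - (\<Sum>i\<in>J x. c (x, i) * ((e x - 1) * b x i))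
        = (\<Sum>i\<in>J x. c (x, i) * b x i)"
      unfolding sum_subtractf[symmetric] by (intro sum.cong) (auto simp: algebra_simps)
    finally have "c (x, i) = 0"
      by (intro indep_modD[OF indb[OF xi(2)], of "\<lambda>i. c (x, i)" i]) (use c xi in auto)
    thus "c j = 0" by (simp add: xi)
  qed
  thus ?thesis using zS unfolding J_def v_def by blast
qed

text \<open>Counting: if the powers of \<open>h\<close> times elements of \<open>K\<close> stay in spaces whose dimension grows
  with slope at most \<open>M\<close>, then \<open>M\<close> bounds the number of zeros of \<open>h\<close>, that is, the degree of \<open>K\<close>
  over \<open>k(h)\<close>.\<close>

lemma zeros_bound:
  fixes k K :: "'a::field_char_0 set" and u :: "'a set \<Rightarrow> 'i \<Rightarrow> 'a"
  assumes k: "subfield k \<Omega>" and K: "subfield K \<Omega>" and S: "finite S" "S \<subseteq> closed_points k K"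
    and h: "h \<in> K" "h \<noteq> 0" "\<And>x. x \<in> S \<Longrightarrow> 0 \<le> valuation x h"
    and u: "\<And>x. x \<in> S \<Longrightarrow> finite (I x)" "\<And>x. x \<in> S \<Longrightarrow> u x ` I x \<subseteq> x"
      "\<And>x. x \<in> S \<Longrightarrow> indep_mod k (maximal_ideal x) (I x) (u x)"
    and growth: "\<And>Z. finite Z \<Longrightarrow> Z \<subseteq> K \<Longrightarrow>
      \<exists>m. \<forall>L. codim_le k {z * h ^ l | z l. z \<in> Z \<and> l < L} {0} (m + M * L)"
  shows "(\<Sum>x\<in>S. nat (valuation x h) * card (I x)) \<le> M"
proof (cases "S = {}")
  case False
  define J where "J = (SIGMA x:S. I x \<times> {..<nat (valuation x h)})"
  define A where "A = semilocal_ring K S"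
  obtain z where z: "z ` J \<subseteq> A" "indep_mod k ((*) h ` A) J z"
    using independent_at_points[OF k K S h u] unfolding J_def A_def by blast
  have fin: "finite J" unfolding J_def using S u(1) by auto
  have cp: "x \<in> closed_points k K" if "x \<in> S" for x using S that by auto
  have sub: "k_subspace k A"
  proof -
    have "k_subspace k x" if "x \<in> S" for x
      using k_subspace_frac_ideal[OF K cp[OF that], of 0] frac_ideal_0[OF K cp[OF that]] by simp
    moreover have "k_subspace k K" if "x \<in> S" for x
      using cp_scalars[OF K cp[OF that]] cp_subset[OF K cp[OF that]] K
      by (auto simp: k_subspace_def intro!: subfield_closed)
    moreover obtain x where "x \<in> S" using False by blast
    ultimately show ?thesis unfolding A_def semilocal_ring_def k_subspace_def by (auto 4 4)
  qed
  have hA: "h * a \<in> A" if "a \<in> A" for a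
  proof -
    have "h \<in> x" if "x \<in> S" for x using valuation_nonneg_iff(1)[OF K cp[OF that] h(1,2)] h(3)[OF that] by simp
    hence "h * a \<in> x" if "x \<in> S" for x
      using subring_mult[OF cp_ring[OF K cp[OF that]], of h a] that \<open>a \<in> A\<close> by (auto simp: A_def semilocal_ring_def)
    thus ?thesis using that h(1) subfield_closed(4)[OF K, of h a] by (auto simp: A_def semilocal_ring_def)
  qed
  have "finite (z ` J)" "z ` J \<subseteq> K" using fin z by (auto simp: A_def semilocal_ring_def)
  then obtain m where m: "\<And>L. codim_le k {y * h ^ l | y l. y \<in> z ` J \<and> l < L} {0} (m + M * L)"
    using growth[of "z ` J"] by blast
  have le: "card J * L \<le> m + M * L" for L
  proof -
    have "indep_mod k ((*) (h ^ L) ` A) (J \<times> {..<L}) (\<lambda>(j, l). z j * h ^ l)"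
      by (rule indep_mod_powers[OF sub hA h(2) k z(2,1)])
    moreover have "0 \<in> (*) (h ^ L) ` A" using sub by (force simp: k_subspace_def)
    ultimately have ind: "indep_mod k {0} (J \<times> {..<L}) (\<lambda>(j, l). z j * h ^ l)"
      unfolding indep_mod_def by auto
    obtain m' w where w: "m' \<le> m + M * L" "gen_mod k {0} {..<m'} w {y * h ^ l | y l. y \<in> z ` J \<and> l < L}"
      using m[of L] by (auto simp: codim_le_def)
    have "card (J \<times> {..<L}) \<le> card {..<m'}"
      by (rule steinitz[OF k k_subspace_0[OF k] ind _ _ w(2)]) (use fin in auto)
    thus ?thesis using w(1) by (simp add: card_cartesian_product)
  qed
  have "card J \<le> M"
  proof (rule ccontr)
    assume "\<not> card J \<le> M"
    \<comment> \<open>L = m + 1 is large enough to make the constant m irrelevant against a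
      difference in slope.\<close>
    hence "Suc M * Suc m \<le> card J * Suc m" by (intro mult_right_mono) auto
    also have "\<dots> \<le> m + M * Suc m" by (rule le)
    finally show False by simp
  qed
  moreover have "card J = (\<Sum>x\<in>S. nat (valuation x h) * card (I x))"
    unfolding J_def using S u(1) by (subst card_SigmaI) (auto simp: card_cartesian_product mult.commute)
  ultimately show ?thesis by simp
qed simp

section \<open>Existence of valuation rings\<close>

lemma subring_Union_chain:
  fixes C :: "'a::field_char_0 set set"
  assumes "C \<noteq> {}" "\<And>R. R \<in> C \<Longrightarrow> subring R \<Omega>" "\<And>R S. R \<in> C \<Longrightarrow> S \<in> C \<Longrightarrow> R \<subseteq> S \<or> S \<subseteq> R"
  shows "subring (\<Union> C) \<Omega>"
proof (rule ambient_subringI)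
  show "1 \<in> \<Union> C" using assms subring_1 by blast
  show "- a \<in> \<Union> C" if "a \<in> \<Union> C" for a using that assms(2) subring_uminus by blast
  fix a b assume "a \<in> \<Union> C" "b \<in> \<Union> C"
  then obtain R where R: "R \<in> C" "a \<in> R" "b \<in> R" using assms(3) by blast
  show "a + b \<in> \<Union> C" "a * b \<in> \<Union> C"
    using R subring_add[OF assms(2)[OF R(1)] R(2,3)] subring_mult[OF assms(2)[OF R(1)] R(2,3)] by blast+
qed

lemma subring_poly_image:
  fixes R :: "'a::field_char_0 set" assumes R: "subring R \<Omega>"
  shows "subring {poly p c | p. p \<in> poly_over R} \<Omega>" and "R \<subseteq> {poly p c | p. p \<in> poly_over R}"
    and "c \<in> {poly p c | p. p \<in> poly_over R}"
proof -
  let ?E = "{poly p c | p. p \<in> poly_over R}"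
  show "R \<subseteq> ?E"
  proof
    fix r assume "r \<in> R"
    hence "[:r:] \<in> poly_over R" "poly [:r:] c = r" using poly_over_pCons[OF R] poly_over_0[OF R] by auto
    thus "r \<in> ?E" by (metis (mono_tags, lifting) mem_Collect_eq)
  qed
  have "[:0, 1:] \<in> poly_over R" "poly [:0, 1:] c = c"
    using poly_over_pCons[OF R] poly_over_0[OF R] subring_0[OF R] subring_1[OF R] by auto
  thus "c \<in> ?E" by (metis (mono_tags, lifting) mem_Collect_eq)
  show "subring ?E \<Omega>"
  proof (rule ambient_subringI)
    show "1 \<in> ?E" using poly_over_1[OF R] by (metis (mono_tags, lifting) mem_Collect_eq poly_1)
    fix a assume "a \<in> ?E"
    then obtain p where p: "a = poly p c" "p \<in> poly_over R" by blast
    show "- a \<in> ?E" using poly_over_uminus[OF R p(2)] p(1) by (metis (mono_tags, lifting) mem_Collect_eq poly_minus)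
    fix b assume "b \<in> ?E"
    then obtain q where q: "b = poly q c" "q \<in> poly_over R" by blast
    show "a + b \<in> ?E" using poly_over_add[OF R p(2) q(2)] p(1) q(1) by (metis (mono_tags, lifting) mem_Collect_eq poly_add)
    show "a * b \<in> ?E" using poly_over_mult[OF R p(2) q(2)] p(1) q(1) by (metis (mono_tags, lifting) mem_Collect_eq poly_mult)
  qed
qed

lemma clear_inverse_powers:
  fixes R :: "'a::field_char_0 set"
  assumes R: "subring R \<Omega>" and p: "p \<in> poly_over R" and u: "u \<in> R" "u \<noteq> 0" and n: "degree p \<le> n"
  shows "u ^ n * poly p (inverse u) \<in> R"
proof -
  have "u ^ n * poly p (inverse u) = (\<Sum>i\<le>degree p. coeff p i * u ^ (n - i))"
    unfolding poly_altdef sum_distrib_left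
  proof (intro sum.cong refl)
    fix i assume "i \<in> {..degree p}"
    hence "u ^ n = u ^ (n - i) * u ^ i" using n by (simp add: power_add[symmetric])
    thus "u ^ n * (coeff p i * inverse u ^ i) = coeff p i * u ^ (n - i)"
      using u by (simp add: power_inverse field_simps)
  qed
  also have "\<dots> \<in> R" by (intro subring_sum subring_mult subring_power R poly_overD p u)
  finally show ?thesis .
qed

text \<open>W is a subring M containing R and maximal among those without 1/a. By maximality every c
  outside M satisfies a p(c) = 1 for some polynomial p over M; if c and 1/c were both outside, two
  such relations of least degree could be played off against each other.\<close>

lemma chevalley:
  fixes R :: "'a::field_char_0 set"
  assumes R: "subring R \<Omega>" and a: "a \<in> R" "a \<noteq> 0" "inverse a \<notin> R"
  shows "\<exists>W. valuation_ring UNIV W \<and> R \<subseteq> W \<and> a \<in> maximal_ideal W"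
proof -
  let ?A = "{S. subring S \<Omega> \<and> R \<subseteq> S \<and> inverse a \<notin> S}"
  have "\<exists>M\<in>?A. \<forall>S\<in>?A. M \<subseteq> S \<longrightarrow> S = M"
  proof (rule subset_Zorn_nonempty)
    show "?A \<noteq> {}" using assms by blast
    fix C assume C: "C \<noteq> {}" "subset.chain ?A C"
    hence "subring (\<Union> C) \<Omega>" by (intro subring_Union_chain) (auto simp: subset_chain_def)
    thus "\<Union> C \<in> ?A" using C by (auto simp: subset_chain_def)
  qed
  then obtain M where M0: "M \<in> ?A" and max0: "\<forall>S\<in>?A. M \<subseteq> S \<longrightarrow> S = M" by (elim bexE)
  have M: "subring M \<Omega>" "R \<subseteq> M" "inverse a \<notin> M" using M0 by simp_all
  have max: "S = M" if "subring S \<Omega>" "M \<subseteq> S" "inverse a \<notin> S" for S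
  proof -
    have "S \<in> ?A" using that M(2) by simp
    thus ?thesis using max0 that(2) by simp
  qed
  have aM: "a \<in> M" using M a by blast
  have rep: "\<exists>p\<in>poly_over M. inverse a = poly p c" if "c \<notin> M" for c
  proof (rule ccontr)
    assume "\<not> ?thesis"
    hence "{poly p c | p. p \<in> poly_over M} = M"
      by (intro max subring_poly_image M(1)) blast
    thus False using subring_poly_image(3)[OF M(1), of c] that by blast
  qed
  \<comment> \<open>If 1/u were outside M for u = 1 - a s, then 1/a would be a polynomial in 1/u;
    clearing denominators by u^n = 1 - a s' gives 1/a = u^n / a + s', with both terms in M.\<close>
  have unit: "1 - a * s \<noteq> 0 \<and> inverse (1 - a * s) \<in> M" if s: "s \<in> M" for s
  proof -
    define u where "u = 1 - a * s"
    have u0: "u \<noteq> 0"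
    proof
      assume "u = 0"
      hence "s = inverse a" using a by (simp add: u_def field_simps)
      thus False using s M by simp
    qed
    have uM: "u \<in> M" unfolding u_def using s aM by (intro subring_diff subring_mult subring_1 M)
    have "inverse u \<in> M"
    proof (rule ccontr)
      assume "inverse u \<notin> M"
      then obtain p where p: "p \<in> poly_over M" "inverse a = poly p (inverse u)" using rep by blast
      define n where "n = degree p"
      have r: "u ^ n * inverse a \<in> M" using clear_inverse_powers[OF M(1) p(1) uM u0, of n] p(2) by (simp add: n_def)
      have "\<exists>s'\<in>M. u ^ i = 1 - a * s'" for i
      proof (induction i)
        case (Suc i)
        then obtain s' where s': "s' \<in> M" "u ^ i = 1 - a * s'" by blast
        have "u ^ Suc i = u * (1 - a * s')" unfolding s'(2)[symmetric] by simp
        also have "\<dots> = 1 - a * (s + s' - a * s * s')" by (simp add: u_def algebra_simps)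
        finally have "u ^ Suc i = 1 - a * (s + s' - a * s * s')" .
        moreover have "s + s' - a * s * s' \<in> M" using s s' aM by (intro subring_diff subring_add subring_mult M)
        ultimately show ?case by blast
      qed (auto intro!: bexI[of _ 0] subring_0 M)
      then obtain s' where s': "s' \<in> M" "u ^ n = 1 - a * s'" by blast
      have "inverse a = u ^ n * inverse a + s'" using s' a by (simp add: field_simps)
      thus False using subring_add[OF M(1) r s'(1)] M(3) by simp
    qed
    thus ?thesis using u0 by (simp add: u_def)
  qed
  define Q where "Q c n \<longleftrightarrow> (\<exists>p\<in>poly_over M. degree p \<le> n \<and> a * poly p c = 1)" for c n
  have Qex: "\<exists>n. Q c n" if c: "c \<notin> M" for c
  proof -
    obtain p where "p \<in> poly_over M" "inverse a = poly p c" using rep[OF c] by blast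
    thus ?thesis using a unfolding Q_def by (intro exI[of _ "degree p"] bexI[of _ p]) (auto simp flip: \<open>inverse a = poly p c\<close>)
  qed
  have Q0: "\<not> Q c 0" for c
  proof
    assume "Q c 0"
    then obtain p where p: "p \<in> poly_over M" "degree p = 0" "a * poly p c = 1" by (auto simp: Q_def)
    then obtain s where "p = [:s:]" by (metis degree_eq_zeroE)
    hence "a * s = 1" "s \<in> M" using p poly_over_pCons[OF M(1)] by auto
    hence "inverse a = s" by (simp add: inverse_unique)
    thus False using \<open>s \<in> M\<close> M by simp
  qed
  \<comment> \<open>In a q(1/c) = 1 the constant term of q is moved to the other side, where it
    forms the unit u. Multiplying by c^n writes c^n as a times a polynomial in c of degree below n,
    which replaces the leading term of p.\<close>
  have reduce: "Q c (n - 1)" if c: "c \<noteq> 0" and n: "Q c n" and m: "Q (inverse c) m" "m \<le> n" "n > 0" for c n m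
  proof -
    obtain p where p: "p \<in> poly_over M" "degree p \<le> n" "a * poly p c = 1" using n by (auto simp: Q_def)
    obtain q where q: "q \<in> poly_over M" "degree q \<le> m" "a * poly q (inverse c) = 1" using m by (auto simp: Q_def)
    define u where "u = 1 - a * coeff q 0"
    have u: "u \<noteq> 0" "inverse u \<in> M" using unit[of "coeff q 0"] poly_overD[OF q(1)] by (auto simp: u_def)
    define q' where "q' = (\<Sum>j\<in>{1..m}. monom (coeff q j * inverse u) (n - j))"
    have q': "q' \<in> poly_over M"
      unfolding q'_def poly_over_def using q u M(1)
      by (auto simp: coeff_sum intro!: subring_sum subring_mult poly_overD subring_0)
    have dq': "degree q' \<le> n - 1" unfolding q'_def
      by (intro degree_sum_le) (auto intro: order.trans[OF degree_monom_le])
    have "poly q (inverse c) = (\<Sum>j\<le>m. coeff q j * inverse c ^ j)"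
      unfolding poly_altdef using q(2) by (intro sum.mono_neutral_left) (auto simp: coeff_eq_0)
    also have "{..m} = insert 0 {1..m}" by auto
    finally have "a * (\<Sum>j\<in>{1..m}. coeff q j * inverse c ^ j) = u"
      using q(3) by (simp add: u_def algebra_simps)
    hence "c ^ n * u = a * (c ^ n * (\<Sum>j\<in>{1..m}. coeff q j * inverse c ^ j))" by (metis mult.left_commute)
    also have "c ^ n * (\<Sum>j\<in>{1..m}. coeff q j * inverse c ^ j) = (\<Sum>j\<in>{1..m}. coeff q j * (c ^ n * inverse c ^ j))"
      unfolding sum_distrib_left by (intro sum.cong refl) (simp only: mult.left_commute)
    also have "(\<Sum>j\<in>{1..m}. coeff q j * (c ^ n * inverse c ^ j)) = (\<Sum>j\<in>{1..m}. coeff q j * c ^ (n - j))"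
    proof (intro sum.cong refl)
      fix j assume "j \<in> {1..m}"
      hence "c ^ n = c ^ (n - j) * c ^ j" using m(2) by (simp add: power_add[symmetric])
      thus "coeff q j * (c ^ n * inverse c ^ j) = coeff q j * c ^ (n - j)" using c by (simp add: power_inverse)
    qed
    also have "\<dots> = u * poly q' c"
    proof -
      have "u * poly q' c = (\<Sum>j\<in>{1..m}. u * (coeff q j * inverse u * c ^ (n - j)))"
        by (simp only: q'_def poly_sum poly_monom sum_distrib_left)
      also have "\<dots> = (\<Sum>j\<in>{1..m}. coeff q j * c ^ (n - j))" using u by (intro sum.cong) auto
      finally show ?thesis by simp
    qed
    finally have cn: "c ^ n = a * poly q' c" using u by (simp add: mult_ac)
    define p0 where "p0 = p - monom (coeff p n) n"
    have "degree p0 \<le> n" unfolding p0_def using p(2) by (intro degree_diff_le degree_monom_le)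
    moreover have "coeff p0 n = 0" by (simp add: p0_def)
    ultimately have dp0: "degree p0 \<le> n - 1" using m(3)
      by (metis One_nat_def Suc_pred degree_0 eq_zero_or_degree_less le_zero_eq less_Suc_eq_le less_or_eq_imp_le zero_le)
    have p0: "p0 \<in> poly_over M" unfolding p0_def
      using p M(1) by (intro poly_over_diff poly_over_monom poly_overD)
    define f where "f = p0 + smult (a * coeff p n) q'"
    have "poly p c = poly p0 c + coeff p n * c ^ n" by (simp add: p0_def poly_monom)
    also have "\<dots> = poly f c" by (simp add: f_def cn mult_ac)
    finally have "a * poly f c = 1" using p by simp
    moreover have "f \<in> poly_over M" unfolding f_def using p0 q' aM poly_overD[OF p(1)]
      by (intro poly_over_add poly_over_smult subring_mult M(1)) auto
    moreover have "degree f \<le> n - 1" unfolding f_def using dp0 dq'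
      by (intro degree_add_le order.trans[OF degree_smult_le]) auto
    ultimately show ?thesis by (auto simp: Q_def)
  qed
  have dich: "c \<in> M \<or> inverse c \<in> M" for c
  proof (rule ccontr)
    assume "\<not> ?thesis"
    hence c: "c \<notin> M" "inverse c \<notin> M" by auto
    hence c0: "c \<noteq> 0" using subring_0[OF M(1)] by auto
    define n where "n = (LEAST n. Q c n)"
    define m where "m = (LEAST n. Q (inverse c) n)"
    have n: "Q c n" "\<And>i. Q c i \<Longrightarrow> n \<le> i" unfolding n_def
      using LeastI_ex[OF Qex[OF c(1)]] Least_le by metis+
    have m: "Q (inverse c) m" "\<And>i. Q (inverse c) i \<Longrightarrow> m \<le> i" unfolding m_def
      using LeastI_ex[OF Qex[OF c(2)]] Least_le by metis+
    have pos: "n > 0" "m > 0" using n(1) m(1) Q0 by (metis gr0I)+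
    show False
    proof (cases "m \<le> n")
      case True
      thus False using n(2)[OF reduce[OF c0 n(1) m(1)]] pos by auto
    next
      case False
      have "Q (inverse (inverse c)) n" using n(1) by simp
      thus False using m(2)[OF reduce[of "inverse c" m n]] c0 m(1) False pos by auto
    qed
  qed
  thus ?thesis using M aM by (intro exI[of _ M]) (auto simp: valuation_ring_def maximal_ideal_iff)
qed

lemma valuation_ring_restrict:
  fixes F K W :: "'a::field_char_0 set"
  assumes F: "subfield F \<Omega>" "F \<subseteq> K" and W: "valuation_ring K W"
  shows "valuation_ring F (W \<inter> F)" "maximal_ideal (W \<inter> F) = maximal_ideal W \<inter> F"
    "units_of_ring (W \<inter> F) = units_of_ring W \<inter> F"
proof -
  have "subring (W \<inter> F) \<Omega>"
    using W subfield_subring[OF F(1)] by (intro ambient_subringI) (auto simp: valuation_ring_def intro: subring_closed)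
  thus "valuation_ring F (W \<inter> F)" using W F subfield_inverse[OF F(1)] by (auto simp: valuation_ring_def)
  show "maximal_ideal (W \<inter> F) = maximal_ideal W \<inter> F" "units_of_ring (W \<inter> F) = units_of_ring W \<inter> F"
    using subfield_inverse[OF F(1)] by (auto simp: maximal_ideal_iff units_of_ring_iff)
qed

section \<open>Places of the rational function field\<close>

definition rational_functions :: "'a::field_char_0 set \<Rightarrow> 'a \<Rightarrow> 'a set"
  where "rational_functions k t = {poly p t / poly q t | p q. p \<in> poly_over k \<and> q \<in> poly_over k \<and> q \<noteq> 0}"

definition transcendental_over :: "'a::field_char_0 set \<Rightarrow> 'a \<Rightarrow> bool"
  where "transcendental_over k t \<longleftrightarrow> (\<forall>p\<in>poly_over k. poly p t = 0 \<longrightarrow> p = 0)"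

text \<open>Division with remainder by the polynomial m of least degree vanishing at W shows that
  every p(t) in the maximal ideal is divisible by m(t), so m(t) is a uniformizer and every p(t) is a
  unit times a power of it.\<close>

lemma rational_place:
  fixes k W :: "'a::field_char_0 set"
  assumes k: "subfield k \<Omega>" and t: "transcendental_over k t" and F: "subfield (rational_functions k t) \<Omega>"
    and W: "valuation_ring (rational_functions k t) W" "k \<subseteq> W" "t \<in> W"
    and m: "m \<in> poly_over k" "m \<noteq> 0" "poly m t \<in> maximal_ideal W"
      "\<And>p. p \<in> poly_over k \<Longrightarrow> p \<noteq> 0 \<Longrightarrow> poly p t \<in> maximal_ideal W \<Longrightarrow> degree m \<le> degree p"
  shows "W \<in> closed_points k (rational_functions k t)" "uniformizer W (poly m t)"
proof -
  note V = F W(1)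
  have nz: "poly p t \<noteq> 0" if "p \<in> poly_over k" "p \<noteq> 0" for p using t that by (auto simp: transcendental_over_def)
  have pW: "poly p t \<in> W" if "p \<in> poly_over k" for p
    using poly_in_subring[OF valuation_ring_subring[OF V] _ W(3)] that poly_over_mono[OF W(2)] by blast
  have dm: "degree m > 0"
  proof (rule ccontr)
    assume "\<not> degree m > 0"
    then obtain c where c: "m = [:c:]" by (metis degree_eq_zeroE neq0_conv)
    hence "c \<in> k" "c \<noteq> 0" using m poly_over_pCons[OF subfield_subring[OF k]] by auto
    hence "inverse c \<in> W" using W subfield_inverse[OF k] by auto
    thus False using m(3) c \<open>c \<noteq> 0\<close> by (auto simp: maximal_ideal_iff)
  qed
  have pol: "\<exists>n u. u \<in> units_of_ring W \<and> poly p t = u * poly m t ^ n" if "p \<in> poly_over k" "p \<noteq> 0" for p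
    using that
  proof (induction "degree p" arbitrary: p rule: less_induct)
    case less
    show ?case
    proof (cases "poly p t \<in> maximal_ideal W")
      case False
      hence "poly p t \<in> units_of_ring W" using ring_cases[OF V] pW[OF less.prems(1)] by blast
      thus ?thesis by (intro exI[of _ 0] exI[of _ "poly p t"]) auto
    next
      case True
      obtain q r where qr: "q \<in> poly_over k" "r \<in> poly_over k" "p = q * m + r" "r = 0 \<or> degree r < degree m"
        using poly_over_division[OF k m(1,2) less.prems(1)] .
      have "poly r t = poly p t - poly m t * poly q t" using qr by (simp add: mult.commute)
      hence "poly r t \<in> maximal_ideal W"
        using True maximal_ideal_diff[OF V] maximal_ideal_mult[OF V m(3) pW[OF qr(1)]] by metis
      hence r0: "r = 0" using m(4)[OF qr(2)] qr(4) by (metis leD)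
      hence "q \<noteq> 0" "degree q < degree p" using qr less.prems m dm by (auto simp: degree_mult_eq)
      then obtain n u where nu: "u \<in> units_of_ring W" "poly q t = u * poly m t ^ n" using less.hyps[of q] qr by blast
      hence "poly p t = u * poly m t ^ Suc n" using qr r0 by simp
      thus ?thesis using nu by blast
    qed
  qed
  have mt: "poly m t \<noteq> 0" using nz m by blast
  show "W \<in> closed_points k (rational_functions k t)" "uniformizer W (poly m t)"
  proof -
    have "\<exists>n u. u \<in> units_of_ring W \<and> f = u * poly m t powi n" if f: "f \<in> rational_functions k t" "f \<noteq> 0" for f
    proof -
      obtain p q where pq: "f = poly p t / poly q t" "p \<in> poly_over k" "q \<in> poly_over k" "q \<noteq> 0"
        using f by (auto simp: rational_functions_def)
      hence "p \<noteq> 0" using f by auto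
      obtain n u where nu: "u \<in> units_of_ring W" "poly p t = u * poly m t ^ n" using pol[OF pq(2) \<open>p \<noteq> 0\<close>] by blast
      obtain n' u' where nu': "u' \<in> units_of_ring W" "poly q t = u' * poly m t ^ n'" using pol[OF pq(3,4)] by blast
      have "f = (u / u') * poly m t powi (int n - int n')"
        using pq(1) nu(2) nu'(2) mt by (simp add: power_int_diff)
      thus ?thesis using units_divide[OF V nu(1) nu'(1)] by blast
    qed
    thus "W \<in> closed_points k (rational_functions k t)" "uniformizer W (poly m t)"
      using closed_pointI[OF V W(2) m(3) mt] by blast+
  qed
qed

lemma exists_minimal_polynomial:
  fixes k :: "'a::field_char_0 set"
  assumes "p \<in> poly_over k" "p \<noteq> 0" "poly p t \<in> I"
  obtains m where "m \<in> poly_over k" "m \<noteq> 0" "poly m t \<in> I"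
    "\<And>p. p \<in> poly_over k \<Longrightarrow> p \<noteq> 0 \<Longrightarrow> poly p t \<in> I \<Longrightarrow> degree m \<le> degree p"
  using ex_has_least_nat[of "\<lambda>p. p \<in> poly_over k \<and> p \<noteq> 0 \<and> poly p t \<in> I" p degree] assms that by metis

text \<open>p(t) is not invertible in k[t], a polynomial ring as t is transcendental; apply
  \<open>chevalley\<close> to it.\<close>

lemma exists_place:
  fixes k :: "'a::field_char_0 set"
  assumes k: "subfield k \<Omega>" and t: "transcendental_over k t" and p: "p \<in> poly_over k" "degree p > 0"
  obtains W where "valuation_ring UNIV W" "k \<subseteq> W" "t \<in> W" "poly p t \<in> maximal_ideal W"
proof -
  note kr = subfield_subring[OF k]
  let ?R = "{poly p t | p. p \<in> poly_over k}"
  have "inverse (poly p t) \<notin> ?R"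
  proof
    assume "inverse (poly p t) \<in> ?R"
    then obtain q where q: "q \<in> poly_over k" "inverse (poly p t) = poly q t" by blast
    have "poly p t \<noteq> 0" using p t by (auto simp: transcendental_over_def)
    hence "poly (p * q - 1) t = 0" using q by (simp flip: q(2))
    hence "p * q = 1" using t poly_over_diff[OF kr poly_over_mult[OF kr p(1) q(1)] poly_over_1[OF kr]]
      by (auto simp: transcendental_over_def)
    hence "degree p = 0" by (metis degree_1 dvd_triv_left is_unit_iff_degree one_neq_zero zero_neq_one degree_0 less_not_refl2 dvd_def p(2))
    thus False using p by simp
  qed
  moreover have "poly p t \<in> ?R" "poly p t \<noteq> 0" using p t by (auto simp: transcendental_over_def)
  ultimately obtain W where "valuation_ring UNIV W" "?R \<subseteq> W" "poly p t \<in> maximal_ideal W"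
    using chevalley[OF subring_poly_image(1)[OF kr, of t]] by blast
  thus ?thesis using that[of W] subring_poly_image(2,3)[OF kr, of t] by blast
qed

section \<open>Quadratic extensions\<close>

locale quadratic =
  fixes k F K :: "'a::field_char_0 set" and y
  assumes k: "subfield k \<Omega>" and F: "subfield F \<Omega>" and K: "subfield K \<Omega>" and FK: "F \<subseteq> K"
    and y: "y \<in> K" "y \<notin> F" "y ^ 2 \<in> F" and KF: "\<And>z. z \<in> K \<Longrightarrow> \<exists>a\<in>F. \<exists>b\<in>F. z = a + b * y"
begin

text \<open>B and C are minus the trace and the norm of z; the norm is nonzero because y is not in
  F.\<close>

lemma quadratic_equation:
  assumes "z \<in> K" "z \<notin> F"
  obtains B C where "B \<in> F" "C \<in> F" "C \<noteq> 0" "z ^ 2 + B * z + C = 0"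
proof -
  obtain a b where ab: "a \<in> F" "b \<in> F" "z = a + b * y" using KF assms by blast
  have b: "b \<noteq> 0" using ab assms by auto
  have "a - b * y \<noteq> 0"
  proof
    assume "a - b * y = 0"
    hence "y = a / b" using b by (simp add: field_simps)
    thus False using ab y subfield_divide[OF F] by auto
  qed
  moreover have "z \<noteq> 0" using assms subfield_closed(1)[OF F] by auto
  ultimately have "z * (a - b * y) \<noteq> 0" by simp
  moreover have "z * (a - b * y) = a ^ 2 - b ^ 2 * y ^ 2" using ab by (simp add: power2_eq_square algebra_simps)
  ultimately have "a ^ 2 - b ^ 2 * y ^ 2 \<noteq> 0" by simp
  moreover have "a ^ 2 - b ^ 2 * y ^ 2 \<in> F" "- 2 * a \<in> F"
    using ab y subfield_closed(8)[OF F, of 2] by (auto intro!: subfield_closed[OF F])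
  moreover have "z ^ 2 + (- 2 * a) * z + (a ^ 2 - b ^ 2 * y ^ 2) = 0"
    using ab by (simp add: power2_eq_square algebra_simps)
  ultimately show ?thesis using that by blast
qed

lemma generator:
  assumes "z \<in> K" "z \<notin> F" "w \<in> K" shows "\<exists>a\<in>F. \<exists>b\<in>F. w = a + b * z"
proof -
  obtain a b where ab: "a \<in> F" "b \<in> F" "z = a + b * y" using KF assms by blast
  have b: "b \<noteq> 0" using ab assms by auto
  obtain a' b' where ab': "a' \<in> F" "b' \<in> F" "w = a' + b' * y" using KF assms by blast
  have "w = (a' - b' / b * a) + (b' / b) * z" using ab ab' b by (simp add: field_simps)
  moreover have "a' - b' / b * a \<in> F" "b' / b \<in> F" using ab ab' by (auto intro!: subfield_closed[OF F])
  ultimately show ?thesis by blast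
qed

text \<open>Discreteness passes up. If the uniformizer t of F no longer suffices, some z has a value
  unlike that of any element of F; its quadratic equation then gives z an odd multiple of half the
  value of t, and z divided by a power of t is the new uniformizer.\<close>

lemma closed_point_lift:
  assumes W: "valuation_ring K W" "k \<subseteq> W" and x: "W \<inter> F \<in> closed_points k F"
  shows "W \<in> closed_points k K"
proof -
  note V = K W(1)
  note r = valuation_ring_restrict[OF F FK W(1)]
  let ?U = "units_of_ring W"
  obtain t where t: "uniformizer (W \<inter> F) t" "t \<noteq> 0" "t \<in> maximal_ideal (W \<inter> F)" "t \<in> F"
    "\<And>f. f \<in> F \<Longrightarrow> f \<noteq> 0 \<Longrightarrow> \<exists>n u. u \<in> units_of_ring (W \<inter> F) \<and> f = u * t powi n"
    using obtain_uniformizer[OF F x] by blast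
  have tF: "\<exists>n u. u \<in> ?U \<and> f = u * t powi n" if "f \<in> F" "f \<noteq> 0" for f
    using t(5)[OF that] r(3) by blast
  have tm: "t \<in> maximal_ideal W" using t(3) r(2) by blast
  show ?thesis
  proof (cases "\<forall>z\<in>K. z \<noteq> 0 \<longrightarrow> (\<exists>n u. u \<in> ?U \<and> z = u * t powi n)")
    case True
    thus ?thesis using closed_pointI(1)[OF V W(2) tm t(2)] by blast
  next
    case False
    then obtain z where z: "z \<in> K" "z \<noteq> 0" "\<And>n u. u \<in> ?U \<Longrightarrow> z \<noteq> u * t powi n" by blast
    have zF: "z / f \<notin> ?U" if f: "f \<in> F" "f \<noteq> 0" for f
    proof
      assume u: "z / f \<in> ?U"
      obtain n u where nu: "u \<in> ?U" "f = u * t powi n" using tF[OF f] by blast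
      hence "z = (z / f * u) * t powi n" using f by simp
      thus False using z(3)[OF units_mult[OF V u nu(1)]] by blast
    qed
    have zn: "z \<notin> F" using zF[of z] z one_in_units[OF V] by auto
    obtain B C where BC: "B \<in> F" "C \<in> F" "C \<noteq> 0" "z ^ 2 + B * z + C = 0" using quadratic_equation[OF z(1) zn] .
    \<comment> \<open>The values of z, B and C/B are pairwise compared through the previous fact: B
      z cannot balance C, so z^2 must.\<close>
    have z2: "z ^ 2 / C \<in> ?U"
    proof (cases "B = 0")
      case True
      hence "z ^ 2 / C = - 1" using BC by (simp add: field_simps eq_neg_iff_add_eq_0)
      thus ?thesis using units_uminus[OF V one_in_units[OF V]] by simp
    next
      case B0: False
      have zB: "z / B \<in> K" using z BC FK by (auto intro!: subfield_closed[OF K])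
      show ?thesis
      proof (cases "z / B \<in> W")
        case True
        hence "z / B \<in> maximal_ideal W" using zF[OF BC(1) B0] ring_cases[OF V] by blast
        hence u: "- (1 + z / B) \<in> ?U" using units_uminus[OF V units_add[OF V one_in_units[OF V]]] by blast
        have "B * z * (1 + z / B) = z ^ 2 + B * z" using B0 by (simp add: field_simps power2_eq_square)
        also have "\<dots> = - C" using BC(4) by (simp only: eq_neg_iff_add_eq_0)
        finally have e: "B * z * (1 + z / B) = - C" .
        have nz: "- (1 + z / B) \<noteq> 0" using u by (auto simp: units_of_ring_iff)
        have "z / (C / B) * (- w) = - (B * z * w) / C" for w by simp
        hence "z / (C / B) * (- (1 + z / B)) = - (B * z * (1 + z / B)) / C" .
        also have "\<dots> = 1" unfolding e using BC(3) by simp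
        finally have "z / (C / B) = inverse (- (1 + z / B))" by (metis inverse_unique mult.commute)
        hence "z / (C / B) \<in> ?U" using units_inverse[OF V u] by simp
        thus ?thesis using zF[of "C / B"] BC B0 subfield_divide[OF F] by auto
      next
        case False
        hence "inverse (z / B) \<in> maximal_ideal W" using inverse_in_maximal_ideal[OF V zB] by blast
        hence u: "- (1 + B / z) \<in> ?U" using units_uminus[OF V units_add[OF V one_in_units[OF V]]] by simp
        have "z ^ 2 * (1 + B / z) = z ^ 2 + B * z" using z(2) by (simp add: field_simps power2_eq_square)
        also have "\<dots> = - C" using BC(4) by (simp only: eq_neg_iff_add_eq_0)
        finally have "z ^ 2 * (1 + B / z) = - C" .
        moreover have "z ^ 2 / C * (- w) = - (z ^ 2 * w) / C" for w by simp
        ultimately have "z ^ 2 / C * (- (1 + B / z)) = 1" using BC(3) by (metis add.inverse_inverse divide_self_if)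
        hence "z ^ 2 / C = inverse (- (1 + B / z))" by (metis inverse_unique mult.commute)
        thus ?thesis using units_inverse[OF V u] by simp
      qed
    qed
    obtain n u where nu: "u \<in> ?U" "C = u * t powi n" using tF[OF BC(2,3)] by blast
    have z2n: "z ^ 2 / t powi n \<in> ?U"
    proof -
      have "z ^ 2 / t powi n = z ^ 2 / C * u" using nu BC(3) by simp
      thus ?thesis using units_mult[OF V z2 nu(1)] by simp
    qed
    \<comment> \<open>z^2 has the value of t^n. An even n would make z / t^j a unit, so n = 2j + 1
      and z' = z / t^j has half the value of t.\<close>
    define j where "j = n div 2"
    define z' where "z' = z / t powi j"
    have tK: "t powi j \<in> F" "t powi j \<in> K" using t(4) FK by (auto intro!: subfield_closed[OF F] subfield_closed[OF K])
    have z'K: "z' \<in> K" using z tK by (auto simp: z'_def intro!: subfield_closed[OF K])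
    have z'0: "z' \<noteq> 0" using z t by (auto simp: z'_def)
    have sq: "z' ^ 2 = z ^ 2 / t powi (2 * j)" by (simp add: z'_def power_divide power_int_mult mult.commute flip: power_int_power)
    have odd: "n = 2 * j + 1"
    proof (rule ccontr)
      assume "n \<noteq> 2 * j + 1"
      hence "n = 2 * j" unfolding j_def by presburger
      hence "z' ^ 2 \<in> ?U" using z2n sq by simp
      hence "z' \<in> ?U" using power_unit_imp_unit[OF V z'K] by auto
      thus False using zF[OF tK(1)] t(2) by (simp add: z'_def)
    qed
    have z't: "z' ^ 2 / t \<in> ?U" using z2n sq odd t(2) by (simp add: power_int_add)
    have z'F: "z' \<notin> F"
    proof
      assume "z' \<in> F"
      hence "z' * t powi j \<in> F" using tK subfield_closed(4)[OF F] by blast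
      thus False using zn t(2) by (simp add: z'_def)
    qed
    have z'm: "z' \<in> maximal_ideal W"
    proof -
      have "z' ^ 2 = t * (z' ^ 2 / t)" using t(2) by simp
      hence m2: "z' ^ 2 \<in> maximal_ideal W" using maximal_ideal_mult[OF V tm] z't units_subset[OF V] by (metis subsetD)
      have "z' \<in> W"
      proof (rule ccontr)
        assume "z' \<notin> W"
        hence "inverse z' ^ 2 \<in> maximal_ideal W" using maximal_ideal_power[OF V inverse_in_maximal_ideal[OF V z'K]] by simp
        hence "z' ^ 2 * inverse z' ^ 2 \<in> maximal_ideal W"
          using maximal_ideal_mult[OF V m2] maximal_ideal_subset[OF V] by blast
        thus False using one_notin_maximal_ideal[OF V] z'0 by (simp add: power_inverse)
      qed
      thus ?thesis using m2 ring_cases[OF V, of z'] units_power[OF V, of z' 2] units_notin[OF V] by blast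
    qed
    have even: "\<exists>i u. u \<in> ?U \<and> f = u * z' powi (2 * i)" if f: "f \<in> F" "f \<noteq> 0" for f
    proof -
      obtain i u where iu: "u \<in> ?U" "f = u * t powi i" using tF[OF f] by blast
      have "t = z' ^ 2 * inverse (z' ^ 2 / t)" using t(2) z'0 by simp
      hence "t powi i = z' powi (2 * i) * inverse (z' ^ 2 / t) powi i"
        by (metis power_int_mult_distrib power_int_mult power_int_numeral)
      hence "f = (u * inverse (z' ^ 2 / t) powi i) * z' powi (2 * i)" using iu by simp
      moreover have "u * inverse (z' ^ 2 / t) powi i \<in> ?U"
        using iu z't by (intro units_mult[OF V] units_powi[OF V] units_inverse[OF V])
      ultimately show ?thesis by blast
    qed
    have "\<exists>n u. u \<in> ?U \<and> w = u * z' powi n" if w: "w \<in> K" "w \<noteq> 0" for w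
    proof -
      obtain a b where ab: "a \<in> F" "b \<in> F" "w = a + b * z'" using generator[OF z'K z'F w(1)] by blast
      consider "b = 0" | "a = 0" "b \<noteq> 0" | "a \<noteq> 0" "b \<noteq> 0" by blast
      thus ?thesis
      proof cases
        case 1 thus ?thesis using even[of a] ab w by auto
      next
        case 2
        then obtain i u where "u \<in> ?U" "b = u * z' powi (2 * i)" using even[of b] ab by blast
        moreover from this have "w = u * z' powi (2 * i + 1)" using ab 2 z'0 by (simp add: power_int_add)
        ultimately show ?thesis by blast
      next
        case 3
        obtain i u where iu: "u \<in> ?U" "a = u * z' powi (2 * i)" using even[OF ab(1)] 3 by blast
        obtain l v where lv: "v \<in> ?U" "b = v * z' powi (2 * l)" using even[OF ab(2)] 3 by blast
        have lv': "b * z' = v * z' powi (2 * l + 1)" using lv z'0 by (simp add: power_int_add)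
        have step: "\<exists>n u. u \<in> ?U \<and> c * z' powi p + d * z' powi q = u * z' powi n"
          if cd: "c \<in> ?U" "d \<in> ?U" "p < q" for c d p q
        proof -
          have "c + d * z' powi (q - p) \<in> ?U"
          proof (rule units_add[OF V cd(1)])
            have "z' powi (q - p) = z' ^ nat (q - p)" using cd(3) by (simp add: power_int_def)
            thus "d * z' powi (q - p) \<in> maximal_ideal W"
              using maximal_ideal_mult[OF V maximal_ideal_power[OF V z'm, of "nat (q - p)"], of d] cd units_subset[OF V]
              by (auto simp: mult.commute)
          qed
          moreover have "c * z' powi p + d * z' powi q = (c + d * z' powi (q - p)) * z' powi p"
            using z'0 by (simp add: power_int_diff field_simps)
          ultimately show ?thesis by blast
        qed
        \<comment> \<open>In a + b z' the first term has even and the second odd value, so one of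
          them dominates strictly.\<close>
        have "2 * i < 2 * l + 1 \<or> 2 * l + 1 < 2 * i" by presburger
        thus ?thesis using step[OF iu(1) lv(1)] step[OF lv(1) iu(1)] iu(2) lv' ab(3)
          by (metis add.commute)
      qed
    qed
    thus ?thesis using closed_pointI(1)[OF V W(2) z'm z'0] by blast
  qed
qed

text \<open>Discreteness passes down. If all nonzero elements of F were units, the equation t^2 + B
  t + C = 0 of a uniformizer t of K would put the unit C into the maximal ideal. So F has nonzero
  values, and the least positive one, e, is the ramification index.\<close>

lemma closed_point_restrict:
  assumes x: "W \<in> closed_points k K" and kF: "k \<subseteq> F"
  shows "W \<inter> F \<in> closed_points k F"
proof -
  note W = closed_point_valuation_ring[OF K x]
  note V = K W
  note r = valuation_ring_restrict[OF F FK W]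
  define P where "P n \<longleftrightarrow> n > 0 \<and> (\<exists>f\<in>F. f \<noteq> 0 \<and> valuation W f = int n)" for n
  have "\<exists>f\<in>F. f \<noteq> 0 \<and> valuation W f \<noteq> 0"
  proof (rule ccontr)
    assume H: "\<not> ?thesis"
    obtain t where t: "t \<noteq> 0" "t \<in> maximal_ideal W" "t \<in> K" using obtain_uniformizer[OF K x] by blast
    have U: "f \<in> W" "f \<notin> maximal_ideal W" if "f \<in> F" "f \<noteq> 0" for f
    proof -
      have "f \<in> K" using that FK by blast
      thus "f \<in> W" "f \<notin> maximal_ideal W" using H that valuation_nonneg_iff[OF K x, of f] by auto
    qed
    have "t \<notin> F" using U t by blast
    then obtain B C where BC: "B \<in> F" "C \<in> F" "C \<noteq> 0" "t ^ 2 + B * t + C = 0" using quadratic_equation[OF t(3)] by blast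
    have "t + B \<in> W" using t U(1)[OF BC(1)] maximal_ideal_subset[OF V] valuation_ring_subring[OF V]
      by (cases "B = 0") (auto intro: subring_add)
    hence "- (t * (t + B)) \<in> maximal_ideal W" using maximal_ideal_uminus[OF V maximal_ideal_mult[OF V t(2)]] by blast
    moreover have "t ^ 2 + B * t = - C" using BC(4) by (simp only: eq_neg_iff_add_eq_0)
    hence "C = - (t ^ 2 + B * t)" by simp
    hence "- (t * (t + B)) = C" by (simp add: power2_eq_square algebra_simps)
    ultimately show False using U(2)[OF BC(2,3)] by simp
  qed
  then obtain f where f: "f \<in> F" "f \<noteq> 0" "valuation W f \<noteq> 0" by blast
  have "P (nat \<bar>valuation W f\<bar>)"
  proof (cases "valuation W f > 0")
    case True thus ?thesis using f by (auto simp: P_def)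
  next
    case False
    thus ?thesis using f valuation_inverse[OF K x, of f] FK subfield_inverse[OF F f(1)]
      unfolding P_def by (intro conjI bexI[of _ "inverse f"]) auto
  qed
  define e where "e = (LEAST n. P n)"
  have e: "P e" "\<And>n. P n \<Longrightarrow> e \<le> n" unfolding e_def using LeastI[of P] Least_le[of P] \<open>P (nat _)\<close> by blast+
  obtain t where t: "t \<in> F" "t \<noteq> 0" "valuation W t = int e" "e > 0" using e(1) by (auto simp: P_def)
  have tK: "t \<in> K" using t FK by blast
  obtain s where s: "uniformizer W s" "s \<noteq> 0" "s \<in> K" using obtain_uniformizer[OF K x] by blast
  have tv: "valuation W (t powi n) = n * int e" for n
    using valuation_power[OF K x tK t(2), of "nat \<bar>n\<bar>"] valuation_inverse[OF K x tK t(2)] t(3)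
      valuation_power[OF K x, of "inverse t" "nat \<bar>n\<bar>"] subfield_inverse[OF K tK] t(2)
    by (auto simp: power_int_def)
  show ?thesis
  proof (rule closed_pointI(1)[OF F r(1)])
    show "k \<subseteq> W \<inter> F" using cp_scalars[OF K x] kF by blast
    show "t \<in> maximal_ideal (W \<inter> F)" using t valuation_nonneg_iff(2)[OF K x tK t(2)] r(2) by auto
    show "t \<noteq> 0" by fact
    fix f assume f: "f \<in> F" "f \<noteq> 0"
    \<comment> \<open>Division by e leaves a value in [0, e), which the minimality of e forces to be
      0.\<close>
    define q where "q = valuation W f div int e"
    define u where "u = f / t powi q"
    have u: "u \<in> F" "u \<noteq> 0" "u \<in> K" using f t FK by (auto simp: u_def intro!: subfield_closed[OF F])
    have "f \<in> K" "t powi q \<in> K" "t powi q \<noteq> 0" using f FK subfield_powi[OF K tK] t(2) by auto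
    hence "valuation W u = valuation W f - q * int e"
      unfolding u_def using valuation_divide[OF K x _ f(2)] tv[of q] by simp
    hence vu: "valuation W u = valuation W f mod int e" by (simp add: q_def minus_div_mult_eq_mod)
    have "valuation W u = 0"
    proof (rule ccontr)
      assume "valuation W u \<noteq> 0"
      moreover have "valuation W u \<ge> 0" "valuation W u < int e" using vu t(4) by auto
      ultimately have "P (nat (valuation W u))" using u unfolding P_def by auto
      thus False using e(2) \<open>valuation W u < int e\<close> \<open>valuation W u \<ge> 0\<close> by fastforce
    qed
    hence "u \<in> units_of_ring (W \<inter> F)"
      using u valuation_nonneg_iff[OF K x u(3,2)] r(2) by (auto simp: units_of_ring_def)
    moreover have "f = u * t powi q" using t by (simp add: u_def)
    ultimately show "\<exists>n u. u \<in> units_of_ring (W \<inter> F) \<and> f = u * t powi n" by blast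
  qed
qed

end

section \<open>The rational function field\<close>

lemma poly_over_in_subring:
  "subring R \<Omega> \<Longrightarrow> k \<subseteq> R \<Longrightarrow> p \<in> poly_over k \<Longrightarrow> a \<in> R \<Longrightarrow> poly p a \<in> R"
  by (rule poly_in_subring[OF _ subsetD[OF poly_over_mono]])

context fixes k :: "'a::field_char_0 set" and t assumes k: "subfield k \<Omega>" and t: "transcendental_over k t"
begin
lemma rational_functions_adjoin: "rational_functions k t = adjoin k {t}"
  using adjoin_transcendental[OF k] t transcendental_iff[OF k]
  by (auto simp: rational_functions_def transcendental_over_def)
lemma subfield_rational_functions: "subfield (rational_functions k t) \<Omega>"
  unfolding rational_functions_adjoin adjoin_def
  by (rule field.generate_field_is_subfield[OF field_ambient]) auto
lemma scalars_rational_functions: "k \<subseteq> rational_functions k t" and var_rational_functions: "t \<in> rational_functions k t"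
  unfolding rational_functions_adjoin adjoin_def by (auto intro: generate_field.incl)
lemma poly_rational_functions: "p \<in> poly_over k \<Longrightarrow> poly p t \<in> rational_functions k t"
  by (rule poly_over_in_subring[OF subfield_subring[OF subfield_rational_functions]
        scalars_rational_functions _ var_rational_functions])
lemma transcendental_nonzero: "t \<noteq> 0"
proof
  assume "t = 0"
  moreover have "[:0, 1:] \<in> poly_over k" using subfield_subring[OF k] by (auto simp: poly_over_pCons poly_over_closed subring_closed)
  ultimately show False using t by (auto simp: transcendental_over_def)
qed
lemma reflect_poly_over: "p \<in> poly_over k \<Longrightarrow> reflect_poly p \<in> poly_over k"
  using subfield_closed(1)[OF k] by (auto simp: poly_over_def coeff_reflect_poly)
lemma transcendental_inverse: "transcendental_over k (inverse t)"
  unfolding transcendental_over_def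
proof (intro ballI impI)
  fix p assume p: "p \<in> poly_over k" "poly p (inverse t) = 0"
  have "poly (reflect_poly p) t = 0" using poly_reflect_poly_nz[OF transcendental_nonzero, of p] p by simp
  thus "p = 0" using t reflect_poly_over[OF p(1)] by (auto simp: transcendental_over_def)
qed
end

lemma rational_functions_min:
  fixes k :: "'a::field_char_0 set"
  assumes "subfield k \<Omega>" "transcendental_over k t" "subfield F \<Omega>" "k \<subseteq> F" "t \<in> F"
  shows "rational_functions k t \<subseteq> F"
  unfolding rational_functions_adjoin[OF assms(1,2)] adjoin_def
  by (rule field.generate_field_min_subfield1[OF field_ambient]) (use assms in auto)

lemma rational_functions_inverse:
  fixes k :: "'a::field_char_0 set"
  assumes k: "subfield k \<Omega>" and t: "transcendental_over k t"
  shows "rational_functions k (inverse t) = rational_functions k t"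
proof -
  note i = transcendental_inverse[OF k t]
  have "rational_functions k (inverse t) \<subseteq> rational_functions k t"
    by (intro rational_functions_min k i subfield_rational_functions t scalars_rational_functions
        subfield_inverse[OF subfield_rational_functions[OF k t]] var_rational_functions)
  moreover have "inverse (inverse t) \<in> rational_functions k (inverse t)"
    by (intro subfield_inverse[OF subfield_rational_functions[OF k i]] var_rational_functions k i)
  hence "rational_functions k t \<subseteq> rational_functions k (inverse t)"
    by (intro rational_functions_min k i subfield_rational_functions t scalars_rational_functions) simp
  ultimately show ?thesis by blast
qed

section \<open>A hyperelliptic curve\<close>

text \<open>\<open>d\<close> is the constant c^(-2) of the twist, kept arbitrary because it depends
  on the section.\<close>

locale hyperelliptic =
  fixes k :: "'a::field_char_0 set" and t y d :: 'a and g :: nat and P K f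
  assumes k: "subfield k \<Omega>" and t: "transcendental_over k t" and d: "d \<in> k" "d \<noteq> 0"
    and P_def: "P = rational_functions k t" and f_def: "f = (\<Prod>i\<in>{1..2*g+1}. [:- of_nat i, 1:])"
    and y2: "y ^ 2 = d * poly f t" and K: "subfield K \<Omega>" and K_eq: "K = {a + b * y | a b. a \<in> P \<and> b \<in> P}"
begin

lemmas kr = subfield_subring[OF k]
lemmas P = subfield_rational_functions[OF k t, folded P_def]
lemmas kP = scalars_rational_functions[OF k t, folded P_def]
lemmas tP = var_rational_functions[OF k t, folded P_def]
lemmas polyP = poly_rational_functions[OF k t, folded P_def]

lemma PK: "P \<subseteq> K"
proof
  fix a assume "a \<in> P"
  hence "a + 0 * y \<in> K" using subfield_closed(1)[OF P] unfolding K_eq by blast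
  thus "a \<in> K" by simp
qed
lemma yK: "y \<in> K"
proof -
  have "0 + 1 * y \<in> K" using subfield_closed(1,2)[OF P] unfolding K_eq by blast
  thus ?thesis by simp
qed
lemma kK: "k \<subseteq> K" and tK: "t \<in> K" using kP tP PK by auto

lemma linear_poly_over: "[:- of_nat i, 1:] \<in> poly_over k"
  using kr by (auto simp: poly_over_pCons poly_over_closed subring_closed)
lemma f_over: "f \<in> poly_over k"
  unfolding f_def by (intro poly_over_prod kr linear_poly_over)
lemma degree_f: "degree f = 2 * g + 1"
  unfolding f_def by (subst degree_prod_eq_sum_degree) auto
lemma poly_nz: "p \<in> poly_over k \<Longrightarrow> p \<noteq> 0 \<Longrightarrow> poly p t \<noteq> 0"
  using t by (auto simp: transcendental_over_def)
lemma f0: "f \<noteq> 0" using degree_f by auto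
lemma y0: "y \<noteq> 0"
  using y2 d poly_nz[OF f_over f0] by auto

text \<open>Parity of degrees: y = p/q would give 2 deg p = 2g + 1 + 2 deg q.\<close>

lemma yP: "y \<notin> P"
proof
  assume "y \<in> P"
  then obtain p q where pq: "y = poly p t / poly q t" "p \<in> poly_over k" "q \<in> poly_over k" "q \<noteq> 0"
    by (auto simp: P_def rational_functions_def)
  have p0: "p \<noteq> 0" using pq y0 by auto
  have "poly (p ^ 2) t = poly (smult d (f * q ^ 2)) t"
    using y2 pq poly_nz[OF pq(3,4)] by (simp add: power_divide field_simps)
  hence "poly (p ^ 2 - smult d (f * q ^ 2)) t = 0" by simp
  moreover have "p ^ 2 - smult d (f * q ^ 2) \<in> poly_over k"
    by (intro poly_over_diff poly_over_smult poly_over_mult poly_over_power kr d f_over pq)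
  ultimately have "p ^ 2 = smult d (f * q ^ 2)" using t by (auto simp: transcendental_over_def)
  hence "degree (p ^ 2) = degree (smult d (f * q ^ 2))" by simp
  hence "2 * degree p = 2 * g + 1 + 2 * degree q"
    using d f0 pq(4) p0 by (simp add: degree_mult_eq degree_power_eq degree_f)
  thus False by presburger
qed

sublocale quadratic k P K y
proof (rule quadratic.intro)
  show "y ^ 2 \<in> P" using y2 d kP polyP[OF f_over] subfield_closed(4)[OF P] by auto
  show "\<exists>a\<in>P. \<exists>b\<in>P. z = a + b * y" if "z \<in> K" for z using that K_eq by blast
qed (fact k P K PK yK yP)+

lemma y2P: "y ^ 2 \<in> P" using y by blast

subsection \<open>Points and polynomials\<close>

lemma poly_in_point: "x \<in> closed_points k K \<Longrightarrow> t \<in> x \<Longrightarrow> p \<in> poly_over k \<Longrightarrow> poly p t \<in> x"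
  by (rule poly_over_in_subring[OF cp_ring[OF K] cp_scalars[OF K]])

text \<open>y is integral over k[t]: a pole of y would be a pole of y^2 = d f(t).\<close>

lemma y_in_point:
  assumes x: "x \<in> closed_points k K" "t \<in> x" shows "y \<in> x"
proof (rule ccontr)
  note V = K closed_point_valuation_ring[OF K x(1)]
  assume "y \<notin> x"
  hence "inverse y ^ 2 \<in> maximal_ideal x" using maximal_ideal_power[OF V inverse_in_maximal_ideal[OF V yK]] by simp
  moreover have "y ^ 2 \<in> x"
    unfolding y2 using cp_scalars[OF K x(1)] d poly_in_point[OF x f_over] subring_mult[OF cp_ring[OF K x(1)]] by blast
  ultimately have "inverse y ^ 2 * y ^ 2 \<in> maximal_ideal x" by (rule maximal_ideal_mult[OF V])
  thus False using one_notin_maximal_ideal[OF V] y0 by (simp add: power_inverse)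
qed

text \<open>The restriction of x to P is still discrete, hence nontrivial, and the numerator of a
  uniformizer there vanishes at x.\<close>

lemma exists_vanishing_poly:
  assumes x: "x \<in> closed_points k K" "t \<in> x"
  obtains q where "q \<in> poly_over k" "q \<noteq> 0" "poly q t \<in> maximal_ideal x"
proof -
  note V = K closed_point_valuation_ring[OF K x(1)]
  obtain s where s: "s \<noteq> 0" "s \<in> maximal_ideal (x \<inter> P)" "s \<in> P"
    using obtain_uniformizer[OF P closed_point_restrict[OF x(1) kP]] by blast
  obtain p q where pq: "s = poly p t / poly q t" "p \<in> poly_over k" "q \<in> poly_over k" "q \<noteq> 0"
    using s by (auto simp: P_def rational_functions_def)
  have "s \<in> maximal_ideal x" using s valuation_ring_restrict(2)[OF P PK V(2)] by blast
  hence "s * poly q t \<in> maximal_ideal x" using maximal_ideal_mult[OF V] poly_in_point[OF x pq(3)] by blast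
  hence "poly p t \<in> maximal_ideal x" using pq poly_nz by simp
  moreover have "p \<noteq> 0" using s pq by auto
  ultimately show ?thesis using that pq by blast
qed

lemma degree_vanishing_poly:
  assumes V: "subfield F \<Omega>" "valuation_ring F W" and W: "k \<subseteq> W" and q: "q \<in> poly_over k" "q \<noteq> 0" "poly q t \<in> maximal_ideal W"
  shows "degree q > 0"
proof (rule ccontr)
  assume "\<not> degree q > 0"
  then obtain c where c: "q = [:c:]" by (metis degree_eq_zeroE neq0_conv)
  hence "c \<in> k" "c \<noteq> 0" using q poly_over_pCons[OF kr] by auto
  thus False using W q(3) c subfield_inverse[OF k] by (auto simp: maximal_ideal_iff)
qed

lemma finite_place_lift:
  assumes W: "valuation_ring UNIV W" "k \<subseteq> W" "t \<in> W" and p: "p \<in> poly_over k" "p \<noteq> 0" "poly p t \<in> maximal_ideal W"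
  shows "W \<inter> K \<in> closed_points k K"
proof -
  have WK: "valuation_ring K (W \<inter> K)" by (rule valuation_ring_restrict(1)[OF K _ W(1)]) simp
  have WP: "valuation_ring P (W \<inter> P)" and mP: "maximal_ideal (W \<inter> P) = maximal_ideal W \<inter> P"
    by (rule valuation_ring_restrict[OF P _ W(1)], simp)+
  obtain m where m: "m \<in> poly_over k" "m \<noteq> 0" "poly m t \<in> maximal_ideal (W \<inter> P)"
    "\<And>q. q \<in> poly_over k \<Longrightarrow> q \<noteq> 0 \<Longrightarrow> poly q t \<in> maximal_ideal (W \<inter> P) \<Longrightarrow> degree m \<le> degree q"
    using exists_minimal_polynomial[of p k t "maximal_ideal (W \<inter> P)"] p polyP[OF p(1)] mP by auto
  have "W \<inter> P \<in> closed_points k P"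
    unfolding P_def
    by (rule rational_place(1)[OF k t subfield_rational_functions[OF k t]])
      (use WP W kP tP m in \<open>auto simp flip: P_def\<close>)
  moreover have "W \<inter> K \<inter> P = W \<inter> P" using PK by blast
  ultimately show ?thesis using closed_point_lift[OF WK] W(2) kK by auto
qed

section \<open>The points at infinity, as zeros of the parameter 1/t\<close>

lemma exists_infinite_point: "\<exists>x\<in>closed_points k K. t \<notin> x"
proof -
  note i = transcendental_inverse[OF k t]
  have X: "[:0, 1:] \<in> poly_over k" using kr by (auto simp: poly_over_pCons poly_over_closed subring_closed)
  obtain W where W: "valuation_ring UNIV W" "k \<subseteq> W" "inverse t \<in> W" "poly [:0, 1:] (inverse t) \<in> maximal_ideal W"
    using exists_place[OF k i X] by auto
  have it: "inverse t \<in> maximal_ideal W" using W(4) by simp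
  have iP: "inverse t \<in> P" by (rule subfield_inverse[OF P tP])
  have WK: "valuation_ring K (W \<inter> K)" by (rule valuation_ring_restrict(1)[OF K _ W(1)]) simp
  have WP: "valuation_ring P (W \<inter> P)" and mP: "maximal_ideal (W \<inter> P) = maximal_ideal W \<inter> P"
    by (rule valuation_ring_restrict[OF P _ W(1)], simp)+
  obtain m where m: "m \<in> poly_over k" "m \<noteq> 0" "poly m (inverse t) \<in> maximal_ideal (W \<inter> P)"
    "\<And>q. q \<in> poly_over k \<Longrightarrow> q \<noteq> 0 \<Longrightarrow> poly q (inverse t) \<in> maximal_ideal (W \<inter> P) \<Longrightarrow> degree m \<le> degree q"
    using exists_minimal_polynomial[of "[:0, 1:]" k "inverse t" "maximal_ideal (W \<inter> P)"] X it iP mP by auto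
  have PI: "P = rational_functions k (inverse t)" using rational_functions_inverse[OF k t] by (simp add: P_def)
  have "W \<inter> P \<in> closed_points k P"
    unfolding PI
    by (rule rational_place(1)[OF k i subfield_rational_functions[OF k i]])
      (use WP W kP iP m in \<open>auto simp flip: PI\<close>)
  moreover have "W \<inter> K \<inter> P = W \<inter> P" using PK by blast
  ultimately have "W \<inter> K \<in> closed_points k K" using closed_point_lift[OF WK] W(2) kK by auto
  moreover have "t \<notin> W" using it by (auto simp: maximal_ideal_iff transcendental_nonzero[OF k t])
  ultimately show ?thesis by blast
qed

text \<open>p(t) is t^(deg p) times the reversed polynomial at 1/t, and the latter is a unit since
  its constant term is the leading coefficient of p.\<close>

lemma valuation_poly_infinite:
  assumes x: "x \<in> closed_points k K" "t \<notin> x" and p: "p \<in> poly_over k" "p \<noteq> 0"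
  shows "valuation x (poly p t) = int (degree p) * valuation x t"
proof -
  note V = K closed_point_valuation_ring[OF K x(1)]
  note t0 = transcendental_nonzero[OF k t]
  have it: "inverse t \<in> maximal_ideal x" by (rule inverse_in_maximal_ideal[OF V tK x(2)])
  define r where "r = reflect_poly p"
  obtain c r' where r: "r = pCons c r'" by (cases r)
  have c: "c \<noteq> 0" "c \<in> k" "r' \<in> poly_over k"
  proof -
    have "coeff r 0 = lead_coeff p" by (simp add: r_def)
    thus "c \<noteq> 0" using r p by simp
    show "c \<in> k" "r' \<in> poly_over k" using reflect_poly_over[OF k t p(1)] poly_over_pCons[OF kr] r r_def by auto
  qed
  have u: "poly r (inverse t) \<in> units_of_ring x"
  proof -
    have "c \<in> units_of_ring x" using c cp_scalars[OF K x(1)] subfield_inverse[OF k] by (auto simp: units_of_ring_iff)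
    moreover have "poly r' (inverse t) \<in> x"
      by (rule poly_over_in_subring[OF cp_ring[OF K x(1)] cp_scalars[OF K x(1)] c(3)]) (use it maximal_ideal_subset[OF V] in blast)
    ultimately show ?thesis unfolding r poly_pCons using units_add[OF V] maximal_ideal_mult[OF V it] by blast
  qed
  hence uK: "poly r (inverse t) \<in> K" "poly r (inverse t) \<noteq> 0" "valuation x (poly r (inverse t)) = 0"
  proof -
    have a: "poly r (inverse t) \<in> x" "poly r (inverse t) \<noteq> 0" "poly r (inverse t) \<notin> maximal_ideal x"
      using u by (auto simp: units_of_ring_iff maximal_ideal_iff)
    thus b: "poly r (inverse t) \<in> K" "poly r (inverse t) \<noteq> 0" using cp_subset[OF K x(1)] by auto
    show "valuation x (poly r (inverse t)) = 0" using valuation_nonneg_iff[OF K x(1) b] a by auto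
  qed
  have "poly p t = t ^ degree p * poly r (inverse t)"
  proof -
    have "poly r (inverse t) = inverse t ^ degree p * poly p t"
      using poly_reflect_poly_nz[of "inverse t" p] t0 by (simp add: r_def)
    thus ?thesis using t0 by (simp add: power_inverse)
  qed
  thus ?thesis using valuation_mult[OF K x(1) _ _ uK(1,2), of "t ^ degree p"] uK(3)
    valuation_power[OF K x(1) tK t0] t0 subfield_closed(7)[OF K tK] by simp
qed

lemma valuation_t_infinite: "x \<in> closed_points k K \<Longrightarrow> t \<notin> x \<Longrightarrow> valuation x t < 0"
  using valuation_nonneg_iff(1)[OF K _ tK transcendental_nonzero[OF k t]] by fastforce

text \<open>The source of all parity arguments: as 2g + 1 is odd, v(t) must be even, so infinity
  ramifies in K over P.\<close>

lemma valuation_y_infinite: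
  assumes x: "x \<in> closed_points k K" "t \<notin> x"
  shows "2 * valuation x y = int (2 * g + 1) * valuation x t"
proof -
  have "[:d:] \<in> poly_over k" "[:d:] \<noteq> 0" using d kr by (auto simp: poly_over_pCons poly_over_closed)
  hence "valuation x d = 0" using valuation_poly_infinite[OF x, of "[:d:]"] by simp
  hence "valuation x (d * poly f t) = int (2 * g + 1) * valuation x t"
    using valuation_mult[OF K x(1), of d "poly f t"] valuation_poly_infinite[OF x f_over f0] degree_f d kK PK
      polyP[OF f_over] poly_nz[OF f_over f0] by auto
  thus ?thesis using valuation_power[OF K x(1) yK y0, of 2] y2 by simp
qed

section \<open>The involution a + b y -> a - b y of K over P and its action on points\<close>

definition conj_ring :: "'a set \<Rightarrow> 'a set"
  where "conj_ring x = {a + b * y | a b. a \<in> P \<and> b \<in> P \<and> a - b * y \<in> x}"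

lemma coordinates_unique:
  assumes "a \<in> P" "b \<in> P" "a' \<in> P" "b' \<in> P" "a + b * y = a' + b' * y"
  shows "a = a'" "b = b'"
proof -
  show "b = b'"
  proof (rule ccontr)
    assume "b \<noteq> b'"
    hence "y = (a' - a) / (b - b')" using assms by (simp add: field_simps)
    thus False using yP assms by (auto intro!: subfield_closed[OF P])
  qed
  thus "a = a'" using assms by simp
qed

text \<open>The ring laws are checked in coordinates, and inverses through the norm N. The conjugate
  ring meets P in the same ring as x, so it inherits discreteness by restriction and
  lifting.\<close>

lemma conj_ring_closed_point:
  assumes x: "x \<in> closed_points k K" shows "conj_ring x \<in> closed_points k K"
proof -
  note R = cp_ring[OF K x]
  have mem: "a + b * y \<in> conj_ring x \<longleftrightarrow> a - b * y \<in> x" if "a \<in> P" "b \<in> P" for a b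
    using coordinates_unique[OF that] that by (auto simp: conj_ring_def)
  have intP: "conj_ring x \<inter> P = x \<inter> P"
  proof -
    have "a \<in> conj_ring x \<longleftrightarrow> a \<in> x" if "a \<in> P" for a
      using mem[OF that subfield_closed(1)[OF P]] by simp
    thus ?thesis by blast
  qed
  have sub: "subring (conj_ring x) \<Omega>"
  proof (rule ambient_subringI)
    show "1 \<in> conj_ring x" using intP subring_1[OF R] subfield_closed(2)[OF P] by blast
    fix u assume "u \<in> conj_ring x"
    then obtain a b where u: "u = a + b * y" "a \<in> P" "b \<in> P" "a - b * y \<in> x" by (auto simp: conj_ring_def)
    have "- u = - a + (- b) * y" "- a - (- b) * y = - (a - b * y)" using u by auto
    thus "- u \<in> conj_ring x" using mem[of "- a" "- b"] u subring_uminus[OF R u(4)] subfield_closed(5)[OF P] by metis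
    fix v assume "v \<in> conj_ring x"
    then obtain a' b' where v: "v = a' + b' * y" "a' \<in> P" "b' \<in> P" "a' - b' * y \<in> x" by (auto simp: conj_ring_def)
    have "u + v = (a + a') + (b + b') * y" "(a + a') - (b + b') * y = (a - b * y) + (a' - b' * y)"
      using u v by (auto simp: algebra_simps)
    thus "u + v \<in> conj_ring x"
      using mem[of "a + a'" "b + b'"] u v subring_add[OF R u(4) v(4)] subfield_closed(3)[OF P] by metis
    have e: "u * v = (a * a' + b * b' * y ^ 2) + (a * b' + a' * b) * y"
      "(a * a' + b * b' * y ^ 2) - (a * b' + a' * b) * y = (a - b * y) * (a' - b' * y)"
      using u v by (auto simp: algebra_simps power2_eq_square)
    have "a * a' + b * b' * y ^ 2 \<in> P" "a * b' + a' * b \<in> P"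
      using u v y2P by (auto intro!: subfield_closed(3,4)[OF P])
    thus "u * v \<in> conj_ring x" using mem e subring_mult[OF R u(4) v(4)] by metis
  qed
  have "valuation_ring K (conj_ring x)" unfolding valuation_ring_def
  proof (intro conjI ballI sub)
    show "conj_ring x \<subseteq> K" by (auto simp: conj_ring_def K_eq)
    fix z assume "z \<in> K"
    then obtain a b where z: "z = a + b * y" "a \<in> P" "b \<in> P" by (auto simp: K_eq)
    have wK: "a - b * y \<in> K" using z PK yK by (auto intro!: subfield_closed[OF K])
    consider "a - b * y \<in> x" | "inverse (a - b * y) \<in> x" "a - b * y \<noteq> 0"
      using valuation_ring_cases[OF K closed_point_valuation_ring[OF K x] wK] subring_0[OF R] by fastforce
    thus "z \<in> conj_ring x \<or> inverse z \<in> conj_ring x"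
    proof cases
      case 1 thus ?thesis using mem z by simp
    next
      case 2
      have z0: "z \<noteq> 0"
      proof
        assume "z = 0"
        hence "a + b * y = 0 + 0 * y" using z by simp
        hence "a = 0" "b = 0" using coordinates_unique[of a b 0 0] z subfield_closed(1)[OF P] by auto
        thus False using 2 by simp
      qed
      define N where "N = a ^ 2 - b ^ 2 * y ^ 2"
      have N: "N = z * (a - b * y)" by (simp add: N_def z power2_eq_square algebra_simps)
      have "N \<in> P" using z y2P unfolding N_def by (auto intro!: subfield_closed[OF P])
      moreover have N0: "N \<noteq> 0" using N z0 2 by simp
      have "inverse z = a / N + (- b / N) * y"
      proof -
        have "w / (z * w) = inverse z" if "w \<noteq> 0" for w using that by (simp add: divide_inverse)
        moreover have "a / N + (- b / N) * y = (a - b * y) / N" by (simp add: diff_divide_distrib)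
        ultimately show ?thesis using N 2(2) by metis
      qed
      moreover have "a / N - (- b / N) * y = inverse (a - b * y)"
      proof -
        have "z / (z * w) = inverse w" for w using z0 by (simp add: divide_inverse)
        moreover have "a / N - (- b / N) * y = z / N" by (simp add: add_divide_distrib z)
        ultimately show ?thesis using N by metis
      qed
      moreover have "a / N \<in> P" "- b / N \<in> P" using z \<open>N \<in> P\<close> by (auto intro!: subfield_closed(5,10)[OF P])
      ultimately show ?thesis using mem 2 by metis
    qed
  qed
  moreover have "k \<subseteq> conj_ring x" using intP kP cp_scalars[OF K x] by blast
  ultimately show ?thesis using closed_point_lift closed_point_restrict[OF x kP] intP by simp
qed

text \<open>Conjugation permutes the finite points, so regularity at all of them passes to the
  conjugate function.\<close>

lemma conj_in_finite_points:
  assumes ab: "a \<in> P" "b \<in> P" and reg: "\<And>x. x \<in> closed_points k K \<Longrightarrow> t \<in> x \<Longrightarrow> a + b * y \<in> x"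
    and x: "x \<in> closed_points k K" "t \<in> x"
  shows "a - b * y \<in> x"
proof -
  have "t + 0 * y \<in> conj_ring x" using x tP subfield_closed(1)[OF P] unfolding conj_ring_def by force
  hence "a + b * y \<in> conj_ring x" using reg[OF conj_ring_closed_point[OF x(1)]] by simp
  thus ?thesis using coordinates_unique[OF ab] by (auto simp: conj_ring_def)
qed

text \<open>Take a denominator q of least degree. If it were not constant, it would vanish at some
  finite place; regularity makes the numerator vanish there too, and the minimal polynomial of that
  place could be cancelled from both.\<close>

lemma regular_imp_poly:
  assumes a: "a \<in> P" and reg: "\<And>x. x \<in> closed_points k K \<Longrightarrow> t \<in> x \<Longrightarrow> a \<in> x"
  obtains p where "p \<in> poly_over k" "a = poly p t"
proof -
  define Q where "Q q \<longleftrightarrow> q \<in> poly_over k \<and> q \<noteq> 0 \<and> (\<exists>p\<in>poly_over k. a * poly q t = poly p t)" for q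
  obtain p0 q0 where pq: "a = poly p0 t / poly q0 t" "p0 \<in> poly_over k" "q0 \<in> poly_over k" "q0 \<noteq> 0"
    using a by (auto simp: P_def rational_functions_def)
  hence "a * poly q0 t = poly p0 t" using poly_nz[OF pq(3,4)] by simp
  hence "Q q0" using pq unfolding Q_def by blast
  then obtain q where Qq: "Q q" and min: "\<forall>q'. Q q' \<longrightarrow> degree q \<le> degree q'"
    using ex_has_least_nat[of Q q0 degree] by blast
  have q: "q \<in> poly_over k" "q \<noteq> 0" "\<exists>p\<in>poly_over k. a * poly q t = poly p t" using Qq by (auto simp: Q_def)
  obtain p where p: "p \<in> poly_over k" "a * poly q t = poly p t" using q by blast
  have "degree q = 0"
  proof (rule ccontr)
    assume "degree q \<noteq> 0"
    then obtain W where W: "valuation_ring UNIV W" "k \<subseteq> W" "t \<in> W" "poly q t \<in> maximal_ideal W"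
      using exists_place[OF k t q(1)] by blast
    have U: "subfield UNIV (\<Omega> :: 'a ring)" by (rule ambient_subfieldI) auto
    note V = U W(1)
    have x: "W \<inter> K \<in> closed_points k K" by (rule finite_place_lift[OF W(1-3) q(1,2) W(4)])
    have aW: "a \<in> W" using reg[OF x] W tK by auto
    obtain m where m: "m \<in> poly_over k" "m \<noteq> 0" "poly m t \<in> maximal_ideal W"
      "\<And>q. q \<in> poly_over k \<Longrightarrow> q \<noteq> 0 \<Longrightarrow> poly q t \<in> maximal_ideal W \<Longrightarrow> degree m \<le> degree q"
      using exists_minimal_polynomial[OF q(1,2) W(4)] by blast
    have div: "\<exists>q'\<in>poly_over k. p = q' * m" if p: "p \<in> poly_over k" "poly p t \<in> maximal_ideal W" for p
    proof -
      obtain q' r where qr: "q' \<in> poly_over k" "r \<in> poly_over k" "p = q' * m + r" "r = 0 \<or> degree r < degree m"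
        using poly_over_division[OF k m(1,2) p(1)] .
      have "poly q' t \<in> W" by (rule poly_over_in_subring[OF valuation_ring_subring[OF V] W(2) qr(1) W(3)])
      moreover have "poly r t = poly p t - poly m t * poly q' t" using qr by (simp add: mult.commute)
      ultimately have "poly r t \<in> maximal_ideal W"
        using p(2) maximal_ideal_diff[OF V] maximal_ideal_mult[OF V m(3)] by metis
      hence "r = 0" using m(4)[OF qr(2)] qr(4) by (metis leD)
      thus ?thesis using qr by auto
    qed
    have "poly q t * a \<in> maximal_ideal W" by (rule maximal_ideal_mult[OF V W(4) aW])
    hence "poly p t \<in> maximal_ideal W" using p(2) by (simp add: mult.commute)
    then obtain p' where p': "p' \<in> poly_over k" "p = p' * m" using div[OF p(1)] by blast
    obtain q' where q': "q' \<in> poly_over k" "q = q' * m" using div[OF q(1) W(4)] by blast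
    have q'0: "q' \<noteq> 0" using q' q(2) by auto
    have "a * poly q' t = poly p' t" using p(2) p' q' poly_nz[OF m(1,2)] by simp
    hence "Q q'" using q' q'0 p' unfolding Q_def by blast
    hence "degree q \<le> degree q'" using min by blast
    moreover have "degree m > 0" by (rule degree_vanishing_poly[OF V W(2) m(1-3)])
    ultimately show False using q' q'0 m(2) by (simp add: degree_mult_eq)
  qed
  then obtain c where c: "q = [:c:]" by (metis degree_eq_zeroE)
  hence "c \<noteq> 0" "c \<in> k" using q poly_over_pCons[OF kr] by auto
  hence "a = poly (smult (inverse c) p) t" "smult (inverse c) p \<in> poly_over k"
    using p c subfield_inverse[OF k] poly_over_smult[OF kr] by (auto simp: field_simps)
  thus ?thesis using that by blast
qed

text \<open>At a finite place at most one of the linear factors of \<open>f\<close> vanishes, and it is then a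
  uniformizer, so that \<open>f\<close> has valuation 0 or 1.\<close>

lemma square_free_regular:
  assumes b: "b \<in> P" and reg: "b ^ 2 * poly f t \<in> x" and x: "x \<in> closed_points k K" "t \<in> x"
  shows "b \<in> x"
proof (cases "b = 0")
  case True thus ?thesis using subring_0[OF cp_ring[OF K x(1)]] by simp
next
  case b0: False
  note V = K closed_point_valuation_ring[OF K x(1)]
  note r = valuation_ring_restrict[OF P PK V(2)]
  note w = closed_point_restrict[OF x(1) kP]
  note VP = P closed_point_valuation_ring[OF P w]
  let ?w = "x \<inter> P"
  have lin: "t - of_nat i \<in> ?w" "t - of_nat i \<noteq> 0" for i
    using poly_in_point[OF x linear_poly_over, of i] polyP[OF linear_poly_over, of i] poly_nz[OF linear_poly_over, of i] by auto
  have ft: "poly f t = (\<Prod>i\<in>{1..2*g+1}. t - of_nat i)"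
    unfolding f_def poly_prod by (intro prod.cong refl) simp
  have unit_prod: "(\<Prod>i\<in>I. t - of_nat i) \<in> units_of_ring ?w" if "\<And>i. i \<in> I \<Longrightarrow> t - of_nat i \<in> units_of_ring ?w" for I
    using that by (induction I rule: infinite_finite_induct) (auto intro: units_mult[OF VP] one_in_units[OF VP])
  have vu: "valuation ?w u = 0" "u \<in> P" "u \<noteq> 0" if "u \<in> units_of_ring ?w" for u
  proof -
    show a: "u \<in> P" "u \<noteq> 0" using that by (auto simp: units_of_ring_iff)
    show "valuation ?w u = 0" using valuation_nonneg_iff[OF P w a] that by (auto simp: units_of_ring_def)
  qed
  have fP: "poly f t \<in> P" "poly f t \<noteq> 0" using polyP[OF f_over] poly_nz[OF f_over f0] by auto
  have vf: "valuation ?w (poly f t) \<le> 1"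
  proof (cases "\<exists>i\<in>{1..2*g+1}. t - of_nat i \<in> maximal_ideal ?w")
    case False
    hence "poly f t \<in> units_of_ring ?w" unfolding ft by (intro unit_prod) (use lin in \<open>auto simp: units_of_ring_def\<close>)
    thus ?thesis using vu by simp
  next
    case True
    then obtain i where i: "i \<in> {1..2*g+1}" "t - of_nat i \<in> maximal_ideal ?w" by blast
    have "uniformizer ?w (poly [:- of_nat i, 1:] t)"
      unfolding P_def
    proof (rule rational_place(2)[OF k t subfield_rational_functions[OF k t]], unfold P_def[symmetric])
      show "valuation_ring P ?w" by (rule VP)
      show "k \<subseteq> ?w" by (rule cp_scalars[OF P w])
      show "t \<in> ?w" using x tP by simp
      fix q assume "q \<in> poly_over k" "q \<noteq> 0" "poly q t \<in> maximal_ideal ?w"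
      hence "degree q > 0" by (rule degree_vanishing_poly[OF VP cp_scalars[OF P w]])
      thus "degree [:- of_nat i, 1:] \<le> degree q" by simp
    qed (use i linear_poly_over in auto)
    hence v1: "valuation ?w (t - of_nat i) = 1" using valuation_uniformizer[OF P w] by simp
    have "t - of_nat j \<in> units_of_ring ?w" if j: "j \<noteq> i" for j
    proof -
      have "(of_nat i - of_nat j :: 'a) \<in> k" using subfield_closed(8)[OF k] subfield_closed(6)[OF k] by blast
      moreover have "(of_nat i - of_nat j :: 'a) \<noteq> 0" using j by simp
      ultimately have "(of_nat i - of_nat j :: 'a) \<in> units_of_ring ?w"
        using cp_scalars[OF P w] subfield_inverse[OF k] by (auto simp: units_of_ring_iff)
      from units_add[OF VP this i(2)] show ?thesis by (simp add: algebra_simps)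
    qed
    hence u: "(\<Prod>j\<in>{1..2*g+1}-{i}. t - of_nat j) \<in> units_of_ring ?w" by (intro unit_prod) auto
    have "poly f t = (t - of_nat i) * (\<Prod>j\<in>{1..2*g+1}-{i}. t - of_nat j)"
      unfolding ft using i by (intro prod.remove) auto
    thus ?thesis using valuation_mult[OF P w, of "t - of_nat i"] vu[OF u] lin[of i] v1 by auto
  qed
  have "b ^ 2 * poly f t \<in> P" "b ^ 2 * poly f t \<noteq> 0" using b b0 fP by (auto intro!: subfield_closed[OF P])
  hence "0 \<le> valuation ?w (b ^ 2 * poly f t)" using valuation_nonneg_iff(1)[OF P w] reg by blast
  also have "\<dots> = 2 * valuation ?w b + valuation ?w (poly f t)"
    using valuation_mult[OF P w, of "b ^ 2" "poly f t"] valuation_power[OF P w b b0, of 2] b b0 fP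
      subfield_closed(7)[OF P b] by auto
  \<comment> \<open>2 v(b) + v(f) >= 0 and v(f) <= 1 give 2 v(b) >= -1, hence v(b) >= 0 by
    integrality.\<close>
  finally have "0 \<le> valuation ?w b" using vf by presburger
  thus ?thesis using valuation_nonneg_iff(1)[OF P w b b0] by blast
qed

text \<open>Half the trace of z is a, and a^2 minus the norm of z is d b^2 f(t). So a is regular at
  once, and b because f is square-free.\<close>

lemma regular_functions:
  assumes z: "z \<in> K" and reg: "\<And>x. x \<in> closed_points k K \<Longrightarrow> t \<in> x \<Longrightarrow> z \<in> x"
  obtains p q where "p \<in> poly_over k" "q \<in> poly_over k" "z = poly p t + poly q t * y"
proof -
  obtain a b where ab: "a \<in> P" "b \<in> P" "z = a + b * y" using z by (auto simp: K_eq)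
  have half: "1 / 2 \<in> k" using subfield_of_rat[OF k, of 1 2] by simp
  have c: "a - b * y \<in> x" if "x \<in> closed_points k K" "t \<in> x" for x
    using conj_in_finite_points[OF ab(1,2) _ that] reg ab(3) by blast
  have ax: "a \<in> x" if x: "x \<in> closed_points k K" "t \<in> x" for x
  proof -
    have "1 / 2 * (z + (a - b * y)) \<in> x"
      using c[OF x] reg[OF x] half cp_scalars[OF K x(1)] cp_ring[OF K x(1)] by (intro subring_mult subring_add) auto
    thus ?thesis by (simp add: ab(3))
  qed
  have bx: "b \<in> x" if x: "x \<in> closed_points k K" "t \<in> x" for x
  proof (rule square_free_regular[OF ab(2) _ x])
    note R = cp_ring[OF K x(1)]
    have "inverse d * (a ^ 2 - z * (a - b * y)) \<in> x"
      using subring_diff[OF R subring_power[OF R ax[OF x], of 2] subring_mult[OF R reg[OF x] c[OF x]]]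
        subfield_inverse[OF k d(1)] cp_scalars[OF K x(1)] by (intro subring_mult[OF R]) auto
    moreover have "a ^ 2 - z * (a - b * y) = d * (b ^ 2 * poly f t)"
      using y2 by (simp add: ab(3) power2_eq_square algebra_simps)
    moreover have "inverse d * (d * w) = w" for w using d(2) by (simp flip: mult.assoc)
    ultimately show "b ^ 2 * poly f t \<in> x" by metis
  qed
  obtain p where p: "p \<in> poly_over k" "a = poly p t" using regular_imp_poly[OF ab(1) ax] by blast
  obtain q where q: "q \<in> poly_over k" "b = poly q t" using regular_imp_poly[OF ab(2) bx] by blast
  show ?thesis using that[OF p(1) q(1)] p q ab by simp
qed

end

section \<open>Divisors\<close>

lemma divisor_degree_superset:
  assumes "finite S" "{x. D x \<noteq> 0} \<subseteq> S"
  shows "divisor_degree k D = (\<Sum>x\<in>S. D x * int (point_degree k x))"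
  unfolding divisor_degree_def using assms by (intro sum.mono_neutral_left) auto

lemma riemann_roch_space_eq:
  fixes K :: "'a::field_char_0 set"
  assumes "subfield K \<Omega>"
  shows "riemann_roch_space k K D = {f \<in> K. \<forall>x\<in>closed_points k K. f \<in> frac_ideal K x (- D x)}"
  using subfield_closed(1)[OF assms] by (auto simp: riemann_roch_space_def frac_ideal_def)

lemma k_subspace_riemann_roch:
  fixes k K :: "'a::field_char_0 set"
  assumes "subfield K \<Omega>" "k \<subseteq> K"
  shows "k_subspace k (riemann_roch_space k K D)"
  unfolding riemann_roch_space_eq[OF assms(1)] k_subspace_def
  using k_subspace_frac_ideal[OF assms(1)] subfield_closed(1,3,4)[OF assms(1)] assms(2)
  unfolding k_subspace_def by (auto simp: subset_iff)

context
  fixes k K :: "'a::field_char_0 set"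
  assumes k: "subfield k \<Omega>" and K: "subfield K \<Omega>" and kK: "k \<subseteq> K"
    and residue: "\<And>x. x \<in> closed_points k K \<Longrightarrow> \<exists>N u. basis_mod k (maximal_ideal x) x {..<N::nat} u"
begin

text \<open>Multiplication by s^(D x + 1), s a uniformizer, maps L(D + x) into the ring x, and
  precisely L(D) into the maximal ideal. So L(D + x) / L(D) embeds into the residue field.\<close>

lemma codim_add_point:
  assumes x: "x \<in> closed_points k K"
  shows "codim_le k (riemann_roch_space k K (D(x := D x + 1))) (riemann_roch_space k K D) (point_degree k x)"
proof -
  let ?A = "riemann_roch_space k K (D(x := D x + 1))" and ?B = "riemann_roch_space k K D"
  obtain N w where w: "basis_mod k (maximal_ideal x) x {..<N::nat} w" using residue[OF x] by blast
  have deg: "point_degree k x = N" using point_degree_eq[OF k K x w] by simp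
  obtain s where s: "uniformizer x s" "s \<noteq> 0" "s \<in> K" using obtain_uniformizer[OF K x] by blast
  have ms: "k_subspace k (maximal_ideal x)" using k_subspace_frac_ideal[OF K x, of 1] frac_ideal_1[OF K x] by simp
  have bound: "n \<le> N" if u: "indep_mod k ?B {..<n} u" "u ` {..<n} \<subseteq> ?A" for n and u :: "nat \<Rightarrow> 'a"
  proof -
    define e where "e = s powi (D x + 1)"
    have e: "e \<in> K" "e \<noteq> 0" using s subfield_powi[OF K] by (auto simp: e_def)
    have uA: "u i \<in> K" "u i \<in> frac_ideal K x (- (D x + 1))" if "i < n" for i
    proof -
      have "u i \<in> ?A" using u that by auto
      thus "u i \<in> K" "u i \<in> frac_ideal K x (- (D x + 1))" using x unfolding riemann_roch_space_eq[OF K] by force+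
    qed
    have ux: "u i * e \<in> x" if "i < n" for i
      using frac_ideal_iff[OF K x s(1,3) uA(1)[OF that], of "- (D x + 1)"] uA(2)[OF that] by (simp add: e_def add.commute)
    have "indep_mod k (maximal_ideal x) {..<n} (\<lambda>i. u i * e)" unfolding indep_mod_def
    proof (rule allI, rule impI, rule impI)
      fix c assume c: "\<forall>i\<in>{..<n}. c i \<in> k" "(\<Sum>i<n. c i * (u i * e)) \<in> maximal_ideal x"
      define z where "z = (\<Sum>i<n. c i * u i)"
      have zA: "z \<in> ?A" unfolding z_def
        by (rule k_subspace_sum[OF k_subspace_riemann_roch[OF K kK]]) (use c u in auto)
      hence zK: "z \<in> K" unfolding riemann_roch_space_eq[OF K] by simp
      have ze: "z * e \<in> maximal_ideal x" using c(2) by (simp add: z_def sum_distrib_right mult.assoc)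
      have "z \<in> frac_ideal K x (- D x)"
      proof (cases "z = 0")
        case False
        have ve: "valuation x e = D x + 1"
          using valuation_eqI[OF K x s(1), of 1 "D x + 1"] one_in_units[OF K closed_point_valuation_ring[OF K x]]
          by (simp add: e_def)
        have "z * e \<in> K" "z * e \<noteq> 0" using False e zK subfield_closed(4)[OF K] by auto
        hence "0 < valuation x (z * e)" using ze valuation_nonneg_iff(2)[OF K x] by blast
        also have "\<dots> = valuation x z + (D x + 1)" using valuation_mult[OF K x zK False e] ve by simp
        finally show ?thesis using zK by (auto simp: frac_ideal_def)
      qed (use zK in \<open>auto simp: frac_ideal_def\<close>)
      hence "z \<in> ?B" using zA unfolding riemann_roch_space_eq[OF K] by (auto split: if_splits)
      thus "\<forall>i\<in>{..<n}. c i = 0" using u(1) c(1) unfolding indep_mod_def z_def by blast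
    qed
    hence "card {..<n} \<le> card {..<N}"
      by (rule steinitz[OF k ms, where A = x and u = w]) (use ux w in \<open>auto simp: basis_mod_def\<close>)
    thus ?thesis by simp
  qed
  obtain n u where "n \<le> N" "basis_mod k ?B ?A {..<n::nat} u"
    using exists_basis_mod[OF k k_subspace_riemann_roch[OF K kK, of D], of ?A N] bound by blast
  thus ?thesis unfolding deg codim_le_def basis_mod_def by blast
qed

text \<open>Points are added one at a time, each raising l by at most its degree. In other words,
  deg D - l(D) does not decrease as D grows.\<close>

lemma codim_divisors:
  assumes S: "finite S" "S \<subseteq> closed_points k K" and E: "{x. E x \<noteq> 0} \<subseteq> S" and D: "{x. D x \<noteq> 0} \<subseteq> S"
    and le: "\<And>x. D x \<le> E x"
  shows "divisor_degree k D \<le> divisor_degree k E \<and>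
    codim_le k (riemann_roch_space k K E) (riemann_roch_space k K D) (nat (divisor_degree k E - divisor_degree k D))"
  using D le
proof (induction "nat (\<Sum>x\<in>S. E x - D x)" arbitrary: D)
  case 0
  have "(\<Sum>x\<in>S. E x - D x) = 0" using 0 sum_nonneg[of S "\<lambda>x. E x - D x"] by auto
  hence "\<forall>x\<in>S. E x - D x = 0" using sum_nonneg_eq_0_iff[OF S(1), of "\<lambda>x. E x - D x"] 0 by auto
  hence "E = D" using E 0 by (intro ext) (metis (mono_tags, lifting) diff_eq_eq add_0 mem_Collect_eq subsetD)
  thus ?case using codim_le_refl[OF k_subspace_riemann_roch[OF K kK]] by simp
next
  case (Suc n)
  have "\<exists>x\<in>S. E x \<noteq> D x"
  proof (rule ccontr)
    assume "\<not> ?thesis"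
    hence "(\<Sum>x\<in>S. E x - D x) = 0" by (intro sum.neutral) auto
    thus False using Suc by simp
  qed
  then obtain x where x: "x \<in> S" "D x < E x" using Suc.prems(2) by (metis order_le_less)
  define D1 where "D1 = D(x := D x + 1)"
  have D1: "{x. D1 x \<noteq> 0} \<subseteq> S" "\<And>y. D1 y \<le> E y" using Suc.prems x by (auto simp: D1_def)
  have s1: "(\<Sum>y\<in>S. F y * h y) = (\<Sum>y\<in>S. D y * h y) + h x" if "F = D1" for F and h :: "'a set \<Rightarrow> int"
    using S(1) x(1) unfolding that D1_def
    by (subst (1 2) sum.remove[of S x]) (auto simp: algebra_simps intro!: sum.cong)
  have "(\<Sum>y\<in>S. E y - D1 y) = (\<Sum>y\<in>S. E y - D y) - 1"
    using s1[OF refl, of "\<lambda>_. 1"] by (simp add: sum_subtractf)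
  hence "n = nat (\<Sum>x\<in>S. E x - D1 x)" using Suc.hyps(2) by simp
  from Suc.hyps(1)[OF this D1] have IH: "divisor_degree k D1 \<le> divisor_degree k E"
    "codim_le k (riemann_roch_space k K E) (riemann_roch_space k K D1) (nat (divisor_degree k E - divisor_degree k D1))" by auto
  have d: "divisor_degree k D1 = divisor_degree k D + int (point_degree k x)"
    using s1[OF refl] divisor_degree_superset[OF S(1) D1(1)] divisor_degree_superset[OF S(1) Suc.prems(1)] by simp
  have "codim_le k (riemann_roch_space k K E) (riemann_roch_space k K D)
      (nat (divisor_degree k E - divisor_degree k D1) + point_degree k x)"
    by (rule codim_le_trans[OF IH(2)]) (use codim_add_point[of x D] x S in \<open>auto simp: D1_def\<close>)
  moreover have "nat (divisor_degree k E - divisor_degree k D1) + point_degree k x = nat (divisor_degree k E - divisor_degree k D)"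
    using IH(1) d by simp
  ultimately show ?case using IH(1) d by simp
qed

end

section \<open>The genus of the hyperelliptic curve\<close>

context hyperelliptic
begin

text \<open>M and N count coefficients: the degrees stay below them, and a bound 0 leaves only the
  zero polynomial.\<close>

definition poly_space :: "nat \<Rightarrow> nat \<Rightarrow> 'a set"
  where "poly_space M N = {poly p t + poly q t * y | p q. p \<in> poly_over k \<and> q \<in> poly_over k \<and>
    (\<forall>i\<ge>M. coeff p i = 0) \<and> (\<forall>i\<ge>N. coeff q i = 0)}"

section \<open>Counting functions of bounded degree\<close>

lemma poly_eq_sum_lessThan:
  fixes p :: "'a poly"
  assumes "\<forall>i\<ge>M. coeff p i = 0" shows "poly p a = (\<Sum>i<M. coeff p i * a ^ i)"
proof -
  let ?n = "max M (Suc (degree p))"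
  have "poly p a = (\<Sum>i<?n. coeff p i * a ^ i)"
    unfolding poly_altdef by (intro sum.mono_neutral_left) (auto simp: coeff_eq_0)
  also have "\<dots> = (\<Sum>i<M. coeff p i * a ^ i)"
    using assms by (intro sum.mono_neutral_right) auto
  finally show ?thesis .
qed

lemma basis_poly_space:
  assumes c: "c \<noteq> 0"
  shows "basis_mod k {0} ((*) c ` poly_space M N) ({..<M} <+> {..<N})
    (case_sum (\<lambda>i. c * t ^ i) (\<lambda>i. c * (t ^ i * y)))"
proof -
  let ?u = "case_sum (\<lambda>i. c * t ^ i) (\<lambda>i. c * (t ^ i * y))"
  have sum: "(\<Sum>i\<in>{..<M} <+> {..<N}. e i * ?u i)
      = c * ((\<Sum>i<M. e (Inl i) * t ^ i) + (\<Sum>i<N. e (Inr i) * t ^ i) * y)" for e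
    by (subst sum.Plus) (simp_all add: sum_distrib_left sum_distrib_right distrib_left mult_ac)
  define mk where "mk e n = (\<Sum>i<n. monom (e i) i)" for e :: "nat \<Rightarrow> 'a" and n
  have mk: "poly (mk e n) a = (\<Sum>i<n. e i * a ^ i)" "coeff (mk e n) i = (if i < n then e i else 0)" for e n a i
    by (auto simp: mk_def poly_sum poly_monom coeff_sum coeff_monom)
  have mkk: "mk e n \<in> poly_over k" if "\<And>i. i < n \<Longrightarrow> e i \<in> k" for e n
    using that subfield_closed(1)[OF k] by (auto simp: poly_over_def mk)
  have "?u i \<in> (*) c ` poly_space M N" if "i \<in> {..<M} <+> {..<N}" for i
  proof -
    have mon: "monom 1 i \<in> poly_over k" for i using kr by (auto simp: poly_over_closed subring_closed)
    have zero: "0 \<in> poly_over k" by (rule poly_over_0[OF kr])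
    show ?thesis using that
    proof (cases i)
      case (Inl j)
      hence "t ^ j \<in> poly_space M N" using that mon[of j] zero unfolding poly_space_def
        by (intro CollectI exI[of _ "monom 1 j"] exI[of _ 0]) (auto simp: poly_monom)
      thus ?thesis using Inl by auto
    next
      case (Inr j)
      hence "t ^ j * y \<in> poly_space M N" using that mon[of j] zero unfolding poly_space_def
        by (intro CollectI exI[of _ 0] exI[of _ "monom 1 j"]) (auto simp: poly_monom)
      thus ?thesis using Inr by auto
    qed
  qed
  moreover have "indep_mod k {0} ({..<M} <+> {..<N}) ?u" unfolding indep_mod_def
  proof (rule allI, rule impI, rule impI)
    fix e assume e: "\<forall>i\<in>{..<M} <+> {..<N}. e i \<in> k" "(\<Sum>i\<in>{..<M} <+> {..<N}. e i * ?u i) \<in> {0}"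
    define p q where "p = mk (e \<circ> Inl) M" and "q = mk (e \<circ> Inr) N"
    have pq: "p \<in> poly_over k" "q \<in> poly_over k" unfolding p_def q_def using e(1) by (auto intro!: mkk)
    have "poly p t + poly q t * y = 0 + 0 * y" using e(2) c unfolding sum by (simp add: p_def q_def mk)
    hence "poly p t = 0" "poly q t = 0"
      using coordinates_unique[OF polyP[OF pq(1)] polyP[OF pq(2)] subfield_closed(1)[OF P] subfield_closed(1)[OF P]] by auto
    hence "p = 0" "q = 0" using poly_nz pq by blast+
    hence "e (Inl i) = 0" if "i < M" for i using mk(2)[where e = "e \<circ> Inl" and n = M and i = i] that by (simp add: p_def)
    moreover have "e (Inr i) = 0" if "i < N" for i using mk(2)[where e = "e \<circ> Inr" and n = N and i = i] that \<open>q = 0\<close> by (simp add: q_def)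
    ultimately show "\<forall>i\<in>{..<M} <+> {..<N}. e i = 0" by auto
  qed
  moreover have "gen_mod k {0} ({..<M} <+> {..<N}) ?u ((*) c ` poly_space M N)" unfolding gen_mod_def
  proof
    fix z assume "z \<in> (*) c ` poly_space M N"
    then obtain p q where pq: "z = c * (poly p t + poly q t * y)" "p \<in> poly_over k" "q \<in> poly_over k"
      "\<forall>i\<ge>M. coeff p i = 0" "\<forall>i\<ge>N. coeff q i = 0" by (auto simp: poly_space_def)
    show "\<exists>e. (\<forall>i\<in>{..<M} <+> {..<N}. e i \<in> k) \<and> z - (\<Sum>i\<in>{..<M} <+> {..<N}. e i * ?u i) \<in> {0}"
      using pq(2,3) unfolding sum pq(1) poly_eq_sum_lessThan[OF pq(4)] poly_eq_sum_lessThan[OF pq(5)]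
      by (intro exI[of _ "case_sum (coeff p) (coeff q)"]) (auto simp: poly_over_def)
  qed
  ultimately show ?thesis by (auto simp: basis_mod_def)
qed

lemma common_denominator:
  assumes "finite Z" "Z \<subseteq> K"
  shows "\<exists>h\<in>poly_over k. h \<noteq> 0 \<and> (\<exists>N. \<forall>z\<in>Z. \<exists>p\<in>poly_over k. \<exists>q\<in>poly_over k.
    degree p \<le> N \<and> degree q \<le> N \<and> z * poly h t = poly p t + poly q t * y)"
  using assms
proof (induction Z rule: finite_induct)
  case empty thus ?case using poly_over_1[OF kr] by (intro bexI[of _ 1]) auto
next
  case (insert z Z)
  then obtain h N where h: "h \<in> poly_over k" "h \<noteq> 0" and N: "\<forall>z\<in>Z. \<exists>p\<in>poly_over k. \<exists>q\<in>poly_over k.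
    degree p \<le> N \<and> degree q \<le> N \<and> z * poly h t = poly p t + poly q t * y" by auto
  obtain a b where ab: "a \<in> P" "b \<in> P" "z = a + b * y" using insert.prems by (auto simp: K_eq)
  obtain p q where pq: "a = poly p t / poly q t" "p \<in> poly_over k" "q \<in> poly_over k" "q \<noteq> 0"
    using ab by (auto simp: P_def rational_functions_def)
  obtain r s where rs: "b = poly r t / poly s t" "r \<in> poly_over k" "s \<in> poly_over k" "s \<noteq> 0"
    using ab by (auto simp: P_def rational_functions_def)
  define h' where "h' = h * q * s"
  define N' where "N' = N + degree q + degree s + degree (p * s * h) + degree (r * q * h)"
  note cl = poly_over_mult[OF kr]
  have "\<exists>p'\<in>poly_over k. \<exists>q'\<in>poly_over k. degree p' \<le> N' \<and> degree q' \<le> N' \<and> w * poly h' t = poly p' t + poly q' t * y"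
    if w: "w \<in> insert z Z" for w
  proof (cases "w = z")
    case True
    have "z * poly h' t = poly (p * s * h) t + poly (r * q * h) t * y"
    proof -
      have "a * poly q t = poly p t" "b * poly s t = poly r t"
        using pq(1) rs(1) poly_nz[OF pq(3,4)] poly_nz[OF rs(3,4)] by auto
      moreover have "z * poly h' t = (a * poly q t) * (poly s t * poly h t) + (b * poly s t) * (poly q t * poly h t) * y"
        by (simp add: ab(3) h'_def algebra_simps)
      ultimately show ?thesis by (simp add: mult.assoc)
    qed
    moreover have "p * s * h \<in> poly_over k" "r * q * h \<in> poly_over k" using pq rs h by (auto intro!: cl)
    moreover have "degree (p * s * h) \<le> N'" "degree (r * q * h) \<le> N'" by (auto simp: N'_def)
    ultimately show ?thesis using True by blast
  next
    case False
    then obtain p' q' where p'q': "p' \<in> poly_over k" "q' \<in> poly_over k" "degree p' \<le> N" "degree q' \<le> N"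
      "w * poly h t = poly p' t + poly q' t * y" using N w by auto
    have "w * poly h' t = w * poly h t * (poly q t * poly s t)" by (simp add: h'_def mult_ac)
    also have "\<dots> = poly (p' * (q * s)) t + poly (q' * (q * s)) t * y" unfolding p'q'(5) by (simp add: algebra_simps)
    finally have e: "w * poly h' t = poly (p' * (q * s)) t + poly (q' * (q * s)) t * y" .
    moreover have "p' * (q * s) \<in> poly_over k" "q' * (q * s) \<in> poly_over k" using pq rs p'q' by (auto intro!: cl)
    moreover have "degree (u * (q * s)) \<le> N'" if "degree u \<le> N" for u
      using degree_mult_le[of u "q * s"] degree_mult_le[of q s] that by (simp add: N'_def)
    ultimately show ?thesis using p'q'(3,4) by blast
  qed
  moreover have "h' \<in> poly_over k" "h' \<noteq> 0" using h pq rs by (auto simp: h'_def intro!: cl)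
  ultimately show ?case by blast
qed

text \<open>After multiplication by a common denominator of Z and by t^(a L), the elements become
  p(t) + r(t) y with degrees at most N + \<delta> L. The slope is 2 \<delta> because there are two
  polynomials, that is, because [K : P] = 2.\<close>

lemma growth:
  assumes q: "q \<in> poly_over k" "degree q \<le> \<delta>" "a \<le> \<delta>" and Z: "finite Z" "Z \<subseteq> K"
  shows "\<exists>m. \<forall>L. codim_le k {z * (poly q t / t ^ a) ^ l | z l. z \<in> Z \<and> l < L} {0} (m + 2 * \<delta> * L)"
proof -
  obtain h N where h: "h \<in> poly_over k" "h \<noteq> 0" and N: "\<forall>z\<in>Z. \<exists>p\<in>poly_over k. \<exists>r\<in>poly_over k.
    degree p \<le> N \<and> degree r \<le> N \<and> z * poly h t = poly p t + poly r t * y" using common_denominator[OF Z] by blast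
  have "codim_le k {z * (poly q t / t ^ a) ^ l | z l. z \<in> Z \<and> l < L} {0} (2 * (N + 1) + 2 * \<delta> * L)" for L
  proof (rule codim_leI)
    \<comment> \<open>One more than the degree bound, since \<open>poly_space\<close> counts
      coefficients.\<close>
    define M where "M = N + \<delta> * L + 1"
    define c where "c = inverse (poly h t * t ^ (a * L))"
    have t0: "t \<noteq> 0" by (rule transcendental_nonzero[OF k t])
    have c0: "c \<noteq> 0" using poly_nz[OF h] t0 by (simp add: c_def)
    have sub: "{z * (poly q t / t ^ a) ^ l | z l. z \<in> Z \<and> l < L} \<subseteq> (*) c ` poly_space M M"
    proof safe
      fix z l assume z: "z \<in> Z" and l: "l < L"
      obtain p r where pr: "p \<in> poly_over k" "r \<in> poly_over k" "degree p \<le> N" "degree r \<le> N"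
        "z * poly h t = poly p t + poly r t * y" using N z by blast
      define w where "w = q ^ l * monom 1 (a * (L - l))"
      have wk: "w \<in> poly_over k" unfolding w_def using kr q by (intro poly_over_mult poly_over_power poly_over_monom) (auto simp: subring_closed)
      have "degree w \<le> degree (q ^ l) + a * (L - l)"
        unfolding w_def by (rule order.trans[OF degree_mult_le]) (simp add: degree_monom_le)
      also have "\<dots> \<le> \<delta> * l + \<delta> * (L - l)"
        using order.trans[OF degree_power_le[of q l] mult_right_mono[OF q(2)]] q(3) by (intro add_mono mult_right_mono) auto
      also have "\<dots> = \<delta> * L" using l by (simp flip: distrib_left)
      finally have dw: "degree w \<le> \<delta> * L" .
      have cf: "\<forall>i\<ge>M. coeff (u * w) i = 0" if "degree u \<le> N" for u
        using degree_mult_le[of u w] dw that by (auto simp: M_def intro!: coeff_eq_0)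
      have tl: "t ^ (a * L) = t ^ (a * (L - l)) * (t ^ a) ^ l" using l
        by (simp flip: power_add power_mult add: distrib_left[symmetric])
      have "z * (poly q t / t ^ a) ^ l = c * (z * poly h t * poly w t)"
      proof -
        have "z * (Q / T) = inverse (H * (U * T)) * (z * H * (Q * U))" if "H \<noteq> 0" "U \<noteq> 0" "T \<noteq> 0" for Q T H U :: 'a
          using that by (simp add: field_simps)
        from this[of "poly h t" "t ^ (a * (L - l))" "(t ^ a) ^ l" "poly q t ^ l"] show ?thesis
          using poly_nz[OF h] t0 unfolding c_def tl w_def by (simp add: poly_monom power_divide)
      qed
      also have "z * poly h t * poly w t = poly (p * w) t + poly (r * w) t * y" unfolding pr(5) by (simp add: algebra_simps)
      finally have e: "z * (poly q t / t ^ a) ^ l = c * (poly (p * w) t + poly (r * w) t * y)" .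
      have "poly (p * w) t + poly (r * w) t * y \<in> poly_space M M"
        unfolding poly_space_def using cf pr wk poly_over_mult[OF kr] by blast
      thus "z * (poly q t / t ^ a) ^ l \<in> (*) c ` poly_space M M" unfolding e by blast
    qed
    show "gen_mod k {0} ({..<M} <+> {..<M}) (case_sum (\<lambda>i. c * t ^ i) (\<lambda>i. c * (t ^ i * y)))
      {z * (poly q t / t ^ a) ^ l | z l. z \<in> Z \<and> l < L}"
      using basis_poly_space[OF c0, of M M] sub unfolding basis_mod_def gen_mod_def by (meson subsetD)
    show "card ({..<M} <+> {..<M}) \<le> 2 * (N + 1) + 2 * \<delta> * L" by (simp add: card_Plus M_def algebra_simps)
  qed simp
  thus ?thesis by blast
qed

text \<open>The shape q(t) / t^a covers both kinds of points: a = 0 counts zeros of q(t), while q =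
  1 and a = 1 counts poles of t.\<close>

lemma zeros_bound_poly:
  assumes q: "q \<in> poly_over k" "q \<noteq> 0" "degree q \<le> \<delta>" "a \<le> \<delta>"
    and S: "finite S" "S \<subseteq> closed_points k K" "\<And>x. x \<in> S \<Longrightarrow> 0 \<le> valuation x (poly q t / t ^ a)"
    and u: "\<And>x. x \<in> S \<Longrightarrow> finite (I x)" "\<And>x. x \<in> S \<Longrightarrow> u x ` I x \<subseteq> x"
      "\<And>x. x \<in> S \<Longrightarrow> indep_mod k (maximal_ideal x) (I x) (u x)"
  shows "(\<Sum>x\<in>S. nat (valuation x (poly q t / t ^ a)) * card (I x)) \<le> 2 * \<delta>"
proof (rule zeros_bound[OF k K S(1,2)])
  have "poly q t \<in> K" using polyP[OF q(1)] PK by blast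
  thus "poly q t / t ^ a \<in> K" using tK by (auto intro!: subfield_closed(7,10)[OF K])
  show "poly q t / t ^ a \<noteq> 0" using poly_nz[OF q(1,2)] transcendental_nonzero[OF k t] by simp
  show "\<exists>m. \<forall>L. codim_le k {z * (poly q t / t ^ a) ^ l |z l. z \<in> Z \<and> l < L} {0} (m + 2 * \<delta> * L)"
    if "finite Z" "Z \<subseteq> K" for Z using growth[OF q(1,3,4) that] .
qed (fact S(3) u)+

section \<open>Finiteness of residue fields and of zeros\<close>

lemma exists_vanishing_function:
  assumes x: "x \<in> closed_points k K"
  obtains q a where "q \<in> poly_over k" "q \<noteq> 0" "0 < valuation x (poly q t / t ^ a)"
proof (cases "t \<in> x")
  case True
  obtain q where q: "q \<in> poly_over k" "q \<noteq> 0" "poly q t \<in> maximal_ideal x"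
    using exists_vanishing_poly[OF x True] by blast
  have "poly q t \<in> K" using polyP[OF q(1)] PK by blast
  hence "0 < valuation x (poly q t)" using valuation_nonneg_iff(2)[OF K x] poly_nz[OF q(1,2)] q(3) by blast
  thus ?thesis using that[of q 0] q by simp
next
  case False
  have "0 < valuation x (inverse t)"
    using valuation_inverse[OF K x tK transcendental_nonzero[OF k t]] valuation_t_infinite[OF x False] by simp
  thus ?thesis using that[of 1 1] poly_over_1[OF kr] by (simp add: inverse_eq_divide)
qed

text \<open>The counting bound at a single point: n independent residues at a zero of q(t) / t^a
  produce at least n independent classes, so n is bounded.\<close>

lemma finite_residue:
  assumes x: "x \<in> closed_points k K"
  obtains N u where "basis_mod k (maximal_ideal x) x {..<N::nat} u"
proof -
  obtain q a where q: "q \<in> poly_over k" "q \<noteq> 0" "0 < valuation x (poly q t / t ^ a)"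
    using exists_vanishing_function[OF x] .
  have "n \<le> 2 * (degree q + a)" if "indep_mod k (maximal_ideal x) {..<n} u" "u ` {..<n} \<subseteq> x" for n and u :: "nat \<Rightarrow> 'a"
  proof -
    have "(\<Sum>x\<in>{x}. nat (valuation x (poly q t / t ^ a)) * card {..<n}) \<le> 2 * (degree q + a)"
      by (rule zeros_bound_poly[OF q(1,2), where u = "\<lambda>_. u"]) (use q x that in auto)
    hence "nat (valuation x (poly q t / t ^ a)) * n \<le> 2 * (degree q + a)" by simp
    moreover have "1 * n \<le> nat (valuation x (poly q t / t ^ a)) * n" using q(3) by (intro mult_right_mono) auto
    ultimately show ?thesis by linarith
  qed
  moreover have "k_subspace k (maximal_ideal x)" using k_subspace_frac_ideal[OF K x, of 1] frac_ideal_1[OF K x] by simp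
  ultimately show ?thesis using exists_basis_mod[OF k] that by metis
qed

lemma point_degree_pos:
  assumes x: "x \<in> closed_points k K"
  obtains N u where "basis_mod k (maximal_ideal x) x {..<N::nat} u" "point_degree k x = N" "N > 0"
proof -
  note V = K closed_point_valuation_ring[OF K x]
  obtain N u where u: "basis_mod k (maximal_ideal x) x {..<N::nat} u" using finite_residue[OF x] .
  have "N \<noteq> 0"
  proof
    assume "N = 0"
    hence "\<forall>a\<in>x. a \<in> maximal_ideal x" using u by (auto simp: basis_mod_def gen_mod_def)
    thus False using subring_1[OF cp_ring[OF K x]] one_notin_maximal_ideal[OF V] by blast
  qed
  thus ?thesis using that[OF u] point_degree_eq[OF k K x u] by simp
qed

lemma degree_bound:
  assumes q: "q \<in> poly_over k" "q \<noteq> 0" "degree q \<le> \<delta>" "a \<le> \<delta>"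
    and S: "finite S" "S \<subseteq> closed_points k K" "\<And>x. x \<in> S \<Longrightarrow> 0 \<le> valuation x (poly q t / t ^ a)"
  shows "(\<Sum>x\<in>S. valuation x (poly q t / t ^ a) * int (point_degree k x)) \<le> 2 * int \<delta>"
proof -
  have "\<exists>u. basis_mod k (maximal_ideal x) x {..<point_degree k x} u" if "x \<in> S" for x
    using point_degree_pos[of x] S(2) that by (metis subsetD)
  then obtain u where u: "\<And>x. x \<in> S \<Longrightarrow> basis_mod k (maximal_ideal x) x {..<point_degree k x} (u x)" by metis
  have "(\<Sum>x\<in>S. nat (valuation x (poly q t / t ^ a)) * card {..<point_degree k x}) \<le> 2 * \<delta>"
    by (rule zeros_bound_poly[OF q S, where u = u]) (use u in \<open>auto simp: basis_mod_def\<close>)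
  hence "(\<Sum>x\<in>S. nat (valuation x (poly q t / t ^ a)) * point_degree k x) \<le> 2 * \<delta>" by (simp only: card_lessThan)
  hence "int (\<Sum>x\<in>S. nat (valuation x (poly q t / t ^ a)) * point_degree k x) \<le> 2 * int \<delta>" by linarith
  also have "int (\<Sum>x\<in>S. nat (valuation x (poly q t / t ^ a)) * point_degree k x)
      = (\<Sum>x\<in>S. valuation x (poly q t / t ^ a) * int (point_degree k x))"
    unfolding of_nat_sum using S(3) by (intro sum.cong) auto
  finally show ?thesis .
qed

text \<open>Each zero contributes at least 1 to the bounded degree sum.\<close>

lemma finite_zeros:
  assumes q: "q \<in> poly_over k" "q \<noteq> 0"
  shows "finite {x \<in> closed_points k K. 0 < valuation x (poly q t / t ^ a)}" (is "finite ?S")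
proof (rule ccontr)
  assume "infinite ?S"
  then obtain S where S: "S \<subseteq> ?S" "finite S" "card S = Suc (2 * (degree q + a))"
    using infinite_arbitrarily_large by blast
  have "int (card S) = (\<Sum>x\<in>S. 1 * 1)" by simp
  also have "\<dots> \<le> (\<Sum>x\<in>S. valuation x (poly q t / t ^ a) * int (point_degree k x))"
  proof (rule sum_mono)
    fix x assume "x \<in> S"
    hence "x \<in> closed_points k K" "0 < valuation x (poly q t / t ^ a)" using S by auto
    thus "1 * 1 \<le> valuation x (poly q t / t ^ a) * int (point_degree k x)"
      using point_degree_pos[of x] by (intro mult_mono) force+
  qed
  also have "\<dots> \<le> 2 * int (degree q + a)" by (rule degree_bound[OF q]) (use S in auto)
  finally show False using S(3) by simp
qed

text \<open>The divisor of zeros of \<open>q(t)\<close> plus \<open>n\<close> times the divisor of poles of \<open>t\<close>.\<close>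

definition big_divisor :: "'a poly \<Rightarrow> nat \<Rightarrow> 'a set \<Rightarrow> int"
  where "big_divisor q n x = (if x \<in> closed_points k K
    then if t \<in> x then valuation x (poly q t) else - int n * valuation x t else 0)"

section \<open>The cofinal family of divisors\<close>

lemma valuation_poly_nonneg:
  assumes "x \<in> closed_points k K" "t \<in> x" "q \<in> poly_over k" "q \<noteq> 0"
  shows "0 \<le> valuation x (poly q t)"
proof -
  have "poly q t \<in> K" using polyP[OF assms(3)] PK by blast
  thus ?thesis using valuation_nonneg_iff(1)[OF K assms(1)] poly_nz[OF assms(3,4)] poly_in_point[OF assms(1-3)] by blast
qed

text \<open>The zeros of q(t) contribute at most 2 deg q to the degree, and each of the n copies of
  the poles of t at most 2; the factor is again [K : P].\<close>

lemma big_divisor: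
  assumes q: "q \<in> poly_over k" "q \<noteq> 0"
  shows "finite {x. big_divisor q n x \<noteq> 0}" "{x. big_divisor q n x \<noteq> 0} \<subseteq> closed_points k K"
    "divisor_degree k (big_divisor q n) \<le> 2 * int (n + degree q)"
proof -
  define S1 where "S1 = {x \<in> closed_points k K. 0 < valuation x (poly q t / t ^ 0)} \<inter> {x. t \<in> x}"
  define S2 where "S2 = {x \<in> closed_points k K. 0 < valuation x (poly 1 t / t ^ 1)}"
  have vi: "valuation x (poly 1 t / t ^ 1) = - valuation x t" if "x \<in> closed_points k K" for x
    using valuation_inverse[OF K that tK transcendental_nonzero[OF k t]] by (simp add: inverse_eq_divide)
  have S2: "x \<in> S2 \<longleftrightarrow> x \<in> closed_points k K \<and> t \<notin> x" for x
    using vi[of x] valuation_nonneg_iff(1)[OF K _ tK transcendental_nonzero[OF k t], of x k] by (auto simp: S2_def)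
  have fin: "finite S1" "finite S2" unfolding S1_def S2_def
    using finite_zeros[OF q, of 0] finite_zeros[of 1 1] poly_over_1[OF kr] by auto
  have supp: "{x. big_divisor q n x \<noteq> 0} \<subseteq> S1 \<union> S2"
    using valuation_poly_nonneg[OF _ _ q] S2 by (force simp: big_divisor_def S1_def split: if_splits)
  thus "finite {x. big_divisor q n x \<noteq> 0}" using fin by (meson finite_UnI finite_subset)
  show "{x. big_divisor q n x \<noteq> 0} \<subseteq> closed_points k K" by (auto simp: big_divisor_def)
  have "divisor_degree k (big_divisor q n) = (\<Sum>x\<in>S1 \<union> S2. big_divisor q n x * int (point_degree k x))"
    by (rule divisor_degree_superset) (use fin supp in auto)
  also have "\<dots> = (\<Sum>x\<in>S1. big_divisor q n x * int (point_degree k x)) + (\<Sum>x\<in>S2. big_divisor q n x * int (point_degree k x))"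
    by (rule sum.union_disjoint) (use fin S2 in \<open>auto simp: S1_def\<close>)
  also have "(\<Sum>x\<in>S1. big_divisor q n x * int (point_degree k x)) = (\<Sum>x\<in>S1. valuation x (poly q t / t ^ 0) * int (point_degree k x))"
    by (intro sum.cong) (auto simp: big_divisor_def S1_def)
  also have "\<dots> \<le> 2 * int (degree q)" by (rule degree_bound[OF q]) (use fin in \<open>auto simp: S1_def\<close>)
  also have "(\<Sum>x\<in>S2. big_divisor q n x * int (point_degree k x))
      = (\<Sum>x\<in>S2. int n * (valuation x (poly 1 t / t ^ 1) * int (point_degree k x)))"
    by (intro sum.cong refl) (use S2 vi in \<open>auto simp: big_divisor_def\<close>)
  also have "\<dots> = int n * (\<Sum>x\<in>S2. valuation x (poly 1 t / t ^ 1) * int (point_degree k x))" by (simp only: sum_distrib_left)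
  also have "\<dots> \<le> int n * (2 * int 1)"
    by (intro mult_left_mono degree_bound) (use fin poly_over_1[OF kr] in \<open>auto simp: S2_def\<close>)
  finally show "divisor_degree k (big_divisor q n) \<le> 2 * int (n + degree q)" by simp
qed

text \<open>Twice the valuations of the two terms are an even and an odd multiple of v(t), so they
  differ and the smaller one is the valuation of the sum.\<close>

lemma valuation_sum_infinite:
  assumes x: "x \<in> closed_points k K" "t \<notin> x" and p: "p \<in> poly_over k" "p \<noteq> 0" and r: "r \<in> poly_over k" "r \<noteq> 0"
  shows "poly p t + poly r t * y \<noteq> 0" "valuation x (poly p t + poly r t * y) =
    min (int (degree p) * valuation x t) (valuation x (poly r t * y))"
    "2 * valuation x (poly r t * y) = int (2 * degree r + 2 * g + 1) * valuation x t"
proof -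
  have K1: "poly p t \<in> K" "poly p t \<noteq> 0" "poly r t \<in> K" "poly r t \<noteq> 0"
    using polyP p r PK poly_nz by blast+
  have K2: "poly r t * y \<in> K" "poly r t * y \<noteq> 0" using K1 yK y0 subfield_closed(4)[OF K] by auto
  have vp: "valuation x (poly p t) = int (degree p) * valuation x t" by (rule valuation_poly_infinite[OF x p])
  have "valuation x (poly r t * y) = int (degree r) * valuation x t + valuation x y"
    using valuation_mult[OF K x(1) K1(3,4) yK y0] valuation_poly_infinite[OF x r] by simp
  thus v2: "2 * valuation x (poly r t * y) = int (2 * degree r + 2 * g + 1) * valuation x t"
    using valuation_y_infinite[OF x] by (simp add: algebra_simps)
  have ne: "valuation x (poly p t) \<noteq> valuation x (poly r t * y)"
  proof
    assume "valuation x (poly p t) = valuation x (poly r t * y)"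
    hence "2 * (int (degree p) * valuation x t) = int (2 * degree r + 2 * g + 1) * valuation x t" using vp v2 by metis
    hence "int (2 * degree p) * valuation x t = int (2 * degree r + 2 * g + 1) * valuation x t"
      by (simp only: of_nat_mult of_nat_numeral mult.assoc)
    hence "2 * degree p = 2 * degree r + 2 * g + 1" using valuation_t_infinite[OF x] by (simp only: mult_cancel_right of_nat_eq_iff) simp
    thus False by presburger
  qed
  show "poly p t + poly r t * y \<noteq> 0" "valuation x (poly p t + poly r t * y) =
    min (int (degree p) * valuation x t) (valuation x (poly r t * y))"
    using valuation_add_eq[OF K x(1) K1(1,2) K2] valuation_add_eq[OF K x(1) K2 K1(1,2)] ne vp
    by (cases "valuation x (poly p t) < valuation x (poly r t * y)"; force simp: add.commute)+
qed

text \<open>Multiplication by q(t) turns the finite conditions into regularity, which yields p(t) +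
  r(t) y. At infinity, absence of cancellation bounds the terms separately: deg p <= n + deg q, and
  2 deg r + 2g + 1 <= 2 (n + deg q), that is, deg r < n + deg q - g.\<close>

lemma riemann_roch_big_divisor:
  assumes q: "q \<in> poly_over k" "q \<noteq> 0" and n: "g \<le> n"
  shows "riemann_roch_space k K (big_divisor q n)
    = (*) (inverse (poly q t)) ` poly_space (n + degree q + 1) (n + degree q - g)"
proof (rule equalityI; rule subsetI)
  have qK: "poly q t \<in> K" "poly q t \<noteq> 0" using polyP[OF q(1)] PK poly_nz[OF q] by auto
  {
    fix z assume z: "z \<in> riemann_roch_space k K (big_divisor q n)"
    hence zK: "z \<in> K" by (simp add: riemann_roch_space_def)
    have zv: "- big_divisor q n x \<le> valuation x z" if "z \<noteq> 0" "x \<in> closed_points k K" for x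
      using z that by (auto simp: riemann_roch_space_def)
    have zqK: "z * poly q t \<in> K" using zK qK subfield_closed(4)[OF K] by blast
    have reg: "z * poly q t \<in> x" if x: "x \<in> closed_points k K" "t \<in> x" for x
    proof (cases "z = 0")
      case False
      have "valuation x (z * poly q t) = valuation x z + valuation x (poly q t)"
        by (rule valuation_mult[OF K x(1) zK False qK])
      thus ?thesis using zv[OF False x(1)] x valuation_nonneg_iff(1)[OF K x(1) zqK] False qK by (simp add: big_divisor_def)
    qed (use subring_0[OF cp_ring[OF K x(1)]] in simp)
    obtain p r where pr: "p \<in> poly_over k" "r \<in> poly_over k" "z * poly q t = poly p t + poly r t * y"
      using regular_functions[OF zqK reg] by blast
    \<comment> \<open>One infinite point is enough to read off both degree bounds.\<close>
    obtain x where x: "x \<in> closed_points k K" "t \<notin> x" using exists_infinite_point by blast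
    define e where "e = - valuation x t"
    have e: "e > 0" using valuation_t_infinite[OF x] by (simp add: e_def)
    have bound: "- e * int (n + degree q) \<le> valuation x (poly p t + poly r t * y)" if "z \<noteq> 0"
    proof -
      have "valuation x (z * poly q t) = valuation x z - e * int (degree q)"
        using valuation_mult[OF K x(1) zK that qK] valuation_poly_infinite[OF x q] by (simp add: e_def)
      moreover have "- e * int n \<le> valuation x z" using zv[OF that x(1)] x by (simp add: big_divisor_def e_def mult.commute)
      ultimately show ?thesis using pr(3) by (simp add: algebra_simps)
    qed
    have "degree p \<le> n + degree q \<and> (r \<noteq> 0 \<longrightarrow> degree r + g < n + degree q)" if z0: "z \<noteq> 0"
    proof -
      have dp: "degree p \<le> n + degree q" if "- e * int (n + degree q) \<le> int (degree p) * valuation x t"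
      proof -
        have "e * int (degree p) \<le> e * int (n + degree q)" using that by (simp add: e_def mult.commute)
        thus ?thesis using e by simp
      qed
      have dr: "degree r + g < n + degree q"
        if "- e * int (n + degree q) \<le> valuation x (poly r t * y)"
          "2 * valuation x (poly r t * y) = int (2 * degree r + 2 * g + 1) * valuation x t"
      proof -
        have "e * int (2 * degree r + 2 * g + 1) = - (2 * valuation x (poly r t * y))"
          unfolding that(2) e_def by (metis mult.commute mult_minus_left)
        moreover have "e * int (2 * (n + degree q)) = 2 * (e * int (n + degree q))" by simp
        moreover have "- (e * int (n + degree q)) \<le> valuation x (poly r t * y)" using that(1) by simp
        ultimately have "e * int (2 * degree r + 2 * g + 1) \<le> e * int (2 * (n + degree q))" by linarith
        hence "2 * degree r + 2 * g + 1 \<le> 2 * (n + degree q)" using e by (simp only: mult_le_cancel_left_pos of_nat_le_iff)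
        thus ?thesis by simp
      qed
      consider "r = 0" | "p = 0" "r \<noteq> 0" | "p \<noteq> 0" "r \<noteq> 0" by blast
      thus ?thesis
      proof cases
        case 1
        hence "p \<noteq> 0" using pr(3) z0 qK by auto
        thus ?thesis using dp bound[OF z0] 1 valuation_poly_infinite[OF x pr(1)] by simp
      next
        case 2
        have "2 * valuation x (poly r t * y) = int (2 * degree r + 2 * g + 1) * valuation x t"
          \<comment> \<open>The third claim does not involve p, so the polynomial 1 stands in for
            the vanishing p.\<close>
          by (rule valuation_sum_infinite(3)[OF x poly_over_1[OF kr] one_neq_zero pr(2) 2(2)])
        thus ?thesis using dr bound[OF z0] 2 by simp
      next
        case 3
        note v = valuation_sum_infinite[OF x pr(1) 3(1) pr(2) 3(2)]
        show ?thesis using dp dr[OF _ v(3)] bound[OF z0] unfolding v(2) by simp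
      qed
    qed
    hence "(\<forall>i\<ge>n + degree q + 1. coeff p i = 0) \<and> (\<forall>i\<ge>n + degree q - g. coeff r i = 0)" if "z \<noteq> 0"
      using that by (cases "r = 0") (auto intro!: coeff_eq_0)
    hence "poly p t + poly r t * y \<in> poly_space (n + degree q + 1) (n + degree q - g)" if "z \<noteq> 0"
      using pr that unfolding poly_space_def by blast
    moreover have "z = inverse (poly q t) * (poly p t + poly r t * y)" using pr(3) qK by (simp add: field_simps flip: pr(3))
    moreover have "0 \<in> poly_space (n + degree q + 1) (n + degree q - g)"
      unfolding poly_space_def using poly_over_0[OF kr] by (intro CollectI exI[of _ 0]) auto
    ultimately show "z \<in> (*) (inverse (poly q t)) ` poly_space (n + degree q + 1) (n + degree q - g)"
      by (cases "z = 0") (auto simp: image_iff intro: bexI[of _ 0])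
  }
  {
    fix z assume "z \<in> (*) (inverse (poly q t)) ` poly_space (n + degree q + 1) (n + degree q - g)"
    then obtain p r where pr: "z = inverse (poly q t) * (poly p t + poly r t * y)" "p \<in> poly_over k" "r \<in> poly_over k"
      "\<forall>i\<ge>n + degree q + 1. coeff p i = 0" "\<forall>i\<ge>n + degree q - g. coeff r i = 0" by (auto simp: poly_space_def)
    define w where "w = poly p t + poly r t * y"
    have K1: "poly p t \<in> K" "poly r t \<in> K" using polyP pr PK by blast+
    have wK: "w \<in> K" unfolding w_def using K1 yK by (intro subfield_closed(3,4)[OF K])
    have dp: "degree p \<le> n + degree q" using pr(4) by (intro degree_le) auto
    have dr: "degree r + g < n + degree q" if "r \<noteq> 0"
    proof (rule ccontr)
      assume "\<not> ?thesis"
      hence "coeff r (degree r) = 0" using pr(5) by auto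
      thus False using that by simp
    qed
    have zK: "z \<in> K" using wK qK pr(1) by (auto simp: w_def intro!: subfield_closed(4,9)[OF K])
    have "- big_divisor q n x \<le> valuation x z" if z0: "z \<noteq> 0" and x: "x \<in> closed_points k K" for x
    proof -
      have w0: "w \<noteq> 0" using z0 pr(1) by (auto simp: w_def)
      have vz: "valuation x z = valuation x w - valuation x (poly q t)"
        using valuation_divide[OF K x wK w0 qK] pr(1) by (simp add: w_def divide_inverse mult.commute)
      show ?thesis
      proof (cases "t \<in> x")
        case True
        have "w \<in> x" unfolding w_def using poly_in_point[OF x True] pr y_in_point[OF x True]
          by (intro subring_add[OF cp_ring[OF K x]] subring_mult[OF cp_ring[OF K x]]) auto
        hence "0 \<le> valuation x w" using valuation_nonneg_iff(1)[OF K x wK w0] by blast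
        thus ?thesis using vz x True by (simp add: big_divisor_def)
      next
        case False
        define e where "e = - valuation x t"
        have e: "e > 0" using valuation_t_infinite[OF x False] by (simp add: e_def)
        have ep: "- e * int (n + degree q) \<le> int (degree p) * valuation x t"
          using mult_left_mono[of "int (degree p)" "int (n + degree q)" e] dp e by (simp add: e_def algebra_simps)
        have er: "- e * int (n + degree q) \<le> v" if "r \<noteq> 0" "2 * v = int (2 * degree r + 2 * g + 1) * valuation x t" for v
        proof -
          have "e * int (2 * degree r + 2 * g + 1) \<le> e * int (2 * (n + degree q))"
            using dr[OF that(1)] e by (intro mult_left_mono) auto
          moreover have "e * int (2 * degree r + 2 * g + 1) = - (2 * v)"
            unfolding that(2) e_def by (metis mult.commute mult_minus_left)
          moreover have "e * int (2 * (n + degree q)) = 2 * (e * int (n + degree q))" by simp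
          ultimately have "- (e * int (n + degree q)) \<le> v" by linarith
          thus ?thesis by simp
        qed
        have "- e * int (n + degree q) \<le> valuation x w"
        proof -
          consider "r = 0" | "p = 0" "r \<noteq> 0" | "p \<noteq> 0" "r \<noteq> 0" by blast
          thus ?thesis
          proof cases
            case 1
            hence "p \<noteq> 0" using w0 by (auto simp: w_def)
            thus ?thesis using ep 1 valuation_poly_infinite[OF x False pr(2)] by (simp add: w_def)
          next
            case 2
            thus ?thesis using er[OF 2(2) valuation_sum_infinite(3)[OF x False poly_over_1[OF kr] one_neq_zero pr(3) 2(2)]]
              by (simp add: w_def)
          next
            case 3
            note v = valuation_sum_infinite[OF x False pr(2) 3(1) pr(3) 3(2)]
            show ?thesis using ep er[OF 3(2) v(3)] unfolding w_def v(2) by simp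
          qed
        qed
        thus ?thesis using vz x False valuation_poly_infinite[OF x False q] by (simp add: big_divisor_def e_def algebra_simps)
      qed
    qed
    thus "z \<in> riemann_roch_space k K (big_divisor q n)" using zK by (auto simp: riemann_roch_space_def)
  }
qed

section \<open>Cofinality and the value of the genus\<close>

lemma residue_basis: "x \<in> closed_points k K \<Longrightarrow> \<exists>N u. basis_mod k (maximal_ideal x) x {..<N::nat} u"
  using finite_residue by metis

text \<open>At a finite point x of D, a polynomial vanishing at x is raised to the power D x; q is
  the product of these. Points at infinity are handled by n.\<close>

lemma big_divisor_dominates:
  assumes D: "D \<in> divisors k K"
  obtains q n where "q \<in> poly_over k" "q \<noteq> 0" "g \<le> n" "\<And>x. D x \<le> big_divisor q n x"
proof -
  define S where "S = {x. D x \<noteq> 0}"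
  have S: "finite S" "S \<subseteq> closed_points k K" using D by (auto simp: S_def divisors_def)
  have "\<exists>q. q \<in> poly_over k \<and> q \<noteq> 0 \<and> (x \<in> S \<longrightarrow> t \<in> x \<longrightarrow> poly q t \<in> maximal_ideal x)" for x
  proof (cases "x \<in> S \<and> t \<in> x")
    case True
    hence x: "x \<in> closed_points k K" "t \<in> x" using S(2) by auto
    obtain q where "q \<in> poly_over k" "q \<noteq> 0" "poly q t \<in> maximal_ideal x"
      using exists_vanishing_poly[OF x] .
    thus ?thesis by blast
  next
    case False
    thus ?thesis using poly_over_1[OF kr] by (intro exI[of _ 1]) auto
  qed
  then obtain Q where Q: "\<And>x. Q x \<in> poly_over k" "\<And>x. Q x \<noteq> 0"
    "\<And>x. x \<in> S \<Longrightarrow> t \<in> x \<Longrightarrow> poly (Q x) t \<in> maximal_ideal x" by metis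
  define q where "q = (\<Prod>x\<in>S. Q x ^ nat (D x))"
  \<comment> \<open>Every pole of t has order at least 1, so n times the poles dominates D at
    infinity; the summand g secures \<open>g \<le> n\<close>.\<close>
  define n where "n = (\<Sum>x\<in>S. nat (D x)) + g"
  have q: "q \<in> poly_over k" "q \<noteq> 0" unfolding q_def using Q S by (auto intro!: poly_over_prod poly_over_power kr)
  have "D x \<le> big_divisor q n x" for x
  proof (cases "x \<in> S")
    case False
    hence "D x = 0" by (simp add: S_def)
    thus ?thesis using valuation_poly_nonneg[OF _ _ q, of x] valuation_t_infinite[of x] by (auto simp: big_divisor_def mult_nonneg_nonpos)
  next
    case True
    hence x: "x \<in> closed_points k K" using S by auto
    show ?thesis
    proof (cases "t \<in> x")
      case tx: True
      define r where "r = (\<Prod>z\<in>S-{x}. Q z ^ nat (D z))"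
      have r: "r \<in> poly_over k" "r \<noteq> 0" unfolding r_def using Q S by (auto intro!: poly_over_prod poly_over_power kr)
      have qr: "q = Q x ^ nat (D x) * r" unfolding q_def r_def using S True by (intro prod.remove) auto
      have QK: "poly (Q x) t \<in> K" "poly (Q x) t \<noteq> 0" using polyP[OF Q(1)[of x]] PK poly_nz[OF Q(1,2)] by auto
      have rK: "poly r t \<in> K" "poly r t \<noteq> 0" using polyP[OF r(1)] PK poly_nz[OF r] by auto
      have "valuation x (poly q t) = int (nat (D x)) * valuation x (poly (Q x) t) + valuation x (poly r t)"
        using valuation_mult[OF K x _ _ rK, of "poly (Q x) t ^ nat (D x)"] valuation_power[OF K x QK]
          subfield_closed(7)[OF K QK(1)] QK(2) by (simp add: qr)
      moreover have "0 \<le> valuation x (poly r t)" by (rule valuation_poly_nonneg[OF x tx r])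
      moreover have "1 \<le> valuation x (poly (Q x) t)" using valuation_nonneg_iff(2)[OF K x QK] Q(3)[OF True tx] by simp
      hence "int (nat (D x)) * 1 \<le> int (nat (D x)) * valuation x (poly (Q x) t)" by (intro mult_left_mono) auto
      moreover have "D x \<le> int (nat (D x)) * 1" by simp
      moreover have "big_divisor q n x = valuation x (poly q t)" using x tx by (simp add: big_divisor_def)
      ultimately show ?thesis by linarith
    next
      case False
      have "nat (D x) \<le> (\<Sum>x\<in>S. nat (D x))" using member_le_sum[OF True, of "\<lambda>x. nat (D x)"] S by auto
      hence "D x \<le> int n" unfolding n_def by linarith
      moreover have "int n * 1 \<le> int n * (- valuation x t)" using valuation_t_infinite[OF x False] by (intro mult_left_mono) auto
      ultimately show ?thesis using x False by (simp add: big_divisor_def)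
    qed
  qed
  thus ?thesis using that[OF q, of n] by (simp add: n_def)
qed

lemma dim_big_divisor:
  assumes q: "q \<in> poly_over k" "q \<noteq> 0" and n: "g \<le> n"
  obtains u :: "nat + nat \<Rightarrow> 'a" where
    "basis_mod k {0} (riemann_roch_space k K (big_divisor q n)) ({..<n + degree q + 1} <+> {..<n + degree q - g}) u"
  using basis_poly_space[of "inverse (poly q t)" "n + degree q + 1" "n + degree q - g"] poly_nz[OF q]
    riemann_roch_big_divisor[OF q n] that by fastforce

text \<open>On the family, deg <= 2 (n + deg q) and l = 2 (n + deg q) + 1 - g, so deg - l + 1 <= g,
  and monotonicity carries the bound to every D. The value g is attained for q = 1 and n = g, where
  l = g + 1 and the degree is 2g.\<close>

theorem genus_eq: "genus k K = int g"
proof -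
  let ?d = "\<lambda>D. divisor_degree k D - int ((ring.dim \<Omega> over k) (riemann_roch_space k K D)) + 1"
  note sub = k_subspace_riemann_roch[OF K kK]
  have upper: "?d D \<le> int g" if D: "D \<in> divisors k K" for D
  proof -
    obtain q n where q: "q \<in> poly_over k" "q \<noteq> 0" "g \<le> n" "\<And>x. D x \<le> big_divisor q n x"
      using big_divisor_dominates[OF D] by blast
    let ?E = "big_divisor q n"
    obtain u :: "nat + nat \<Rightarrow> 'a" where u: "basis_mod k {0} (riemann_roch_space k K ?E) ({..<n + degree q + 1} <+> {..<n + degree q - g}) u"
      using dim_big_divisor[OF q(1-3)] .
    define S where "S = {x. D x \<noteq> 0} \<union> {x. ?E x \<noteq> 0}"
    have S: "finite S" "S \<subseteq> closed_points k K" using D big_divisor[OF q(1,2), of n] by (auto simp: S_def divisors_def)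
    have cd: "divisor_degree k D \<le> divisor_degree k ?E"
      "codim_le k (riemann_roch_space k K ?E) (riemann_roch_space k K D) (nat (divisor_degree k ?E - divisor_degree k D))"
      using codim_divisors[OF k K kK residue_basis S, of ?E D] q(4) by (auto simp: S_def)
    have "riemann_roch_space k K D \<subseteq> riemann_roch_space k K ?E"
    proof
      fix z assume z: "z \<in> riemann_roch_space k K D"
      have "- ?E x \<le> valuation x z" if "z \<noteq> 0" "x \<in> closed_points k K" for x
        using z that q(4)[of x] by (force simp: riemann_roch_space_def)
      thus "z \<in> riemann_roch_space k K ?E" using z by (auto simp: riemann_roch_space_def)
    qed
    then obtain r v where v: "basis_mod k {0} (riemann_roch_space k K D) {..<r::nat} v"
      using basis_mod_subset[OF k k_subspace_0[OF k] u] by metis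
    have "card ({..<n + degree q + 1} <+> {..<n + degree q - g}) \<le> nat (divisor_degree k ?E - divisor_degree k D) + card {..<r}"
      by (rule codim_le_basis[OF k k_subspace_0[OF k] cd(2) u v])
    hence "2 * int (n + degree q) + 1 - int g \<le> divisor_degree k ?E - divisor_degree k D + int r"
      using cd(1) q(3) by (simp add: card_Plus)
    moreover have "(ring.dim \<Omega> over k) (riemann_roch_space k K D) = r" using dim_ambient[OF k sub v] by simp
    ultimately show ?thesis using big_divisor(3)[OF q(1,2), of n] by simp
  qed
  have attained: "\<exists>D\<in>divisors k K. int g = ?d D"
  proof
    let ?E = "big_divisor 1 g"
    have o: "1 \<in> poly_over k" "(1::'a poly) \<noteq> 0" using poly_over_1[OF kr] by auto
    show E: "?E \<in> divisors k K" using big_divisor[OF o, of g] by (auto simp: divisors_def)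
    obtain u :: "nat + nat \<Rightarrow> 'a" where u: "basis_mod k {0} (riemann_roch_space k K ?E) ({..<g + degree (1::'a poly) + 1} <+> {..<g + degree (1::'a poly) - g}) u"
      using dim_big_divisor[OF o order.refl] .
    have dim: "(ring.dim \<Omega> over k) (riemann_roch_space k K ?E) = g + 1" using dim_ambient[OF k sub u] by (simp add: card_Plus)
    obtain x where x: "x \<in> closed_points k K" "t \<notin> x" using exists_infinite_point by blast
    obtain N where N: "point_degree k x = N" "N > 0" using point_degree_pos[OF x(1)] by metis
    \<comment> \<open>An even negative v(t) is at most -2, so a single infinite point already
      supplies degree 2g.\<close>
    have "even (int (2 * g + 1) * valuation x t)" using valuation_y_infinite[OF x] by (metis dvd_triv_left)
    hence "even (valuation x t)" by simp
    hence vt: "2 \<le> - valuation x t" using valuation_t_infinite[OF x] by presburger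
    have "int g * 2 * 1 \<le> ?E x * int (point_degree k x)"
      using x vt N mult_left_mono[OF vt, of "int g"] by (intro mult_mono) (auto simp: big_divisor_def)
    also have "\<dots> \<le> (\<Sum>x\<in>insert x {x. ?E x \<noteq> 0}. ?E x * int (point_degree k x))"
    proof (rule member_le_sum)
      fix z assume "z \<in> insert x {x. ?E x \<noteq> 0} - {x}"
      hence z: "z \<in> closed_points k K" using big_divisor(2)[OF o, of g] by auto
      have "0 \<le> ?E z" using z valuation_poly_nonneg[OF z _ o] valuation_t_infinite[OF z]
        by (auto simp: big_divisor_def mult_nonneg_nonpos)
      thus "0 \<le> ?E z * int (point_degree k z)" by simp
    qed (use big_divisor(1)[OF o, of g] in auto)
    also have "\<dots> = divisor_degree k ?E" by (rule divisor_degree_superset[symmetric]) (use big_divisor(1)[OF o, of g] in auto)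
    finally show "int g = ?d ?E" using big_divisor(3)[OF o, of g] dim by simp
  qed
  show ?thesis unfolding genus_def
    by (rule Greatest_equality) (use attained upper in auto)
qed

end

section \<open>Galois groups\<close>

context fixes L F :: "'a::field_char_0 set" assumes L: "subfield L \<Omega>" and F: "subfield F \<Omega>" and FL: "F \<subseteq> L"
begin
lemma gal_iff: "\<sigma> \<in> carrier (gal L F) \<longleftrightarrow> \<sigma> \<in> extensional L \<and> bij_betw \<sigma> L L \<and>
   (\<forall>a\<in>L. \<forall>b\<in>L. \<sigma> (a + b) = \<sigma> a + \<sigma> b \<and> \<sigma> (a * b) = \<sigma> a * \<sigma> b) \<and> \<sigma> 1 = 1 \<and> (\<forall>a\<in>F. \<sigma> a = a)"
  by (auto simp: gal_def ring_iso_def ring_hom_def bij_betw_def)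
context fixes \<sigma> assumes s: "\<sigma> \<in> carrier (gal L F)"
begin
lemma gal_closed: "a \<in> L \<Longrightarrow> \<sigma> a \<in> L" and gal_add: "a \<in> L \<Longrightarrow> b \<in> L \<Longrightarrow> \<sigma> (a + b) = \<sigma> a + \<sigma> b"
  and gal_mult: "a \<in> L \<Longrightarrow> b \<in> L \<Longrightarrow> \<sigma> (a * b) = \<sigma> a * \<sigma> b" and gal_1: "\<sigma> 1 = 1"
  and gal_fix: "a \<in> F \<Longrightarrow> \<sigma> a = a" and gal_inj: "inj_on \<sigma> L" and gal_surj: "\<sigma> ` L = L"
  using s unfolding gal_iff by (auto simp: bij_betw_def)
lemma gal_0: "\<sigma> 0 = 0" using gal_fix[OF subfield_closed(1)[OF F]] .
lemma gal_uminus: "a \<in> L \<Longrightarrow> \<sigma> (- a) = - \<sigma> a"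
  using gal_add[of a "- a"] gal_0 subfield_closed(5)[OF L] by (simp add: eq_neg_iff_add_eq_0 add.commute)
lemma gal_diff: "a \<in> L \<Longrightarrow> b \<in> L \<Longrightarrow> \<sigma> (a - b) = \<sigma> a - \<sigma> b"
  using gal_add[of a "- b"] gal_uminus subfield_closed(5)[OF L] by simp
lemma gal_power: "a \<in> L \<Longrightarrow> \<sigma> (a ^ n) = \<sigma> a ^ n"
  by (induction n) (auto simp: gal_1 gal_mult subfield_closed(7)[OF L])
lemma gal_sum: "(\<And>i. i \<in> I \<Longrightarrow> f i \<in> L) \<Longrightarrow> \<sigma> (\<Sum>i\<in>I. f i) = (\<Sum>i\<in>I. \<sigma> (f i))"
  by (induction I rule: infinite_finite_induct) (auto simp: gal_0 gal_add subfield_sum[OF L])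
lemma gal_prod: "(\<And>i. i \<in> I \<Longrightarrow> f i \<in> L) \<Longrightarrow> \<sigma> (\<Prod>i\<in>I. f i) = (\<Prod>i\<in>I. \<sigma> (f i))"
  by (induction I rule: infinite_finite_induct) (auto simp: gal_1 gal_mult subring_prod[OF subfield_subring[OF L]])
lemma gal_inverse: "a \<in> L \<Longrightarrow> \<sigma> (inverse a) = inverse (\<sigma> a)"
proof (cases "a = 0")
  case False assume a: "a \<in> L"
  have "\<sigma> a * \<sigma> (inverse a) = 1" using gal_mult[OF a subfield_inverse[OF L a]] False gal_1 by simp
  thus ?thesis by (simp add: inverse_unique)
qed (simp add: gal_0)
lemma gal_divide: "a \<in> L \<Longrightarrow> b \<in> L \<Longrightarrow> \<sigma> (a / b) = \<sigma> a / \<sigma> b"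
  using gal_mult[of a "inverse b"] gal_inverse subfield_inverse[OF L] by (simp add: divide_inverse)
lemma gal_poly: "p \<in> poly_over F \<Longrightarrow> a \<in> L \<Longrightarrow> \<sigma> (poly p a) = poly p (\<sigma> a)"
  unfolding poly_altdef using FL
  by (subst gal_sum) (auto simp: gal_mult gal_power gal_fix poly_overD subfield_closed(4,7)[OF L] subset_iff intro!: subfield_closed(4,7)[OF L])
lemma gal_restrict_inv: "restrict (inv_into L \<sigma>) L \<in> carrier (gal L F)"
proof -
  let ?i = "inv_into L \<sigma>"
  have i: "\<sigma> (?i a) = a" "?i a \<in> L" if "a \<in> L" for a
    using that gal_surj by (auto simp: f_inv_into_f inv_into_into)
  have eqI: "a = b" if "a \<in> L" "b \<in> L" "\<sigma> a = \<sigma> b" for a b using gal_inj that by (auto simp: inj_on_def)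
  have "bij_betw ?i L L" using s unfolding gal_iff by (simp add: bij_betw_inv_into)
  moreover have "?i (a + b) = ?i a + ?i b" "?i (a * b) = ?i a * ?i b" if ab: "a \<in> L" "b \<in> L" for a b
    by (rule eqI; simp add: ab i gal_add gal_mult subfield_closed(3,4)[OF L])+
  moreover have "?i a = a" if "a \<in> F" for a
  proof -
    have "a \<in> L" using that FL by blast
    thus ?thesis by (rule eqI[rotated]; simp add: i gal_fix that)
  qed
  moreover have "?i 1 = 1" by (rule eqI) (simp_all add: i gal_1 subfield_closed(2)[OF L])
  moreover have "bij_betw (restrict ?i L) L L" using \<open>bij_betw ?i L L\<close> by (simp cong: bij_betw_cong)
  ultimately show ?thesis unfolding gal_iff
    using subfield_closed(2,3,4)[OF L] FL by (simp add: subset_iff)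
qed
end
lemma gal_compose:
  assumes s: "\<sigma> \<in> carrier (gal L F)" and r: "\<tau> \<in> carrier (gal L F)"
  shows "compose L \<sigma> \<tau> \<in> carrier (gal L F)"
proof -
  have "bij_betw (compose L \<sigma> \<tau>) L L"
    using s r unfolding gal_iff by (auto intro!: bij_betw_compose)
  thus ?thesis unfolding gal_iff
    using gal_closed[OF r] gal_add[OF s] gal_add[OF r] gal_mult[OF s] gal_mult[OF r] gal_1[OF s] gal_1[OF r]
      gal_fix[OF s] gal_fix[OF r] subfield_closed(2,3,4)[OF L] FL by (auto simp: compose_def subset_iff)
qed
lemma gal_id: "(\<lambda>a\<in>L. a) \<in> carrier (gal L F)"
  unfolding gal_iff using subfield_closed(2,3,4)[OF L] FL by (auto simp: bij_betw_def inj_on_def subset_iff)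
end

section \<open>Extension of isomorphisms\<close>

text \<open>An isomorphism between subfields of \<open>L\<close> over \<open>F\<close> is represented by its graph.\<close>

definition partial_iso :: "'a::field_char_0 set \<Rightarrow> 'a set \<Rightarrow> ('a \<times> 'a) set \<Rightarrow> bool"
  where "partial_iso L F R \<longleftrightarrow> R \<subseteq> L \<times> L \<and> (\<forall>a\<in>F. (a, a) \<in> R) \<and>
    (\<forall>u v u' v'. (u, v) \<in> R \<longrightarrow> (u', v') \<in> R \<longrightarrow> (u + u', v + v') \<in> R \<and> (u * u', v * v') \<in> R) \<and>
    (\<forall>u v. (u, v) \<in> R \<longrightarrow> (- u, - v) \<in> R \<and> (inverse u, inverse v) \<in> R \<and> (u = 0 \<longleftrightarrow> v = 0))"

text \<open>The isomorphism applied to coefficients, again as a graph.\<close>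

definition lift_poly_rel :: "('a::field_char_0 \<times> 'a) set \<Rightarrow> ('a poly \<times> 'a poly) set"
  where "lift_poly_rel R = {(p, q). \<forall>i. (coeff p i, coeff q i) \<in> R}"

locale piso =
  fixes L F :: "'a::field_char_0 set" and R
  assumes F: "subfield F \<Omega>" and L_eq: "L = algebraic_elements F" and R: "partial_iso L F R"
begin
lemma L: "subfield L \<Omega>" unfolding L_eq by (rule subfield_algebraic_elements[OF F])
lemma FL: "F \<subseteq> L" unfolding L_eq by (rule subset_algebraic_elements[OF F])
lemma R_L: "(u, v) \<in> R \<Longrightarrow> u \<in> L \<and> v \<in> L" and R_F: "a \<in> F \<Longrightarrow> (a, a) \<in> R"
  and R_add: "(u, v) \<in> R \<Longrightarrow> (u', v') \<in> R \<Longrightarrow> (u + u', v + v') \<in> R"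
  and R_mult: "(u, v) \<in> R \<Longrightarrow> (u', v') \<in> R \<Longrightarrow> (u * u', v * v') \<in> R"
  and R_uminus: "(u, v) \<in> R \<Longrightarrow> (- u, - v) \<in> R" and R_inverse: "(u, v) \<in> R \<Longrightarrow> (inverse u, inverse v) \<in> R"
  and R_zero: "(u, v) \<in> R \<Longrightarrow> u = 0 \<longleftrightarrow> v = 0"
  using R unfolding partial_iso_def by blast+
lemma R_0: "(0, 0) \<in> R" and R_1: "(1, 1) \<in> R" using R_F subfield_closed(1,2)[OF F] by auto
lemma R_diff: "(u, v) \<in> R \<Longrightarrow> (u', v') \<in> R \<Longrightarrow> (u - u', v - v') \<in> R"
  using R_add[of u v "- u'" "- v'"] R_uminus by simp
lemma R_unique: "(u, v) \<in> R \<Longrightarrow> (u, v') \<in> R \<Longrightarrow> v = v'"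
  using R_zero[OF R_diff[of u v u v']] by simp
lemma R_sum: "(\<And>i. i \<in> I \<Longrightarrow> (f i, h i) \<in> R) \<Longrightarrow> (sum f I, sum h I) \<in> R"
  by (induction I rule: infinite_finite_induct) (auto intro: R_0 R_add)
definition E where "E = Domain R"
lemma E: "subfield E \<Omega>"
  by (rule ambient_subfieldI) (auto simp: E_def intro: R_1 R_uminus R_inverse R_add R_mult)
lemma FE: "F \<subseteq> E" using R_F by (auto simp: E_def)
abbreviation "Q \<equiv> lift_poly_rel R"
lemma Q_iff: "(p, q) \<in> Q \<longleftrightarrow> (\<forall>i. (coeff p i, coeff q i) \<in> R)" by (simp add: lift_poly_rel_def)
lemma Q_over: "(p, q) \<in> Q \<Longrightarrow> p \<in> poly_over E" by (auto simp: Q_iff poly_over_def E_def)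
lemma Q_add: "(p, q) \<in> Q \<Longrightarrow> (p', q') \<in> Q \<Longrightarrow> (p + p', q + q') \<in> Q" by (auto simp: Q_iff R_add)
lemma Q_diff: "(p, q) \<in> Q \<Longrightarrow> (p', q') \<in> Q \<Longrightarrow> (p - p', q - q') \<in> Q" by (auto simp: Q_iff R_diff)
lemma Q_uminus: "(p, q) \<in> Q \<Longrightarrow> (- p, - q) \<in> Q" by (auto simp: Q_iff R_uminus)
lemma Q_mult: "(p, q) \<in> Q \<Longrightarrow> (p', q') \<in> Q \<Longrightarrow> (p * p', q * q') \<in> Q"
  by (auto simp: Q_iff coeff_mult intro!: R_sum R_mult)
lemma Q_const: "(u, v) \<in> R \<Longrightarrow> ([:u:], [:v:]) \<in> Q" by (auto simp: Q_iff coeff_pCons R_0 split: nat.splits)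
lemma Q_X: "([:0, 1:], [:0, 1:]) \<in> Q" by (auto simp: Q_iff coeff_pCons R_0 R_1 split: nat.splits)
lemma Q_F: "p \<in> poly_over F \<Longrightarrow> (p, p) \<in> Q" by (auto simp: Q_iff poly_over_def R_F)
lemma Q_unique: "(p, q) \<in> Q \<Longrightarrow> (p, q') \<in> Q \<Longrightarrow> q = q'" by (rule poly_eqI) (auto simp: Q_iff intro: R_unique)
lemma Q_degree: "(p, q) \<in> Q \<Longrightarrow> degree p = degree q"
  unfolding Q_iff using R_zero by (intro antisym degree_le) (metis coeff_eq_0)+
lemma Q_lift: assumes "p \<in> poly_over E" obtains q where "(p, q) \<in> Q"
proof -
  have "\<forall>i. \<exists>v. (coeff p i, v) \<in> R" using assms by (auto simp: poly_over_def E_def)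
  then obtain h where h: "\<And>i. (coeff p i, h i) \<in> R" by metis
  define q where "q = (\<Sum>i\<le>degree p. monom (h i) i)"
  have "coeff q i = (if i \<le> degree p then h i else 0)" for i by (auto simp: q_def coeff_sum coeff_monom)
  hence "(p, q) \<in> Q" using h R_0 by (auto simp: Q_iff coeff_eq_0)
  thus ?thesis using that by blast
qed

text \<open>A polynomial over E that vanishes at b is a multiple of the minimal polynomial m, so its
  transport is a multiple of m' and vanishes at b'. Hence evaluation at b and at b' defines a
  single-valued relation on E[b], which is a field since b is algebraic.\<close>

lemma extend:
  assumes b: "b \<in> L" and m: "(m, m') \<in> Q" "m \<noteq> 0" "poly m b = 0"
    "\<And>p. p \<in> poly_over E \<Longrightarrow> p \<noteq> 0 \<Longrightarrow> poly p b = 0 \<Longrightarrow> degree m \<le> degree p"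
    and b': "poly m' b' = 0"
  shows "\<exists>S. partial_iso L F S \<and> R \<subseteq> S \<and> (b, b') \<in> S"
proof -
  define S where "S = {(poly p b, poly q b') | p q. (p, q) \<in> Q}"
  note Er = subfield_subring[OF E]
  have SI: "(poly p b, poly q b') \<in> S" if "(p, q) \<in> Q" for p q using that by (auto simp: S_def)
  have zero: "poly q b' = 0" if pq: "(p, q) \<in> Q" "poly p b = 0" for p q
  proof -
    obtain s r where sr: "s \<in> poly_over E" "r \<in> poly_over E" "p = s * m + r" "r = 0 \<or> degree r < degree m"
      using poly_over_division[OF E Q_over[OF m(1)] m(2) Q_over[OF pq(1)]] .
    have "poly r b = 0" using sr(3) pq(2) m(3) by simp
    hence r0: "r = 0" using m(4)[OF sr(2)] sr(4) by (metis leD)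
    obtain s' where s': "(s, s') \<in> Q" using Q_lift[OF sr(1)] .
    have "(p, s' * m') \<in> Q" using Q_mult[OF s' m(1)] sr(3) r0 by simp
    hence "q = s' * m'" using Q_unique pq(1) by blast
    thus ?thesis using b' by simp
  qed
  \<comment> \<open>Polynomials over F are transported to themselves, so b' is a root of any
    F-polynomial of b.\<close>
  have b'L: "b' \<in> L"
  proof -
    obtain f where f: "f \<in> poly_over F" "f \<noteq> 0" "poly f b = 0" using b algebraic_iff[OF F] by (auto simp: L_eq)
    thus ?thesis using zero[OF Q_F] algebraic_iff[OF F] by (auto simp: L_eq)
  qed
  have EL: "E \<subseteq> L" using R_L by (auto simp: E_def)
  \<comment> \<open>The minimal polynomial of z over F has nonzero constant term c, so 1/z is a
    polynomial in z divided by -c.\<close>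
  have inv: "\<exists>s\<in>poly_over E. poly s b = inverse (poly p b)" if p: "p \<in> poly_over E" "poly p b \<noteq> 0" for p
  proof -
    define z where "z = poly p b"
    have zL: "z \<in> L" unfolding z_def by (rule poly_over_in_subring[OF subfield_subring[OF L] EL p(1) b])
    obtain f where f: "f \<in> poly_over F" "f \<noteq> 0" "poly f z \<in> {0}" using zL algebraic_iff[OF F] by (auto simp: L_eq)
    obtain w where w: "w \<in> poly_over F" "w \<noteq> 0" "poly w z \<in> {0}"
      "\<And>q. q \<in> poly_over F \<Longrightarrow> q \<noteq> 0 \<Longrightarrow> poly q z \<in> {0} \<Longrightarrow> degree w \<le> degree q"
      using exists_minimal_polynomial[OF f] by metis
    obtain c w' where cw: "w = pCons c w'" by (cases w)
    have cF: "c \<in> F" "w' \<in> poly_over F" using w(1) cw poly_over_pCons[OF subfield_subring[OF F]] by auto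
    have c0: "c \<noteq> 0"
    proof
      assume "c = 0"
      hence "w' \<noteq> 0" "poly w' z \<in> {0}" using w cw p by (auto simp: z_def)
      hence "degree w \<le> degree w'" using w(4) cF by blast
      thus False using cw \<open>w' \<noteq> 0\<close> by simp
    qed
    define D where "D = {poly q b | q. q \<in> poly_over E}"
    have D: "subring D \<Omega>" "E \<subseteq> D" unfolding D_def by (rule subring_poly_image[OF Er])+
    have "z \<in> D" using p by (auto simp: z_def D_def)
    hence "poly w' z \<in> D" using poly_over_in_subring[OF D(1) _ cF(2)] FE D(2) by blast
    moreover have "- inverse c \<in> D" using cF FE D(2) by (auto intro!: subfield_closed(5,9)[OF E])
    ultimately have "- inverse c * poly w' z \<in> D" by (intro subring_mult[OF D(1)])
    moreover have "z * (- inverse c * poly w' z) = 1"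
    proof -
      have "z * poly w' z = - c" using w(3) cw by (simp add: eq_neg_iff_add_eq_0 add.commute)
      hence "- inverse c * (z * poly w' z) = 1" using c0 by simp
      thus ?thesis by (simp add: mult_ac)
    qed
    ultimately have "inverse z \<in> D" using inverse_unique by metis
    thus ?thesis unfolding D_def z_def by fastforce
  qed
  \<comment> \<open>A nonzero p(b) has an inverse s(b) in E[b]; the relation s p - 1 is transported,
    so q(b') is invertible too.\<close>
  have zero': "poly p b = 0" if pq: "(p, q) \<in> Q" "poly q b' = 0" for p q
  proof (rule ccontr)
    assume p0: "poly p b \<noteq> 0"
    obtain s where s: "s \<in> poly_over E" "poly s b = inverse (poly p b)" using inv[OF Q_over[OF pq(1)] p0] by blast
    obtain s' where s': "(s, s') \<in> Q" using Q_lift[OF s(1)] .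
    have "(s * p - [:1:], s' * q - [:1:]) \<in> Q" by (intro Q_diff Q_mult s' pq Q_const R_1)
    moreover have "poly (s * p - [:1:]) b = 0" using s p0 by simp
    ultimately have "poly (s' * q - [:1:]) b' = 0" by (rule zero)
    thus False using pq(2) by simp
  qed
  have "partial_iso L F S" unfolding partial_iso_def
  proof (intro conjI allI impI ballI)
    show "S \<subseteq> L \<times> L"
    proof
      fix w assume "w \<in> S"
      then obtain p q where pq: "w = (poly p b, poly q b')" "(p, q) \<in> Q" by (auto simp: S_def)
      have "q \<in> poly_over L" "p \<in> poly_over L" using pq(2) R_L by (auto simp: Q_iff poly_over_def)
      thus "w \<in> L \<times> L" using pq(1) poly_in_subring[OF subfield_subring[OF L]] b b'L by auto
    qed
    show "(a, a) \<in> S" if "a \<in> F" for a using SI[OF Q_const[OF R_F[OF that]]] by simp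
    fix u v assume "(u, v) \<in> S"
    then obtain p q where pq: "u = poly p b" "v = poly q b'" "(p, q) \<in> Q" by (auto simp: S_def)
    show "(- u, - v) \<in> S" using SI[OF Q_uminus[OF pq(3)]] pq by simp
    show "u = 0 \<longleftrightarrow> v = 0" using zero[OF pq(3)] zero'[OF pq(3)] pq by auto
    show "(inverse u, inverse v) \<in> S"
    proof (cases "u = 0")
      case True
      thus ?thesis using SI[OF Q_const[OF R_0]] zero[OF pq(3)] pq by simp
    next
      case False
      obtain s where s: "s \<in> poly_over E" "poly s b = inverse (poly p b)" using inv[OF Q_over[OF pq(3)]] False pq(1) by blast
      obtain s' where s': "(s, s') \<in> Q" using Q_lift[OF s(1)] .
      have "(s * p - [:1:], s' * q - [:1:]) \<in> Q" by (intro Q_diff Q_mult s' pq Q_const R_1)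
      moreover have "poly (s * p - [:1:]) b = 0" using s False pq(1) by simp
      ultimately have "poly (s' * q - [:1:]) b' = 0" by (rule zero)
      hence "v * poly s' b' = 1" using pq(2) by (simp add: mult.commute)
      hence "poly s' b' = inverse v" by (simp add: inverse_unique)
      thus ?thesis using SI[OF s'] s(2) pq by simp
    qed
    fix u' v' assume "(u', v') \<in> S"
    then obtain p' q' where pq': "u' = poly p' b" "v' = poly q' b'" "(p', q') \<in> Q" by (auto simp: S_def)
    show "(u + u', v + v') \<in> S" "(u * u', v * v') \<in> S"
      using SI[OF Q_add[OF pq(3) pq'(3)]] SI[OF Q_mult[OF pq(3) pq'(3)]] pq pq' by auto
  qed
  moreover have "R \<subseteq> S" using SI[OF Q_const] by auto
  moreover have "(b, b') \<in> S" using SI[OF Q_X] by simp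
  ultimately show ?thesis by blast
qed

lemma exists_minimal:
  assumes b: "b \<in> L"
  obtains m m' where "(m, m') \<in> Q" "m \<noteq> 0" "poly m b = 0" "degree m > 0"
    "\<And>p. p \<in> poly_over E \<Longrightarrow> p \<noteq> 0 \<Longrightarrow> poly p b = 0 \<Longrightarrow> degree m \<le> degree p"
proof -
  obtain f where f: "f \<in> poly_over F" "f \<noteq> 0" "poly f b = 0" using b algebraic_iff[OF F] by (auto simp: L_eq)
  have "f \<in> poly_over E" using f poly_over_mono[OF FE] by blast
  then obtain m where m: "m \<in> poly_over E" "m \<noteq> 0" "poly m b \<in> {0}"
    "\<And>q. q \<in> poly_over E \<Longrightarrow> q \<noteq> 0 \<Longrightarrow> poly q b \<in> {0} \<Longrightarrow> degree m \<le> degree q"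
    using exists_minimal_polynomial[of f E b "{0}"] f by auto
  obtain m' where "(m, m') \<in> Q" using Q_lift[OF m(1)] .
  moreover have "degree m > 0"
  proof (rule ccontr)
    assume "\<not> degree m > 0"
    then obtain c where "m = [:c:]" by (metis degree_eq_zeroE neq0_conv)
    thus False using m by simp
  qed
  ultimately show ?thesis using that m by simp
qed

end

text \<open>Fixed elements of the Galois group lie in F: the minimal polynomial of c has a second
  root c', and the isomorphism c -> c' extends to all algebraic elements by Zorn's lemma.\<close>

lemma gal_moves:
  fixes F :: "'a::field_char_0 set"
  assumes F: "subfield F \<Omega>" and closed: "\<And>p :: 'a poly. degree p > 0 \<Longrightarrow> \<exists>x. poly p x = 0"
    and c: "c \<in> algebraic_elements F" "c \<notin> F"
  shows "\<exists>\<sigma>\<in>carrier (gal (algebraic_elements F) F). \<sigma> c \<noteq> c"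
proof -
  define L where "L = algebraic_elements F"
  have L: "subfield L \<Omega>" and FL: "F \<subseteq> L" unfolding L_def
    by (rule subfield_algebraic_elements[OF F], rule subset_algebraic_elements[OF F])
  have "partial_iso L F ((\<lambda>a. (a, a)) ` F)"
    unfolding partial_iso_def using FL by (auto intro!: subfield_closed[OF F] image_eqI)
  then interpret R0: piso L F "(\<lambda>a. (a, a)) ` F" using F by (simp add: piso_def L_def)
  have E0: "R0.E = F" by (auto simp: R0.E_def)
  obtain m m' where m: "(m, m') \<in> R0.Q" "m \<noteq> 0" "poly m c = 0" "degree m > 0"
    "\<And>p. p \<in> poly_over R0.E \<Longrightarrow> p \<noteq> 0 \<Longrightarrow> poly p c = 0 \<Longrightarrow> degree m \<le> degree p"
    using R0.exists_minimal[of c] c unfolding L_def by blast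
  have mF: "m \<in> poly_over F" using R0.Q_over[OF m(1)] E0 by simp
  have "m' = m" using R0.Q_unique[OF m(1) R0.Q_F[OF mF]] .
  obtain n where n: "m = [:- c, 1:] * n" using m(3) by (metis dvdE poly_eq_0_iff_dvd)
  have n0: "n \<noteq> 0" using n m(2) by auto
  have "degree n > 0"
  proof (rule ccontr)
    assume "\<not> degree n > 0"
    then obtain e where e: "n = [:e:]" by (metis degree_eq_zeroE neq0_conv)
    hence "m = [:- c * e, e:]" using n by simp
    hence "- c * e \<in> F" "e \<in> F" using mF poly_over_pCons[OF subfield_subring[OF F]] by auto
    hence "- c * e / e \<in> F" by (intro subfield_divide[OF F])
    hence "- (- c * e / e) \<in> F" by (rule subfield_closed(5)[OF F])
    thus False using c n0 e by simp
  qed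
  then obtain c' where c': "poly n c' = 0" using closed by blast
  \<comment> \<open>If c' = c, then c would be a double root, and the nonzero derivative of m would
    vanish at c with smaller degree.\<close>
  have "c' \<noteq> c"
  proof
    assume "c' = c"
    hence "poly n c = 0" using c' by simp
    hence d0: "poly (pderiv m) c = 0" unfolding n pderiv_mult by (simp add: pderiv_pCons)
    have "pderiv m \<in> poly_over F" using mF
      by (auto simp: poly_over_def coeff_pderiv intro!: subfield_closed(4)[OF F] subring_of_nat[OF subfield_subring[OF F]] simp del: of_nat_Suc)
    moreover have "pderiv m \<noteq> 0" using m(4) by (simp add: pderiv_eq_0_iff)
    ultimately have "degree m \<le> degree (pderiv m)" using m(5) d0 E0 by simp
    thus False using m(4) by (simp add: degree_pderiv)
  qed
  have "poly m' c' = 0" using c' \<open>m' = m\<close> n by simp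
  then obtain R1 where R1: "partial_iso L F R1" "(c, c') \<in> R1"
    using R0.extend[OF _ m(1,2,3,5)] c unfolding L_def by blast
  let ?A = "{R. partial_iso L F R \<and> R1 \<subseteq> R}"
  have "\<exists>M\<in>?A. \<forall>S\<in>?A. M \<subseteq> S \<longrightarrow> S = M"
  proof (rule subset_Zorn_nonempty)
    show "?A \<noteq> {}" using R1 by blast
    fix C assume C: "C \<noteq> {}" "subset.chain ?A C"
    hence CA: "\<And>R. R \<in> C \<Longrightarrow> partial_iso L F R" and CR: "\<And>R. R \<in> C \<Longrightarrow> R1 \<subseteq> R"
      and ch: "\<And>R S. R \<in> C \<Longrightarrow> S \<in> C \<Longrightarrow> R \<subseteq> S \<or> S \<subseteq> R"
      by (auto simp: subset_chain_def)
    have "partial_iso L F (\<Union> C)" unfolding partial_iso_def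
    proof (intro conjI allI impI ballI)
      show "\<Union> C \<subseteq> L \<times> L" using CA unfolding partial_iso_def by blast
      show "(a, a) \<in> \<Union> C" if "a \<in> F" for a using CA C(1) that unfolding partial_iso_def by blast
      fix u v assume "(u, v) \<in> \<Union> C"
      then obtain R where R: "R \<in> C" "(u, v) \<in> R" by blast
      show "(- u, - v) \<in> \<Union> C" "(inverse u, inverse v) \<in> \<Union> C" "u = 0 \<longleftrightarrow> v = 0"
        using CA[OF R(1)] R unfolding partial_iso_def by blast+
      fix u' v' assume "(u', v') \<in> \<Union> C"
      then obtain S where S: "S \<in> C" "(u', v') \<in> S" by blast
      obtain T where T: "T \<in> C" "(u, v) \<in> T" "(u', v') \<in> T" using ch[OF R(1) S(1)] R S by blast
      show "(u + u', v + v') \<in> \<Union> C" "(u * u', v * v') \<in> \<Union> C"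
        using CA[OF T(1)] T unfolding partial_iso_def by blast+
    qed
    thus "\<Union> C \<in> ?A" using C(1) CR by blast
  qed
  then obtain R where R0: "R \<in> ?A" and max: "\<forall>S\<in>?A. R \<subseteq> S \<longrightarrow> S = R" by (elim bexE)
  interpret R: piso L F R using R0 F by (simp add: piso_def L_def)
  have dom: "\<exists>v. (b, v) \<in> R" if b: "b \<in> L" for b
  proof -
    obtain m m' where m: "(m, m') \<in> R.Q" "m \<noteq> 0" "poly m b = 0" "degree m > 0"
      "\<And>p. p \<in> poly_over R.E \<Longrightarrow> p \<noteq> 0 \<Longrightarrow> poly p b = 0 \<Longrightarrow> degree m \<le> degree p"
      using R.exists_minimal[OF b] by blast
    obtain b' where "poly m' b' = 0" using closed[of m'] R.Q_degree[OF m(1)] m(4) by auto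
    then obtain S where S: "partial_iso L F S" "R \<subseteq> S" "(b, b') \<in> S" using R.extend[OF b m(1,2,3,5)] by blast
    hence "S \<in> ?A" using R0 by blast
    hence "S = R" using max S(2) by blast
    thus ?thesis using S(3) by blast
  qed
  define \<sigma> where "\<sigma> = (\<lambda>u\<in>L. THE v. (u, v) \<in> R)"
  have sR: "(u, \<sigma> u) \<in> R" if "u \<in> L" for u
    using dom[OF that] R.R_unique that unfolding \<sigma>_def by (auto intro: theI)
  have sI: "\<sigma> u = v" if "(u, v) \<in> R" for u v using R.R_unique[OF sR that] R.R_L[OF that] by blast
  have add: "\<sigma> (a + b) = \<sigma> a + \<sigma> b" "\<sigma> (a * b) = \<sigma> a * \<sigma> b" if "a \<in> L" "b \<in> L" for a b
    using sR[OF that(1)] sR[OF that(2)] by (auto intro!: sI R.R_add R.R_mult)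
  have fixF: "\<sigma> a = a" if "a \<in> F" for a using sI[OF R.R_F[OF that]] .
  have sL: "\<sigma> a \<in> L" if "a \<in> L" for a using R.R_L[OF sR[OF that]] by blast
  have inj: "inj_on \<sigma> L"
  proof (rule inj_onI)
    fix a b assume ab: "a \<in> L" "b \<in> L" "\<sigma> a = \<sigma> b"
    show "a = b" using R.R_zero[OF R.R_diff[OF sR[OF ab(1)] sR[OF ab(2)]]] ab(3) by simp
  qed
  \<comment> \<open>An injective map of the finite root set of f into itself is surjective on
    it.\<close>
  have "v \<in> \<sigma> ` L" if v: "v \<in> L" for v
  proof -
    obtain f where f: "f \<in> poly_over F" "f \<noteq> 0" "poly f v = 0" using v algebraic_iff[OF F] by (auto simp: L_def)
    let ?Z = "{x. poly f x = 0}"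
    have Z: "finite ?Z" "?Z \<subseteq> L" using f poly_roots_finite algebraic_iff[OF F] by (auto simp: L_def)
    have "\<sigma> x \<in> ?Z" if x: "x \<in> ?Z" for x
    proof -
      have xL: "x \<in> L" using x Z by blast
      have "(poly p x, poly p (\<sigma> x)) \<in> R" if "p \<in> poly_over F" for p
        using that
      proof (induction p)
        case 0 show ?case using R.R_0 by simp
      next
        case (pCons a p)
        hence "a \<in> F" "p \<in> poly_over F" using poly_over_pCons[OF subfield_subring[OF F]] by auto
        thus ?case using pCons.IH R.R_add R.R_mult R.R_F sR[OF xL] by simp
      qed
      from this[OF f(1)] show ?thesis using x R.R_zero by auto
    qed
    hence "\<sigma> ` ?Z \<subseteq> ?Z" by blast
    hence "\<sigma> ` ?Z = ?Z" using endo_inj_surj[OF Z(1)] inj_on_subset[OF inj Z(2)] by blast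
    thus ?thesis using f(3) Z(2) by blast
  qed
  hence bij: "bij_betw \<sigma> L L" using inj sL by (auto simp: bij_betw_def)
  have "\<sigma> \<in> carrier (gal L F)" unfolding gal_iff[OF L F FL]
    using bij add fixF subfield_closed(2)[OF F] by (auto simp: \<sigma>_def)
  moreover have "\<sigma> c = c'" using R1(2) R0 by (intro sI) auto
  ultimately show ?thesis using \<open>c' \<noteq> c\<close> unfolding L_def by blast
qed

section \<open>Neighbourhoods in the Krull topology\<close>

text \<open>An automorphism that agrees with \<tau> on a finite spanning list of E over F lies in
  the same coset of \<open>gal L E\<close>; finite intersections of cosets merge the lists.\<close>

lemma krull_neighbourhood:
  fixes L F :: "'a::field_char_0 set"
  assumes L: "subfield L \<Omega>" and F: "subfield F \<Omega>" and FL: "F \<subseteq> L"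
    and V: "openin (krull_topology L F) V" "\<tau> \<in> V"
  shows "\<exists>T. finite T \<and> T \<subseteq> L \<and> (\<forall>\<rho>\<in>carrier (gal L F). (\<forall>e\<in>T. \<rho> e = \<tau> e) \<longrightarrow> \<rho> \<in> V)"
proof -
  note G = gal_iff[OF L F FL] and gc = gal_closed[OF L F FL]
  have "generate_topology_on {\<sigma> <#\<^bsub>gal L F\<^esub> carrier (gal L E) |\<sigma> E. \<sigma> \<in> carrier (gal L F) \<and>
       subfield E \<Omega> \<and> F \<subseteq> E \<and> E \<subseteq> L \<and> ring.finite_dimension \<Omega> F E} V"
    using V(1) unfolding krull_topology_def by (rule openin_topology_generated_by)
  thus ?thesis using V(2)
  proof (induction V rule: generate_topology_on.induct)
    case (Int a b)
    then obtain S T where "finite S" "S \<subseteq> L" "\<forall>\<rho>\<in>carrier (gal L F). (\<forall>e\<in>S. \<rho> e = \<tau> e) \<longrightarrow> \<rho> \<in> a"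
      "finite T" "T \<subseteq> L" "\<forall>\<rho>\<in>carrier (gal L F). (\<forall>e\<in>T. \<rho> e = \<tau> e) \<longrightarrow> \<rho> \<in> b" by (auto simp: Int_iff)
    thus ?case by (intro exI[of _ "S \<union> T"]) auto
  next
    case (UN C)
    then obtain c where c: "c \<in> C" "\<tau> \<in> c" by blast
    obtain T where T: "finite T" "T \<subseteq> L" "\<forall>\<rho>\<in>carrier (gal L F). (\<forall>e\<in>T. \<rho> e = \<tau> e) \<longrightarrow> \<rho> \<in> c"
      using UN.IH[OF c] by (elim exE conjE)
    show ?case using T c(1) by (intro exI[of _ T] conjI ballI impI UnionI[of c]) auto
  next
    case (Basis V)
    then obtain \<sigma> E where s: "\<sigma> \<in> carrier (gal L F)" and E: "subfield E \<Omega>" "F \<subseteq> E" "E \<subseteq> L"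
      and fd: "ring.finite_dimension \<Omega> F E" and V: "V = \<sigma> <#\<^bsub>gal L F\<^esub> carrier (gal L E)" by blast
    obtain xs where xs: "E = ring.Span \<Omega> F xs" using fd finite_dimension_Span[OF F] by blast
    have V': "V = {compose L \<sigma> h | h. h \<in> carrier (gal L E)}" unfolding V l_coset_def by (auto simp: gal_def)
    then obtain h where h: "\<tau> = compose L \<sigma> h" "h \<in> carrier (gal L E)" using Basis by blast
    have setE: "set xs \<subseteq> E" using Om.Span_base_incl[OF F, of xs] xs by simp
    have "\<rho> \<in> V" if r: "\<rho> \<in> carrier (gal L F)" and agree: "\<forall>e\<in>set xs. \<rho> e = \<tau> e" for \<rho>
    proof -
      define h' where "h' = compose L (restrict (inv_into L \<sigma>) L) \<rho>"
      have h'G: "h' \<in> carrier (gal L F)" unfolding h'_def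
        by (rule gal_compose[OF L F FL gal_restrict_inv[OF L F FL s] r])
      have h'x: "h' e = e" if e: "e \<in> set xs" for e
      proof -
        have eL: "e \<in> L" using e setE E by blast
        have "h e = e" using gal_fix[OF L E(1) E(3) h(2)] e setE by blast
        hence "\<rho> e = \<sigma> e" using agree e eL h(1) by (simp add: compose_def)
        thus ?thesis using eL gc[OF r eL] gc[OF s eL] inv_into_f_f[OF gal_inj[OF L F FL s] eL] by (simp add: h'_def compose_def)
      qed
      have "h' a = a" if a: "a \<in> E" for a
      proof -
        obtain c where c: "\<forall>i<length xs. c i \<in> F" "a = (\<Sum>i<length xs. c i * xs ! i)"
          using a mem_Span_iff[OF F, of a xs] xs by auto
        have x: "c i \<in> L" "xs ! i \<in> L" if "i < length xs" for i
          using c(1) FL setE E(3) that nth_mem[OF that] by blast+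
        have "h' a = (\<Sum>i<length xs. h' (c i * xs ! i))" unfolding c(2)
          using x by (intro gal_sum[OF L F FL h'G]) (auto intro!: subfield_closed(4)[OF L])
        also have "\<dots> = a" unfolding c(2)
          using x c(1) gal_mult[OF L F FL h'G] gal_fix[OF L F FL h'G] h'x by (intro sum.cong) auto
        finally show ?thesis .
      qed
      hence "h' \<in> carrier (gal L E)" using h'G unfolding G gal_iff[OF L E(1) E(3)] by blast
      moreover have "\<rho> = compose L \<sigma> h'"
      proof (rule extensionalityI[of _ L])
        show "\<rho> \<in> extensional L" using r G by blast
        fix a assume a: "a \<in> L"
        have "\<rho> a \<in> \<sigma> ` L" using gc[OF r a] gal_surj[OF L F FL s] by simp
        thus "\<rho> a = compose L \<sigma> h' a" using a gc[OF r a] by (simp add: compose_def h'_def f_inv_into_f)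
      qed auto
      ultimately show ?thesis unfolding V' by blast
    qed
    thus ?case using setE E(3) by (intro exI[of _ "set xs"]) auto
  qed auto
qed

lemma krull_coset_open:
  fixes L F :: "'a::field_char_0 set"
  assumes "subfield E \<Omega>" "F \<subseteq> E" "E \<subseteq> L" "ring.finite_dimension \<Omega> F E" "\<sigma> \<in> carrier (gal L F)"
  shows "openin (krull_topology L F) (\<sigma> <#\<^bsub>gal L F\<^esub> carrier (gal L E))"
  unfolding krull_topology_def by (rule topology_generated_by_Basis) (use assms in blast)

section \<open>Kummer theory for quadratic characters\<close>

lemma exists_nat_nonroot:
  fixes p :: "'a::field_char_0 poly"
  assumes "p \<noteq> 0" obtains n :: nat where "poly p (of_nat n) \<noteq> 0"
proof -
  have "infinite (range (of_nat :: nat \<Rightarrow> 'a))" by (rule range_inj_infinite) (rule inj_of_nat)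
  hence "\<not> range (of_nat :: nat \<Rightarrow> 'a) \<subseteq> {x. poly p x = 0}" using poly_roots_finite[OF assms] finite_subset by blast
  thus ?thesis using that by blast
qed

text \<open>Choose \<theta> such that \<tau>(\<theta>) determines \<chi>(\<tau>). The orbit of
  \<theta> splits by the sign of \<chi>, and \<tau> with \<chi>(\<tau>) = -1 exchanges the halves.
  The two monic polynomials with these halves as roots are exchanged likewise, so the difference of
  their values at a natural number is an eigenvector.\<close>

lemma quadratic_character_eigenvector:
  fixes k :: "'a::field_char_0 set" and \<chi> :: "('a \<Rightarrow> 'a) \<Rightarrow> 'a"
  defines "L \<equiv> algebraic_elements k"
  defines "G \<equiv> carrier (gal L k)"
  assumes k: "subfield k \<Omega>" and \<chi>: "\<And>\<tau>. \<tau> \<in> G \<Longrightarrow> \<chi> \<tau> = 1 \<or> \<chi> \<tau> = - 1"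
    and hom: "\<And>\<tau> \<rho>. \<tau> \<in> G \<Longrightarrow> \<rho> \<in> G \<Longrightarrow> \<chi> (compose L \<tau> \<rho>) = \<chi> \<tau> * \<chi> \<rho>"
    and T: "finite T" "T \<subseteq> L" "\<And>\<tau>. \<tau> \<in> G \<Longrightarrow> (\<forall>e\<in>T. \<tau> e = e) \<Longrightarrow> \<chi> \<tau> = 1"
  shows "\<exists>c\<in>L. c \<noteq> 0 \<and> (\<forall>\<tau>\<in>G. \<tau> c = \<chi> \<tau> * c)"
proof -
  have L: "subfield L \<Omega>" and kL: "k \<subseteq> L" unfolding L_def
    by (rule subfield_algebraic_elements[OF k], rule subset_algebraic_elements[OF k])
  note A = L k kL
  have gc: "\<tau> a \<in> L" if "\<tau> \<in> G" "a \<in> L" for \<tau> a using gal_closed[OF A] that unfolding G_def by blast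
  have natL: "of_nat m \<in> L" "(of_nat m :: 'a) \<in> k" for m by (intro subfield_closed(8) L k)+
  have gnat: "\<tau> (of_nat m) = of_nat m" if "\<tau> \<in> G" for \<tau> m
    using gal_fix[OF A _ natL(2)] that unfolding G_def by blast
  have inv: "restrict (inv_into L \<tau>) L \<in> G" if "\<tau> \<in> G" for \<tau> using gal_restrict_inv[OF A] that unfolding G_def by blast
  have comp: "compose L \<tau> \<rho> \<in> G" if "\<tau> \<in> G" "\<rho> \<in> G" for \<tau> \<rho> using gal_compose[OF A] that unfolding G_def by blast
  have inv_l: "inv_into L \<tau> (\<tau> a) = a" and inv_r: "\<tau> (inv_into L \<tau> a) = a" and inv_c: "inv_into L \<tau> a \<in> L"
    if "\<tau> \<in> G" "a \<in> L" for \<tau> a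
    using that gal_inj[OF A] gal_surj[OF A] unfolding G_def by (auto simp: inv_into_f_f f_inv_into_f inv_into_into)
  define id where "id = (\<lambda>a\<in>L. a)"
  have idG: "id \<in> G" unfolding id_def G_def by (rule gal_id[OF A])
  have chi_id: "\<chi> id = 1" using T(2) by (intro T(3) idG) (auto simp: id_def)
  have chi_eq: "\<chi> \<tau> = \<chi> \<rho>" if t: "\<tau> \<in> G" "\<rho> \<in> G" "\<forall>e\<in>T. \<tau> e = \<rho> e" for \<tau> \<rho>
  proof -
    define \<eta> where "\<eta> = compose L (restrict (inv_into L \<tau>) L) \<rho>"
    have eta: "\<eta> \<in> G" unfolding \<eta>_def using comp[OF inv[OF t(1)] t(2)] .
    have "\<eta> e = e" if e: "e \<in> T" for e
    proof -
      have eL: "e \<in> L" using e T(2) by blast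
      have "\<eta> e = inv_into L \<tau> (\<rho> e)" using eL gc[OF t(2) eL] by (simp add: \<eta>_def compose_def)
      also have "\<rho> e = \<tau> e" using t(3) e by simp
      finally show ?thesis using inv_l[OF t(1) eL] by simp
    qed
    hence "\<chi> \<eta> = 1" using T(3)[OF eta] by blast
    moreover have "\<rho> = compose L \<tau> \<eta>"
    proof (rule extensionalityI[of _ L])
      show "\<rho> \<in> extensional L" using t(2) gal_iff[OF A] unfolding G_def by blast
      fix a assume a: "a \<in> L"
      thus "\<rho> a = compose L \<tau> \<eta> a" using inv_r[OF t(1) gc[OF t(2) a]] gc[OF t(2) a] by (simp add: compose_def \<eta>_def)
    qed auto
    ultimately show ?thesis using hom[OF t(1) eta] by simp
  qed
  have orbit_finite: "finite ((\<lambda>\<tau>. \<tau> a) ` G)" if a: "a \<in> L" for a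
  proof -
    obtain f where f: "f \<in> poly_over k" "f \<noteq> 0" "poly f a = 0" using a algebraic_iff[OF k] by (auto simp: L_def)
    have "\<tau> a \<in> {x. poly f x = 0}" if "\<tau> \<in> G" for \<tau>
      using gal_poly[OF A _ f(1) a] gal_0[OF A] f(3) that unfolding G_def by fastforce
    thus ?thesis using poly_roots_finite[OF f(2)] by (meson finite_subset image_subsetI)
  qed
  obtain e where e: "bij_betw e {..<card T} T"
    using ex_bij_betw_nat_finite[OF T(1)] by (auto simp: atLeast0LessThan)
  define n where "n = card T"
  have eL: "e i \<in> L" if "i < n" for i using e T(2) that by (auto simp: bij_betw_def n_def)
  \<comment> \<open>The values of \<tau> on T become coefficients, so that evaluation at a suitable
    number packs them into one element.\<close>
  define p where "p \<tau> = (\<Sum>i<n. monom (\<tau> (e i)) i)" for \<tau> :: "'a \<Rightarrow> 'a"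
  have cp: "coeff (p \<tau>) i = (if i < n then \<tau> (e i) else 0)" for \<tau> i by (auto simp: p_def coeff_sum coeff_monom)
  have p_eq: "\<forall>a\<in>T. \<tau> a = \<rho> a" if "p \<tau> = p \<rho>" for \<tau> \<rho>
  proof
    fix a assume "a \<in> T"
    then obtain i where "i < n" "a = e i" using e by (auto simp: bij_betw_def n_def)
    thus "\<tau> a = \<rho> a" using cp[of \<tau> i] cp[of \<rho> i] that by simp
  qed
  have finp: "finite (p ` G)"
  proof -
    have "p ` G \<subseteq> (\<lambda>f. \<Sum>i<n. monom (f i) i) ` (PiE {..<n} (\<lambda>i. (\<lambda>\<tau>. \<tau> (e i)) ` G))"
    proof safe
      fix \<tau> assume "\<tau> \<in> G"
      thus "p \<tau> \<in> (\<lambda>f. \<Sum>i<n. monom (f i) i) ` (PiE {..<n} (\<lambda>i. (\<lambda>\<tau>. \<tau> (e i)) ` G))"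
        by (intro image_eqI[of _ _ "\<lambda>i\<in>{..<n}. \<tau> (e i)"]) (auto simp: p_def)
    qed
    moreover have "finite (PiE {..<n} (\<lambda>i. (\<lambda>\<tau>. \<tau> (e i)) ` G))" using orbit_finite eL by (intro finite_PiE) auto
    ultimately show ?thesis by (meson finite_imageI finite_subset)
  qed
  \<comment> \<open>Only finitely many such polynomials occur; a number that is no root of any of
    their differences separates them.\<close>
  define D where "D = (\<Prod>(q, r)\<in>{(q, r) \<in> p ` G \<times> p ` G. q \<noteq> r}. q - r)"
  have fin2: "finite {(q, r) \<in> p ` G \<times> p ` G. q \<noteq> r}" by (rule finite_subset[of _ "p ` G \<times> p ` G"]) (use finp in auto)
  have "D \<noteq> 0" unfolding D_def using fin2 by auto
  then obtain m :: nat where m: "poly D (of_nat m) \<noteq> 0" using exists_nat_nonroot by blast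
  have sep: "q = r" if "q \<in> p ` G" "r \<in> p ` G" "poly q (of_nat m) = poly r (of_nat m)" for q r
  proof (rule ccontr)
    assume "q \<noteq> r"
    hence "(q, r) \<in> {(q, r) \<in> p ` G \<times> p ` G. q \<noteq> r}" using that by blast
    hence "poly D (of_nat m) = 0" unfolding D_def poly_prod using fin2 that(3) by (intro prod_zero) (auto intro!: bexI[of _ "(q, r)"])
    thus False using m by simp
  qed
  define \<theta> where "\<theta> = (\<Sum>i<n. e i * of_nat m ^ i)"
  have tL: "\<theta> \<in> L" unfolding \<theta>_def using eL natL by (intro subfield_sum[OF L] subfield_closed(4,7)[OF L]) auto
  have gt: "\<tau> \<theta> = poly (p \<tau>) (of_nat m)" if t: "\<tau> \<in> G" for \<tau>
  proof -
    have tg: "\<tau> \<in> carrier (gal L k)" using t by (simp add: G_def)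
    have "\<tau> \<theta> = (\<Sum>i<n. \<tau> (e i * of_nat m ^ i))" unfolding \<theta>_def
      using eL natL by (intro gal_sum[OF A tg] subfield_closed(4,7)[OF L]) auto
    also have "\<dots> = (\<Sum>i<n. \<tau> (e i) * of_nat m ^ i)"
      using eL natL gal_mult[OF A tg] gal_power[OF A tg] gnat[OF t] by (intro sum.cong) (auto simp: subfield_closed(7)[OF L])
    finally show ?thesis by (simp add: p_def poly_sum poly_monom)
  qed
  have sep': "\<chi> \<tau> = \<chi> \<rho>" if "\<tau> \<in> G" "\<rho> \<in> G" "\<tau> \<theta> = \<rho> \<theta>" for \<tau> \<rho>
  proof -
    have "poly (p \<tau>) (of_nat m) = poly (p \<rho>) (of_nat m)" using gt[OF that(1)] gt[OF that(2)] that(3) by metis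
    hence "p \<tau> = p \<rho>" using sep that(1,2) by blast
    thus ?thesis using chi_eq[OF that(1,2) p_eq] by blast
  qed
  define Ob where "Ob s = (\<lambda>\<tau>. \<tau> \<theta>) ` {\<tau> \<in> G. \<chi> \<tau> = s}" for s
  have finO: "finite (Ob s)" for s unfolding Ob_def by (rule finite_subset[OF _ orbit_finite[OF tL]]) auto
  have OL: "Ob s \<subseteq> L" for s unfolding Ob_def using gc tL by auto
  define P where "P s = (\<Prod>v\<in>Ob s. [:- v, 1:])" for s
  have P: "poly (P s) w = (\<Prod>v\<in>Ob s. w - v)" for s w by (simp add: P_def poly_prod)
  have "\<theta> \<in> Ob 1" unfolding Ob_def using idG chi_id tL by (intro image_eqI[of _ _ id]) (auto simp: id_def)
  hence z: "poly (P 1) \<theta> = 0" unfolding P using finO by (intro prod_zero) (auto intro!: bexI[of _ \<theta>])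
  have "\<theta> \<notin> Ob (- 1)"
  proof
    assume "\<theta> \<in> Ob (- 1)"
    then obtain \<tau> where t: "\<tau> \<in> G" "\<chi> \<tau> = - 1" "\<theta> = \<tau> \<theta>" by (auto simp: Ob_def)
    have "id \<theta> = \<theta>" using tL by (simp add: id_def)
    hence "\<chi> id = \<chi> \<tau>" using sep'[OF idG t(1)] t(3) by simp
    thus False using t(2) chi_id by simp
  qed
  hence "poly (P (- 1)) \<theta> \<noteq> 0" unfolding P using finO by auto
  \<comment> \<open>\<theta> is a root of the first polynomial, through the identity, and not of the
    second.\<close>
  hence "P 1 - P (- 1) \<noteq> 0" using z by (metis eq_iff_diff_eq_0)
  then obtain w :: nat where w: "poly (P 1 - P (- 1)) (of_nat w) \<noteq> 0" using exists_nat_nonroot by blast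
  define c where "c = poly (P 1) (of_nat w) - poly (P (- 1)) (of_nat w)"
  have pL: "poly (P s) (of_nat w) \<in> L" for s unfolding P
    using OL natL by (intro subring_prod[OF subfield_subring[OF L]] subfield_closed(6)[OF L]) auto
  have gP: "\<tau> (poly (P s) (of_nat w)) = poly (P (\<chi> \<tau> * s)) (of_nat w)" if t: "\<tau> \<in> G" for \<tau> s
  proof -
    have tg: "\<tau> \<in> carrier (gal L k)" using t by (simp add: G_def)
    have im: "\<tau> ` Ob s = Ob (\<chi> \<tau> * s)"
    proof (rule equalityI; rule subsetI)
      fix v assume "v \<in> \<tau> ` Ob s"
      then obtain \<rho> where r: "\<rho> \<in> G" "\<chi> \<rho> = s" "v = \<tau> (\<rho> \<theta>)" by (auto simp: Ob_def)
      thus "v \<in> Ob (\<chi> \<tau> * s)" unfolding Ob_def using comp[OF t r(1)] hom[OF t r(1)] tL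
        by (intro image_eqI[of _ _ "compose L \<tau> \<rho>"]) (auto simp: compose_def)
    next
      fix v assume "v \<in> Ob (\<chi> \<tau> * s)"
      then obtain \<rho> where r: "\<rho> \<in> G" "\<chi> \<rho> = \<chi> \<tau> * s" "v = \<rho> \<theta>" by (auto simp: Ob_def)
      define \<eta> where "\<eta> = compose L (restrict (inv_into L \<tau>) L) \<rho>"
      have eta: "\<eta> \<in> G" unfolding \<eta>_def using comp[OF inv[OF t] r(1)] .
      have "\<rho> = compose L \<tau> \<eta>"
      proof (rule extensionalityI[of _ L])
        show "\<rho> \<in> extensional L" using r(1) gal_iff[OF A] unfolding G_def by blast
        fix a assume a: "a \<in> L"
        thus "\<rho> a = compose L \<tau> \<eta> a" using inv_r[OF t gc[OF r(1) a]] gc[OF r(1) a] by (simp add: compose_def \<eta>_def)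
      qed auto
      hence "\<chi> \<tau> * s = \<chi> \<tau> * \<chi> \<eta>" "v = \<tau> (\<eta> \<theta>)" using hom[OF t eta] r tL by (auto simp: compose_def)
      moreover have "\<chi> \<tau> \<noteq> 0" using \<chi>[OF t] by auto
      ultimately show "v \<in> \<tau> ` Ob s" using eta by (auto simp: Ob_def)
    qed
    have "\<tau> (\<Prod>v\<in>Ob s. of_nat w - v) = (\<Prod>v\<in>Ob s. \<tau> (of_nat w - v))"
      using OL natL by (intro gal_prod[OF A tg] subfield_closed(6)[OF L]) auto
    also have "\<dots> = (\<Prod>v\<in>Ob s. of_nat w - \<tau> v)"
      using OL natL gal_diff[OF A tg] gnat[OF t] by (intro prod.cong) (auto simp: subset_iff)
    also have "\<dots> = (\<Prod>v\<in>\<tau> ` Ob s. of_nat w - v)"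
      by (subst prod.reindex) (use inj_on_subset[OF gal_inj[OF A tg] OL] in auto)
    finally show ?thesis unfolding P im .
  qed
  have "\<tau> c = \<chi> \<tau> * c" if t: "\<tau> \<in> G" for \<tau>
  proof -
    have "\<tau> c = \<tau> (poly (P 1) (of_nat w)) - \<tau> (poly (P (- 1)) (of_nat w))"
      unfolding c_def using t pL by (intro gal_diff[OF A]) (auto simp: G_def)
    thus ?thesis using gP[OF t, of 1] gP[OF t, of "- 1"] \<chi>[OF t] by (auto simp: c_def)
  qed
  moreover have "c \<in> L" unfolding c_def using pL by (intro subfield_closed(6)[OF L])
  moreover have "c \<noteq> 0" using w by (simp add: c_def)
  ultimately show ?thesis by blast
qed

section \<open>Residues fixed by a section\<close>

lemma subfield_UNIV: "subfield UNIV (\<Omega> :: 'a::field_char_0 ring)"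
  by (rule ambient_subfieldI) auto

text \<open>If a were outside W, then 1/a would be in the maximal ideal, and the reversed polynomial
  at 1/a would be a unit, its constant term being the leading coefficient of p.\<close>

lemma algebraic_in_valuation_ring:
  fixes k W :: "'a::field_char_0 set"
  assumes k: "subfield k \<Omega>" and W: "valuation_ring UNIV W" "k \<subseteq> W" and a: "a \<in> algebraic_elements k"
  shows "a \<in> W"
proof (rule ccontr)
  note V = subfield_UNIV W(1)
  assume "a \<notin> W"
  hence ia: "inverse a \<in> maximal_ideal W" by (intro inverse_in_maximal_ideal[OF V]) auto
  have a0: "a \<noteq> 0" using \<open>a \<notin> W\<close> subring_0[OF valuation_ring_subring[OF V]] by auto
  obtain p where p: "p \<in> poly_over k" "p \<noteq> 0" "poly p a = 0" using a algebraic_iff[OF k] by auto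
  obtain c r where cr: "reflect_poly p = pCons c r" by (cases "reflect_poly p")
  have "reflect_poly p \<in> poly_over k" using p(1) subfield_closed(1)[OF k] by (auto simp: poly_over_def coeff_reflect_poly)
  hence ck: "c \<in> k" "r \<in> poly_over k" using cr poly_over_pCons[OF subfield_subring[OF k]] by auto
  have "coeff (reflect_poly p) 0 = lead_coeff p" by simp
  hence "c \<noteq> 0" using cr p(2) by simp
  hence c: "c \<in> units_of_ring W" using ck(1) W(2) subfield_inverse[OF k] by (auto simp: units_of_ring_iff)
  have "poly r (inverse a) \<in> W"
    by (rule poly_over_in_subring[OF valuation_ring_subring[OF V] W(2) ck(2)]) (use ia maximal_ideal_subset[OF V] in blast)
  hence "c + inverse a * poly r (inverse a) \<in> units_of_ring W"
    by (intro units_add[OF V c] maximal_ideal_mult[OF V ia])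
  moreover have "poly (reflect_poly p) (inverse a) = inverse a ^ degree p * poly p a"
    using poly_reflect_poly_nz[of "inverse a" p] a0 by simp
  ultimately show False using p(3) cr by (simp add: units_of_ring_iff)
qed

text \<open>Take a monic divisor q of p of least degree with q(z) in the maximal ideal, and a root
  \<alpha> of it. If z - \<alpha> were a unit, the linear factor could be removed. Dividing p keeps
  \<alpha> algebraic over k.\<close>

lemma residue_root:
  fixes k W :: "'a::field_char_0 set"
  assumes k: "subfield k \<Omega>" and closed: "\<And>p :: 'a poly. degree p > 0 \<Longrightarrow> \<exists>x. poly p x = 0"
    and W: "valuation_ring UNIV W" "k \<subseteq> W" and z: "z \<in> W"
    and p: "p \<in> poly_over k" "p \<noteq> 0" "poly p z \<in> maximal_ideal W"
  shows "\<exists>\<alpha>\<in>algebraic_elements k. z - \<alpha> \<in> maximal_ideal W"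
proof -
  note V = subfield_UNIV W(1)
  define Q where "Q q \<longleftrightarrow> lead_coeff q = 1 \<and> q dvd p \<and> poly q z \<in> maximal_ideal W" for q
  have "Q (smult (inverse (lead_coeff p)) p)"
  proof -
    have "inverse (lead_coeff p) \<in> W" using poly_overD[OF p(1)] subfield_inverse[OF k] W(2) by blast
    hence "poly p z * inverse (lead_coeff p) \<in> maximal_ideal W" by (rule maximal_ideal_mult[OF V p(3)])
    thus ?thesis using p(2) by (auto simp: Q_def smult_dvd_iff mult.commute)
  qed
  then obtain q where q: "Q q" and min: "\<forall>r. Q r \<longrightarrow> degree q \<le> degree r"
    using ex_has_least_nat[of Q _ degree] by blast
  have "degree q > 0"
  proof (rule ccontr)
    assume "\<not> degree q > 0"
    then obtain e where "q = [:e:]" by (metis degree_eq_zeroE neq0_conv)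
    thus False using q one_notin_maximal_ideal[OF V] by (auto simp: Q_def)
  qed
  then obtain \<alpha> where al: "poly q \<alpha> = 0" using closed by blast
  then obtain r where r: "q = [:- \<alpha>, 1:] * r" by (metis dvdE poly_eq_0_iff_dvd)
  have "poly p \<alpha> = 0" using q al by (auto simp: Q_def dvd_def)
  hence aL: "\<alpha> \<in> algebraic_elements k" using p algebraic_iff[OF k] by blast
  have aW: "\<alpha> \<in> W" by (rule algebraic_in_valuation_ring[OF k W aL])
  have "z - \<alpha> \<in> maximal_ideal W"
  proof (rule ccontr)
    assume "z - \<alpha> \<notin> maximal_ideal W"
    moreover have "z - \<alpha> \<in> W" by (rule subring_diff[OF valuation_ring_subring[OF V] z aW])
    ultimately have u: "z - \<alpha> \<noteq> 0" "inverse (z - \<alpha>) \<in> W" by (auto simp: maximal_ideal_iff)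
    have "poly q z * inverse (z - \<alpha>) \<in> maximal_ideal W"
      using q u by (intro maximal_ideal_mult[OF V]) (auto simp: Q_def)
    moreover have "poly q z = (z - \<alpha>) * poly r z" by (simp add: r algebra_simps)
    moreover have "v * w * inverse v = w" if "v \<noteq> 0" for v w :: 'a using that by simp
    ultimately have "poly r z \<in> maximal_ideal W" using u(1) by metis
    moreover have "lead_coeff q = lead_coeff [:- \<alpha>, 1:] * lead_coeff r" unfolding r by (rule lead_coeff_mult)
    hence "lead_coeff r = 1" using q by (simp add: Q_def)
    moreover have "r dvd q" unfolding r by (rule dvd_triv_right)
    hence "r dvd p" using q unfolding Q_def by (blast intro: dvd_trans)
    ultimately have "degree q \<le> degree r" using min by (auto simp: Q_def)
    moreover have "r \<noteq> 0" using \<open>lead_coeff r = 1\<close> by auto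
    moreover from this have "degree q = degree [:- \<alpha>, 1:] + degree r"
      unfolding r by (intro degree_mult_eq) auto
    ultimately show False by simp
  qed
  thus ?thesis using aL by blast
qed

lemma gal_base_fixed:
  fixes k :: "'a::field_char_0 set"
  assumes k: "subfield k \<Omega>" and closed: "\<And>p :: 'a poly. degree p > 0 \<Longrightarrow> \<exists>x. poly p x = 0"
    and a: "a \<in> algebraic_elements k" "\<And>\<tau>. \<tau> \<in> carrier (G_base k) \<Longrightarrow> \<tau> a = a"
  shows "a \<in> k"
  using gal_moves[OF k closed a(1)] a(2) by blast

text \<open>z is congruent to an algebraic \<alpha>, and applying s(\<tau>) shows that it is
  congruent to \<tau>(\<alpha>) as well. The difference \<tau>(\<alpha>) - \<alpha> is algebraic,
  and nonzero algebraic elements are units of W, so \<alpha> is fixed by G_k.\<close>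

lemma stable_residue:
  fixes k P W :: "'a::field_char_0 set"
  assumes k: "subfield k \<Omega>" and closed: "\<And>p :: 'a poly. degree p > 0 \<Longrightarrow> \<exists>x. poly p x = 0"
    and P: "subfield P \<Omega>" and s: "\<And>\<tau>. \<tau> \<in> carrier (G_base k) \<Longrightarrow> s \<tau> \<in> carrier (gal UNIV P)"
    "\<And>\<tau> a. \<tau> \<in> carrier (G_base k) \<Longrightarrow> a \<in> algebraic_elements k \<Longrightarrow> s \<tau> a = \<tau> a"
    and W: "valuation_ring UNIV W" "k \<subseteq> W" "\<And>\<tau>. \<tau> \<in> carrier (G_base k) \<Longrightarrow> s \<tau> ` W = W"
    and z: "z \<in> W" "\<And>\<tau>. \<tau> \<in> carrier (G_base k) \<Longrightarrow> s \<tau> z = z"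
    and p: "p \<in> poly_over k" "p \<noteq> 0" "poly p z \<in> maximal_ideal W"
  shows "\<exists>\<alpha>\<in>k. z - \<alpha> \<in> maximal_ideal W"
proof -
  note V = subfield_UNIV W(1)
  let ?L = "algebraic_elements k"
  have L: "subfield ?L \<Omega>" by (rule subfield_algebraic_elements[OF k])
  obtain \<alpha> where al: "\<alpha> \<in> ?L" "z - \<alpha> \<in> maximal_ideal W" using residue_root[OF k closed W(1,2) z(1) p] by blast
  have "\<tau> \<alpha> = \<alpha>" if t: "\<tau> \<in> carrier (G_base k)" for \<tau>
  proof -
    note A = subfield_UNIV P subset_UNIV s(1)[OF t]
    have sm: "s \<tau> a \<in> maximal_ideal W" if a: "a \<in> maximal_ideal W" for a
    proof -
      have "s \<tau> a \<in> W" using a maximal_ideal_subset[OF V] W(3)[OF t] by blast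
      moreover have "inverse (s \<tau> a) \<notin> W" if "a \<noteq> 0"
      proof
        assume "inverse (s \<tau> a) \<in> W"
        hence "s \<tau> (inverse a) \<in> s \<tau> ` W" using gal_inverse[OF A] W(3)[OF t] by simp
        hence "inverse a \<in> W" using gal_inj[OF A] by (auto simp: inj_on_def)
        thus False using a that by (auto simp: maximal_ideal_iff)
      qed
      ultimately show ?thesis using gal_0[OF A] by (cases "a = 0") (auto simp: maximal_ideal_iff)
    qed
    have "s \<tau> (z - \<alpha>) = z - \<tau> \<alpha>" using gal_diff[OF A] z(2)[OF t] s(2)[OF t al(1)] by simp
    hence "z - \<tau> \<alpha> \<in> maximal_ideal W" using sm[OF al(2)] by simp
    hence "(z - \<alpha>) - (z - \<tau> \<alpha>) \<in> maximal_ideal W" by (rule maximal_ideal_diff[OF V al(2)])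
    hence m: "\<tau> \<alpha> - \<alpha> \<in> maximal_ideal W" by simp
    have "\<tau> \<alpha> \<in> ?L"
      by (rule gal_closed[OF L k subset_algebraic_elements[OF k] t al(1)])
    hence "inverse (\<tau> \<alpha> - \<alpha>) \<in> ?L" using al(1) by (intro subfield_closed(6,9)[OF L])
    hence "inverse (\<tau> \<alpha> - \<alpha>) \<in> W" by (rule algebraic_in_valuation_ring[OF k W(1,2)])
    thus ?thesis using m by (auto simp: maximal_ideal_iff)
  qed
  hence "\<alpha> \<in> k" using gal_base_fixed[OF k closed al(1)] by blast
  thus ?thesis using al(2) by blast
qed

lemma rational_pointI:
  fixes k K x :: "'a::field_char_0 set"
  assumes k: "subfield k \<Omega>" and K: "subfield K \<Omega>" and x: "x \<in> closed_points k K"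
    and res: "\<And>z. z \<in> x \<Longrightarrow> \<exists>\<alpha>\<in>k. z - \<alpha> \<in> maximal_ideal x"
  shows "x \<in> rational_points k K"
proof -
  note V = K closed_point_valuation_ring[OF K x]
  have "indep_mod k (maximal_ideal x) {()} (\<lambda>_. 1)" unfolding indep_mod_def
  proof (intro allI impI ballI)
    fix c :: "unit \<Rightarrow> 'a" and i assume c: "\<forall>i\<in>{()}. c i \<in> k" "(\<Sum>i\<in>{()}. c i * 1) \<in> maximal_ideal x"
    hence "inverse (c ()) \<in> x" using subfield_inverse[OF k] cp_scalars[OF K x] by auto
    thus "c i = 0" using c(2) by (auto simp: maximal_ideal_iff)
  qed
  moreover have "gen_mod k (maximal_ideal x) {()} (\<lambda>_. 1) x" unfolding gen_mod_def
  proof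
    fix a assume "a \<in> x"
    then obtain \<alpha> where "\<alpha> \<in> k" "a - \<alpha> \<in> maximal_ideal x" using res by blast
    thus "\<exists>c. (\<forall>i\<in>{()}. c i \<in> k) \<and> a - (\<Sum>i\<in>{()}. c i * 1) \<in> maximal_ideal x"
      by (intro exI[of _ "\<lambda>_. \<alpha>"]) auto
  qed
  ultimately have "basis_mod k (maximal_ideal x) x {()} (\<lambda>_. 1)"
    using subring_1[OF cp_ring[OF K x]] by (auto simp: basis_mod_def)
  from point_degree_eq[OF k K x this] show ?thesis using x by (simp add: rational_points_def)
qed

text \<open>The residue field is N-dimensional, so the N + 1 powers of z up to z^N are dependent
  modulo the maximal ideal.\<close>

lemma (in hyperelliptic) residue_algebraic:
  assumes x: "x \<in> closed_points k K" and z: "z \<in> x"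
  shows "\<exists>p\<in>poly_over k. p \<noteq> 0 \<and> poly p z \<in> maximal_ideal x"
proof -
  obtain N u where u: "basis_mod k (maximal_ideal x) x {..<N::nat} u" using finite_residue[OF x] .
  have ms: "k_subspace k (maximal_ideal x)" using k_subspace_frac_ideal[OF K x, of 1] frac_ideal_1[OF K x] by simp
  have "\<not> indep_mod k (maximal_ideal x) {..<Suc N} (\<lambda>i. z ^ i)"
  proof
    assume "indep_mod k (maximal_ideal x) {..<Suc N} (\<lambda>i. z ^ i)"
    hence "card {..<Suc N} \<le> card {..<N}"
      by (rule steinitz[OF k ms, where A = x and u = u])
        (use u z subring_power[OF cp_ring[OF K x]] in \<open>auto simp: basis_mod_def\<close>)
    thus False by simp
  qed
  then obtain c i where c: "\<forall>i\<in>{..<Suc N}. c i \<in> k" "(\<Sum>i<Suc N. c i * z ^ i) \<in> maximal_ideal x" "i < Suc N" "c i \<noteq> 0"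
    unfolding indep_mod_def by blast
  define p where "p = (\<Sum>i<Suc N. monom (c i) i)"
  have cp: "coeff p j = (if j < Suc N then c j else 0)" for j unfolding p_def by (simp add: coeff_sum coeff_monom del: sum.lessThan_Suc)
  have "poly p z = (\<Sum>i<Suc N. c i * z ^ i)" unfolding p_def by (simp add: poly_sum poly_monom del: sum.lessThan_Suc)
  moreover have "p \<in> poly_over k" using c(1) subfield_closed(1)[OF k] by (auto simp: poly_over_def cp)
  moreover have "p \<noteq> 0" using cp[of i] c by auto
  ultimately show ?thesis using c(2) by auto
qed

section \<open>Lifting a section to the hyperelliptic curve\<close>

lemma quadratic_subfield:
  fixes F :: "'a::field_char_0 set"
  assumes F: "subfield F \<Omega>" and y: "y ^ 2 \<in> F"
  shows "subfield {a + b * y | a b. a \<in> F \<and> b \<in> F} \<Omega>" (is "subfield ?E \<Omega>")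
    and "F \<subseteq> {a + b * y | a b. a \<in> F \<and> b \<in> F}" and "y \<in> {a + b * y | a b. a \<in> F \<and> b \<in> F}"
    and "ring.finite_dimension \<Omega> F {a + b * y | a b. a \<in> F \<and> b \<in> F}"
proof -
  have I: "a + b * y \<in> ?E" if "a \<in> F" "b \<in> F" for a b using that by blast
  show sub: "F \<subseteq> ?E" using I[OF _ subfield_closed(1)[OF F]] by auto
  show yE: "y \<in> ?E" using I[OF subfield_closed(1,2)[OF F]] by simp
  show "subfield ?E \<Omega>"
  proof (rule ambient_subfieldI)
    show "1 \<in> ?E" using sub subfield_closed(2)[OF F] by blast
    fix u assume "u \<in> ?E"
    then obtain a b where u: "u = a + b * y" "a \<in> F" "b \<in> F" by blast
    have "- u = - a + (- b) * y" using u by simp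
    thus "- u \<in> ?E" using I[of "- a" "- b"] u subfield_closed(5)[OF F] by metis
    show "inverse u \<in> ?E" if u0: "u \<noteq> 0"
    proof (cases "a - b * y = 0")
      \<comment> \<open>y may already lie in F, so a - b y can vanish for a nonzero u; then u itself
        lies in F.\<close>
      case True
      show ?thesis
      proof (cases "b = 0")
        case True
        thus ?thesis using \<open>a - b * y = 0\<close> u u0 by simp
      next
        case False
        hence "y = a / b" using True by (simp add: field_simps)
        hence "y \<in> F" using subfield_divide[OF F u(2,3)] by simp
        hence "u \<in> F" unfolding u(1) by (intro subfield_closed(3,4)[OF F] u(2,3))
        thus ?thesis using sub subfield_inverse[OF F] by blast
      qed
    next
      case False
      define N where "N = a ^ 2 - b ^ 2 * y ^ 2"
      have N: "N = u * (a - b * y)" by (simp add: N_def u power2_eq_square algebra_simps)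
      have NF: "N \<in> F" unfolding N_def by (intro subfield_closed(4,6)[OF F] subfield_closed(7)[OF F] u(2,3) y)
      have "w / (u * w) = inverse u" if "w \<noteq> 0" for w using that by (simp add: divide_inverse)
      hence "inverse u = (a - b * y) / N" using N False by metis
      also have "\<dots> = a / N + (- b / N) * y" by (simp add: diff_divide_distrib)
      finally show ?thesis using I[of "a / N" "- b / N"] u NF subfield_closed(5,10)[OF F] by metis
    qed
    fix v assume "v \<in> ?E"
    then obtain a' b' where v: "v = a' + b' * y" "a' \<in> F" "b' \<in> F" by blast
    have "u + v = (a + a') + (b + b') * y" using u v by (simp add: algebra_simps)
    thus "u + v \<in> ?E" using I[of "a + a'" "b + b'"] u v subfield_closed(3)[OF F] by metis
    have "u * v = (a * a' + b * b' * y ^ 2) + (a * b' + a' * b) * y"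
      using u v by (simp add: algebra_simps power2_eq_square)
    moreover have "(a * a' + b * b' * y ^ 2) + (a * b' + a' * b) * y \<in> ?E"
      by (rule I) (intro subfield_closed(3,4)[OF F] u(2,3) v(2,3) y)+
    ultimately show "u * v \<in> ?E" by simp
  qed
  have "?E = ring.Span \<Omega> F [1, y]"
  proof (rule equalityI; rule subsetI)
    fix u assume "u \<in> ?E"
    then obtain a b where u: "u = a + b * y" "a \<in> F" "b \<in> F" by blast
    have "u = (\<Sum>i<length [1, y]. (if i = 0 then a else b) * [1, y] ! i)"
      using u by (simp add: numeral_2_eq_2 lessThan_Suc)
    thus "u \<in> ring.Span \<Omega> F [1, y]" unfolding mem_Span_iff[OF F] using u
      by (intro exI[of _ "\<lambda>i. if i = 0 then a else b"]) auto
  next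
    fix u assume "u \<in> ring.Span \<Omega> F [1, y]"
    then obtain c where c: "\<forall>i<length [1, y]. c i \<in> F" "u = (\<Sum>i<length [1, y]. c i * [1, y] ! i)"
      unfolding mem_Span_iff[OF F] by blast
    have "u = c 0 + c 1 * y" using c(2) by (simp add: numeral_2_eq_2 lessThan_Suc)
    thus "u \<in> ?E" using c(1) by (intro CollectI exI[of _ "c 0"] exI[of _ "c 1"]) auto
  qed
  thus "ring.finite_dimension \<Omega> F ?E" using finite_dimension_Span[OF F] by blast
qed

lemma finite_dimension_self: "subfield F \<Omega> \<Longrightarrow> ring.finite_dimension \<Omega> F F"
  using Om.dimension_one[of F] by (auto simp: Om.finite_dimension_def)

lemma finite_dimension_trans:
  assumes "subfield F \<Omega>" "subfield K \<Omega>" "ring.finite_dimension \<Omega> F K" "ring.finite_dimension \<Omega> K E"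
  shows "ring.finite_dimension \<Omega> F E"
  using assms Om.telescopic_base[OF assms(1,2)] unfolding Om.finite_dimension_def by blast

section \<open>Sections of a curve: continuity, eigenvectors and passage to extensions\<close>

locale geometric_section =
  fixes k P :: "'a::field_char_0 set" and s
  assumes curve: "curve k P" and sec: "is_section k P s"
begin
abbreviation "L \<equiv> algebraic_elements k"
abbreviation "G \<equiv> carrier (G_base k)"
lemma k: "subfield k \<Omega>" and P: "subfield P \<Omega>" and kP: "k \<subseteq> P" and ac: "algebraic_closure \<Omega> P"
  using curve by (auto simp: curve_def)
lemma L: "subfield L \<Omega>" and kL: "k \<subseteq> L"
  by (rule subfield_algebraic_elements[OF k], rule subset_algebraic_elements[OF k])
lemmas A = L k kL
lemmas B = subfield_UNIV P subset_UNIV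
lemma closed: "degree (p :: 'a poly) > 0 \<Longrightarrow> \<exists>x. poly p x = 0"
  by (rule algebraically_closed_root[OF ac])
lemma s_gal: "\<tau> \<in> G \<Longrightarrow> s \<tau> \<in> carrier (gal UNIV P)"
  using sec by (auto simp: is_section_def hom_def)
lemma s_comp: "\<tau> \<in> G \<Longrightarrow> \<rho> \<in> G \<Longrightarrow> s (compose L \<tau> \<rho>) a = s \<tau> (s \<rho> a)"
  using sec by (auto simp: is_section_def hom_def gal_def compose_def)
lemma s_alg: "\<tau> \<in> G \<Longrightarrow> a \<in> L \<Longrightarrow> s \<tau> a = \<tau> a"
proof -
  assume "\<tau> \<in> G" "a \<in> L"
  moreover from this have "restrict (s \<tau>) L = \<tau>" using sec by (simp add: is_section_def pr_def)
  ultimately show ?thesis by (metis restrict_apply)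
qed
lemma s_cont: "continuous_map (krull_topology L k) (krull_topology UNIV P) s"
  using sec by (simp add: is_section_def)
lemma fixed_in_k: "a \<in> L \<Longrightarrow> (\<And>\<tau>. \<tau> \<in> G \<Longrightarrow> \<tau> a = a) \<Longrightarrow> a \<in> k"
  by (rule gal_base_fixed[OF k closed])

lemma coset_id: "(\<lambda>a\<in>L'. a) <#\<^bsub>gal L' F\<^esub> carrier (gal L' E) = carrier (gal L' E)"
  if "subfield L' \<Omega>" "subfield E \<Omega>" "E \<subseteq> L'" for L' E F :: "'a set"
proof -
  have "compose L' (\<lambda>a\<in>L'. a) h = h" if h: "h \<in> carrier (gal L' E)" for h
  proof (rule extensionalityI[of _ L'])
    show "h \<in> extensional L'" using h gal_iff[OF \<open>subfield L' \<Omega>\<close> \<open>subfield E \<Omega>\<close> \<open>E \<subseteq> L'\<close>] by blast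
    fix a assume "a \<in> L'"
    thus "compose L' (\<lambda>a\<in>L'. a) h a = h a"
      using gal_closed[OF \<open>subfield L' \<Omega>\<close> \<open>subfield E \<Omega>\<close> \<open>E \<subseteq> L'\<close> h] by (simp add: compose_def)
  qed auto
  thus ?thesis unfolding l_coset_def by (force simp: gal_def)
qed

lemma topspace_base: "topspace (krull_topology L k) = G"
proof
  have "openin (krull_topology L k) ((\<lambda>a\<in>L. a) <#\<^bsub>gal L k\<^esub> carrier (gal L k))"
    by (rule krull_coset_open[OF k _ kL finite_dimension_self[OF k] gal_id[OF A]]) simp
  thus "G \<subseteq> topspace (krull_topology L k)" unfolding coset_id[OF L k kL] by (rule openin_subset)
  show "topspace (krull_topology L k) \<subseteq> G"
  proof
    fix \<tau> assume "\<tau> \<in> topspace (krull_topology L k)"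
    then obtain \<sigma> E where E: "\<sigma> \<in> G" "subfield E \<Omega>" "k \<subseteq> E" "E \<subseteq> L" "\<tau> \<in> \<sigma> <#\<^bsub>gal L k\<^esub> carrier (gal L E)"
      unfolding krull_topology_def topology_generated_by_topspace by blast
    then obtain h where h: "h \<in> carrier (gal L E)" "\<tau> = compose L \<sigma> h" unfolding l_coset_def by (auto simp: gal_def)
    have "h \<in> G" using h(1) E(3) unfolding gal_iff[OF L E(2,4)] gal_iff[OF A] by blast
    thus "\<tau> \<in> G" unfolding h(2) by (rule gal_compose[OF A E(1)])
  qed
qed

text \<open>\<chi>(\<tau>) = s(\<tau>)(y) / y is a sign, and multiplicative because signs lie in P.
  The automorphisms fixing P + P y form an open subgroup, so continuity of s makes \<chi> trivial on
  all \<tau> that fix a finite set.\<close>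

lemma square_root_eigenvector:
  assumes y: "y ^ 2 \<in> P" "y \<noteq> 0"
  obtains c where "c \<in> L" "c \<noteq> 0" "c ^ 2 \<in> k" "\<And>\<tau>. \<tau> \<in> G \<Longrightarrow> s \<tau> (y / c) = y / c"
proof -
  define \<chi> where "\<chi> \<tau> = s \<tau> y / y" for \<tau>
  have sy: "s \<tau> y = \<chi> \<tau> * y" for \<tau> using y by (simp add: \<chi>_def)
  have chi: "\<chi> \<tau> = 1 \<or> \<chi> \<tau> = - 1" if t: "\<tau> \<in> G" for \<tau>
  proof -
    have "s \<tau> y ^ 2 = s \<tau> (y ^ 2)" by (rule gal_power[OF B s_gal[OF t], symmetric]) simp
    also have "\<dots> = y ^ 2" by (rule gal_fix[OF B s_gal[OF t] y(1)])
    finally have "\<chi> \<tau> ^ 2 = 1" using y(2) by (simp add: \<chi>_def power_divide)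
    thus ?thesis by (simp add: power2_eq_1_iff)
  qed
  have hom: "\<chi> (compose L \<tau> \<rho>) = \<chi> \<tau> * \<chi> \<rho>" if t: "\<tau> \<in> G" "\<rho> \<in> G" for \<tau> \<rho>
  proof -
    have "\<chi> \<rho> \<in> P" using chi[OF t(2)] subfield_closed(2,5)[OF P] by auto
    hence "s \<tau> (\<chi> \<rho> * y) = \<chi> \<rho> * s \<tau> y"
      using gal_mult[OF B s_gal[OF t(1)]] gal_fix[OF B s_gal[OF t(1)]] by simp
    hence "s (compose L \<tau> \<rho>) y = \<chi> \<tau> * \<chi> \<rho> * y" using s_comp[OF t, of y] sy[of \<rho>] sy[of \<tau>] by simp
    thus ?thesis unfolding \<chi>_def[of "compose L \<tau> \<rho>"] using y(2) by simp
  qed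
  have "\<exists>T. finite T \<and> T \<subseteq> L \<and> (\<forall>\<tau>\<in>G. (\<forall>e\<in>T. \<tau> e = e) \<longrightarrow> \<chi> \<tau> = 1)"
  proof -
    let ?E = "{a + b * y | a b. a \<in> P \<and> b \<in> P}"
    note E = quadratic_subfield[OF P y(1)]
    let ?U = "carrier (gal UNIV ?E)"
    have "openin (krull_topology UNIV P) ((\<lambda>a\<in>UNIV. a) <#\<^bsub>gal UNIV P\<^esub> ?U)"
      by (rule krull_coset_open[OF E(1,2) _ E(4) gal_id[OF B]]) simp
    hence "openin (krull_topology UNIV P) ?U" unfolding coset_id[OF subfield_UNIV E(1) subset_UNIV] .
    hence V: "openin (krull_topology L k) {\<tau> \<in> topspace (krull_topology L k). s \<tau> \<in> ?U}"
      by (rule openin_continuous_map_preimage[OF s_cont])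
    define i where "i = (\<lambda>a\<in>L. a)"
    have iG: "i \<in> G" unfolding i_def by (rule gal_id[OF A])
    have "compose L i i = i" by (auto simp: i_def compose_def fun_eq_iff)
    \<comment> \<open>s sends the identity to an idempotent automorphism, and an injective
      idempotent map is the identity.\<close>
    hence "s i (s i a) = s i a" for a using s_comp[OF iG iG, of a] by simp
    hence si: "s i a = a" for a using gal_inj[OF B s_gal[OF iG]] by (auto simp: inj_on_def)
    have "s i \<in> ?U" using s_gal[OF iG] si unfolding gal_iff[OF B] gal_iff[OF subfield_UNIV E(1) subset_UNIV] by blast
    hence "i \<in> {\<tau> \<in> topspace (krull_topology L k). s \<tau> \<in> ?U}" using iG topspace_base by blast
    from krull_neighbourhood[OF A V this] obtain T where T: "finite T" "T \<subseteq> L"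
      "\<forall>\<rho>\<in>G. (\<forall>e\<in>T. \<rho> e = i e) \<longrightarrow> \<rho> \<in> {\<tau> \<in> topspace (krull_topology L k). s \<tau> \<in> ?U}" by blast
    have "\<chi> \<tau> = 1" if t: "\<tau> \<in> G" "\<forall>e\<in>T. \<tau> e = e" for \<tau>
    proof -
      have "\<forall>e\<in>T. \<tau> e = i e" using t(2) T(2) by (auto simp: i_def)
      hence "s \<tau> \<in> ?U" using T(3) t(1) by blast
      hence "s \<tau> y = y" by (rule gal_fix[OF subfield_UNIV E(1) subset_UNIV _ E(3)])
      thus ?thesis using y(2) by (simp add: \<chi>_def)
    qed
    thus ?thesis using T by blast
  qed
  then obtain T where T: "finite T" "T \<subseteq> L" "\<And>\<tau>. \<tau> \<in> G \<Longrightarrow> (\<forall>e\<in>T. \<tau> e = e) \<Longrightarrow> \<chi> \<tau> = 1" by blast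
  obtain c where c: "c \<in> L" "c \<noteq> 0" "\<forall>\<tau>\<in>G. \<tau> c = \<chi> \<tau> * c"
    using quadratic_character_eigenvector[OF k chi hom T] by blast
  have "\<tau> (c ^ 2) = c ^ 2" if t: "\<tau> \<in> G" for \<tau>
    using gal_power[OF A t c(1), of 2] c(3) t chi[OF t] by (auto simp: power_mult_distrib)
  hence "c ^ 2 \<in> k" using fixed_in_k subfield_closed(7)[OF L c(1)] by blast
  moreover have "s \<tau> (y / c) = y / c" if t: "\<tau> \<in> G" for \<tau>
    using gal_divide[OF B s_gal[OF t], of y c] s_alg[OF t c(1)] sy[of \<tau>] c(3) t chi[OF t] by auto
  ultimately show ?thesis using that c by blast
qed

text \<open>The image of s lies in the smaller group because it fixes K. For the same reason K meets
  the algebraic elements only in k. Continuity transfers because a field finite over K is finite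
  over P, and a coset is the same set for either base field.\<close>

lemma section_of_extension:
  assumes K: "subfield K \<Omega>" "P \<subseteq> K" "ring.finite_dimension \<Omega> P K"
    and fixed: "\<And>\<tau> z. \<tau> \<in> G \<Longrightarrow> z \<in> K \<Longrightarrow> s \<tau> z = z"
  shows "curve k K" "is_section k K s"
proof -
  note C = subfield_UNIV K(1) subset_UNIV
  have sK: "s \<tau> \<in> carrier (gal UNIV K)" if t: "\<tau> \<in> G" for \<tau>
    using s_gal[OF t] fixed[OF t] unfolding gal_iff[OF B] gal_iff[OF C] by blast
  obtain t where t: "t \<in> P" "ring.transcendental \<Omega> k t" "ring.finite_dimension \<Omega> (adjoin k {t}) P"
    using curve by (auto simp: curve_def)
  have "subfield (adjoin k {t}) \<Omega>" unfolding adjoin_def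
    by (rule field.generate_field_is_subfield[OF field_ambient]) simp
  hence "ring.finite_dimension \<Omega> (adjoin k {t}) K" using finite_dimension_trans[OF _ P t(3) K(3)] by blast
  moreover have "K \<inter> L = k"
  proof
    show "k \<subseteq> K \<inter> L" using kP K(2) kL by blast
    show "K \<inter> L \<subseteq> k" using fixed s_alg fixed_in_k by (metis IntD1 IntD2 subsetI)
  qed
  ultimately show "curve k K" unfolding curve_def
    using k K(1,2) kP t algebraic_closure_extend[OF ac K(1,2)] by blast
  have "continuous_map (krull_topology L k) (krull_topology UNIV K) s"
    unfolding krull_topology_def[of UNIV K]
  proof (rule continuous_on_generated_topo)
    let ?S = "{\<sigma> <#\<^bsub>gal UNIV K\<^esub> carrier (gal UNIV E) |\<sigma> E. \<sigma> \<in> carrier (gal UNIV K) \<and>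
       subfield E \<Omega> \<and> K \<subseteq> E \<and> E \<subseteq> UNIV \<and> ring.finite_dimension \<Omega> K E}"
    fix U assume "U \<in> ?S"
    then obtain \<sigma> E where E: "U = \<sigma> <#\<^bsub>gal UNIV K\<^esub> carrier (gal UNIV E)" "\<sigma> \<in> carrier (gal UNIV K)"
      "subfield E \<Omega>" "K \<subseteq> E" "ring.finite_dimension \<Omega> K E" by blast
    have "\<sigma> \<in> carrier (gal UNIV P)" using E(2) K(2) unfolding gal_iff[OF B] gal_iff[OF C] by blast
    hence "openin (krull_topology UNIV P) (\<sigma> <#\<^bsub>gal UNIV P\<^esub> carrier (gal UNIV E))"
      by (intro krull_coset_open E(3) finite_dimension_trans[OF P K(1) K(3) E(5)]) (use E K in auto)
    hence "openin (krull_topology UNIV P) U" unfolding E(1) by (simp add: l_coset_def gal_def)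
    from openin_continuous_map_preimage[OF s_cont this]
    show "openin (krull_topology L k) (s -` U \<inter> topspace (krull_topology L k))"
      by (simp add: vimage_def Int_def conj_commute)
  next
    let ?S = "{\<sigma> <#\<^bsub>gal UNIV K\<^esub> carrier (gal UNIV E) |\<sigma> E. \<sigma> \<in> carrier (gal UNIV K) \<and>
       subfield E \<Omega> \<and> K \<subseteq> E \<and> E \<subseteq> UNIV \<and> ring.finite_dimension \<Omega> K E}"
    have "(\<lambda>a\<in>UNIV. a) <#\<^bsub>gal UNIV K\<^esub> carrier (gal UNIV K) \<in> ?S"
      using gal_id[OF C] K(1) finite_dimension_self[OF K(1)] by blast
    hence "carrier (gal UNIV K) \<in> ?S" unfolding coset_id[OF C] .
    thus "s ` topspace (krull_topology L k) \<subseteq> \<Union> ?S" unfolding topspace_base using sK by blast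
  qed
  thus "is_section k K s" using sec sK unfolding is_section_def hom_def by (auto simp: gal_def)
qed

end

section \<open>The section conjecture for the projective line\<close>

lemma BGASC_projective_line:
  fixes k P :: "'a::field_char_0 set"
  assumes P: "projective_line k P" and hyp: "\<And>K. curve k K \<Longrightarrow> genus k K = int g \<Longrightarrow> BGASC k K"
  shows "BGASC k P"
  unfolding BGASC_def
proof (intro allI impI)
  fix s assume sec: "is_section k P s"
  interpret S: geometric_section k P s
    by (rule geometric_section.intro) (use P sec in \<open>auto simp: projective_line_def\<close>)
  obtain t where t: "ring.transcendental \<Omega> k t" "P = adjoin k {t}" using P by (auto simp: projective_line_def)
  have tt: "transcendental_over k t" using t(1) transcendental_iff[OF S.k] by (auto simp: transcendental_over_def)
  have PR: "P = rational_functions k t" using t(2) rational_functions_adjoin[OF S.k tt] by simp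
  define f :: "'a poly" where "f = (\<Prod>i\<in>{1..2*g+1}. [:- of_nat i, 1:])"
  have fo: "f \<in> poly_over k" unfolding f_def
    by (intro poly_over_prod subfield_subring[OF S.k])
      (auto simp: poly_over_pCons subfield_subring[OF S.k] poly_over_closed subring_closed)
  have f0: "f \<noteq> 0" unfolding f_def by (subst prod_zero_iff) auto
  have fP: "poly f t \<in> P" unfolding PR by (rule poly_rational_functions[OF S.k tt fo])
  have ft: "poly f t \<noteq> 0" using tt fo f0 by (auto simp: transcendental_over_def)
  obtain y0 where y0: "y0 ^ 2 = poly f t"
  proof -
    have "degree [:- poly f t, 0, 1:] > 0" by simp
    then obtain y where "poly [:- poly f t, 0, 1:] y = 0" using S.closed by blast
    thus ?thesis using that[of y] by (simp add: power2_eq_square)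
  qed
  obtain c where c: "c \<in> S.L" "c \<noteq> 0" "c ^ 2 \<in> k" "\<And>\<tau>. \<tau> \<in> S.G \<Longrightarrow> s \<tau> (y0 / c) = y0 / c"
    using S.square_root_eigenvector[of y0] y0 fP ft by (metis power_zero_numeral)
  define y d where "y = y0 / c" and "d = inverse (c ^ 2)"
  have d: "d \<in> k" "d \<noteq> 0" using c subfield_inverse[OF S.k] by (auto simp: d_def)
  have y2: "y ^ 2 = d * poly f t"
    unfolding y_def d_def power_divide y0 by (simp add: divide_inverse mult.commute)
  have y2P: "y ^ 2 \<in> P" unfolding y2 using d S.kP fP by (auto intro!: subfield_closed(4)[OF S.P])
  define K where "K = {a + b * y | a b. a \<in> P \<and> b \<in> P}"
  note Kq = quadratic_subfield[OF S.P y2P, folded K_def]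
  interpret H: hyperelliptic k t y d g P K f
    by (rule hyperelliptic.intro) (use S.k tt d PR f_def y2 Kq(1) K_def in auto)
  have fixK: "s \<tau> z = z" if ta: "\<tau> \<in> S.G" and z: "z \<in> K" for \<tau> z
  proof -
    obtain a b where ab: "z = a + b * y" "a \<in> P" "b \<in> P" using z by (auto simp: K_def)
    note D = S.B S.s_gal[OF ta]
    have "s \<tau> y = y" using c(4)[OF ta] by (simp add: y_def)
    thus ?thesis using gal_add[OF D] gal_mult[OF D] gal_fix[OF D ab(2)] gal_fix[OF D ab(3)] by (simp add: ab(1))
  qed
  note cur = S.section_of_extension[OF Kq(1,2,4) fixK]
  have BK: "BGASC k K" by (rule hyp[OF cur(1) H.genus_eq])
  have sK: "s \<tau> \<in> carrier (G_curve K)" if "\<tau> \<in> S.G" for \<tau>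
    using cur(2) that by (auto simp: is_section_def hom_def)
  \<comment> \<open>Used for rationality over K and over P alike: residues of elements of K come
    from k.\<close>
  have res: "\<exists>\<alpha>\<in>k. z - \<alpha> \<in> maximal_ideal W"
    if W: "valuation_ring UNIV W" "\<And>\<tau>. \<tau> \<in> S.G \<Longrightarrow> s \<tau> ` W = W" and x: "W \<inter> K \<in> closed_points k K"
      and z: "z \<in> W \<inter> K" for W z
  proof -
    have m: "maximal_ideal (W \<inter> K) = maximal_ideal W \<inter> K"
      by (rule valuation_ring_restrict(2)[OF Kq(1) _ W(1)]) simp
    have kW: "k \<subseteq> W" using cp_scalars[OF Kq(1) x] by blast
    obtain p where p: "p \<in> poly_over k" "p \<noteq> 0" "poly p z \<in> maximal_ideal W"
      using H.residue_algebraic[OF x z] m by blast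
    show ?thesis
      by (rule stable_residue[OF S.k S.closed S.P S.s_gal S.s_alg W(1) kW W(2) _ fixK p]) (use z in auto)
  qed
  have ratK: "W \<inter> K \<in> rational_points k K"
    if W: "valuation_ring UNIV W" "\<And>\<tau>. \<tau> \<in> S.G \<Longrightarrow> s \<tau> ` W = W" and x: "W \<inter> K \<in> closed_points k K" for W
  proof (rule rational_pointI[OF S.k Kq(1) x])
    fix z assume z: "z \<in> W \<inter> K"
    have m: "maximal_ideal (W \<inter> K) = maximal_ideal W \<inter> K"
      by (rule valuation_ring_restrict(2)[OF Kq(1) _ W(1)]) simp
    obtain \<alpha> where al: "\<alpha> \<in> k" "z - \<alpha> \<in> maximal_ideal W" using res[OF W x z] by blast
    have "z - \<alpha> \<in> K" using z al(1) H.kK by (auto intro!: subfield_closed(6)[OF Kq(1)])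
    thus "\<exists>\<alpha>\<in>k. z - \<alpha> \<in> maximal_ideal (W \<inter> K)" using al m by blast
  qed
  have vu: "valuation_ring UNIV W" if "W \<in> valuation_extensions F x" for W F x
    using that by (auto simp: valuation_extensions_def valuation_ring_def)
  have PKW: "W \<inter> K \<inter> P = W \<inter> P" for W using H.PK by blast
  show "\<exists>!x. x \<in> rational_points k P \<and> (\<exists>W\<in>valuation_extensions P x. s ` S.G \<subseteq> decomposition_group P W)"
  proof (rule ex_ex1I)
    obtain x W where x: "x \<in> rational_points k K" and W: "W \<in> valuation_extensions K x"
      and sW: "s ` S.G \<subseteq> decomposition_group K W"
      using BK cur(2) unfolding BGASC_def by blast
    have xW: "x = W \<inter> K" using W by (simp add: valuation_extensions_def)
    have cp: "W \<inter> K \<in> closed_points k K" using x xW by (simp add: rational_points_def)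
    have st: "s \<tau> ` W = W" if "\<tau> \<in> S.G" for \<tau> using sW that by (auto simp: decomposition_group_def)
    have m: "maximal_ideal (W \<inter> P) = maximal_ideal W \<inter> P"
      by (rule valuation_ring_restrict(2)[OF S.P _ vu[OF W]]) simp
    have cpP: "W \<inter> P \<in> closed_points k P" using H.closed_point_restrict[OF cp S.kP] PKW by simp
    have "W \<inter> P \<in> rational_points k P"
    proof (rule rational_pointI[OF S.k S.P cpP])
      fix z assume z: "z \<in> W \<inter> P"
      hence "z \<in> W \<inter> K" using H.PK by blast
      then obtain \<alpha> where al: "\<alpha> \<in> k" "z - \<alpha> \<in> maximal_ideal W" using res[OF vu[OF W] st cp] by blast
      have "z - \<alpha> \<in> P" using z al(1) S.kP by (auto intro!: subfield_closed(6)[OF S.P])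
      thus "\<exists>\<alpha>\<in>k. z - \<alpha> \<in> maximal_ideal (W \<inter> P)" using al m by blast
    qed
    moreover have "W \<in> valuation_extensions P (W \<inter> P)" using W by (simp add: valuation_extensions_def)
    moreover have "s ` S.G \<subseteq> decomposition_group P W"
      using st S.s_gal by (auto simp: decomposition_group_def)
    ultimately show "\<exists>x. x \<in> rational_points k P \<and> (\<exists>W\<in>valuation_extensions P x. s ` S.G \<subseteq> decomposition_group P W)"
      by blast
  next
    fix x1 x2
    assume 1: "x1 \<in> rational_points k P \<and> (\<exists>W\<in>valuation_extensions P x1. s ` S.G \<subseteq> decomposition_group P W)"
      and 2: "x2 \<in> rational_points k P \<and> (\<exists>W\<in>valuation_extensions P x2. s ` S.G \<subseteq> decomposition_group P W)"
    \<comment> \<open>Each candidate on P comes with a stable W, and W \<inter> K is then a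
      candidate on K. Uniqueness on K identifies the two intersections with K, hence those with
      P.\<close>
    have lift: "\<exists>W. x = W \<inter> P \<and> W \<inter> K \<in> rational_points k K \<and>
        (\<exists>V\<in>valuation_extensions K (W \<inter> K). s ` S.G \<subseteq> decomposition_group K V)"
      if x: "x \<in> rational_points k P \<and> (\<exists>W\<in>valuation_extensions P x. s ` S.G \<subseteq> decomposition_group P W)" for x
    proof -
      obtain W where W: "W \<in> valuation_extensions P x" and sW: "s ` S.G \<subseteq> decomposition_group P W" using x by blast
      have xW: "x = W \<inter> P" using W by (simp add: valuation_extensions_def)
      have cp: "W \<inter> P \<in> closed_points k P" using x xW by (simp add: rational_points_def)
      have st: "s \<tau> ` W = W" if "\<tau> \<in> S.G" for \<tau> using sW that by (auto simp: decomposition_group_def)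
      have "valuation_ring K (W \<inter> K)" by (rule valuation_ring_restrict(1)[OF Kq(1) _ vu[OF W]]) simp
      moreover have "k \<subseteq> W \<inter> K" using cp_scalars[OF S.P cp] H.kK by blast
      ultimately have "W \<inter> K \<in> closed_points k K" using H.closed_point_lift cp PKW by metis
      hence "W \<inter> K \<in> rational_points k K" using ratK[OF vu[OF W] st] by blast
      moreover have "W \<in> valuation_extensions K (W \<inter> K)" using W by (simp add: valuation_extensions_def)
      moreover have "s ` S.G \<subseteq> decomposition_group K W"
        using st sK by (auto simp: decomposition_group_def)
      ultimately show ?thesis using xW by blast
    qed
    obtain W1 where W1: "x1 = W1 \<inter> P" "W1 \<inter> K \<in> rational_points k K \<and>
        (\<exists>V\<in>valuation_extensions K (W1 \<inter> K). s ` S.G \<subseteq> decomposition_group K V)" using lift[OF 1] by blast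
    obtain W2 where W2: "x2 = W2 \<inter> P" "W2 \<inter> K \<in> rational_points k K \<and>
        (\<exists>V\<in>valuation_extensions K (W2 \<inter> K). s ` S.G \<subseteq> decomposition_group K V)" using lift[OF 2] by blast
    note ex1 = BK[unfolded BGASC_def, rule_format, OF cur(2)]
    have "W1 \<inter> K = W2 \<inter> K" using the1_equality[OF ex1 W1(2)] the1_equality[OF ex1 W2(2)] by simp
    thus "x1 = x2" using PKW[of W1] PKW[of W2] W1(1) W2(1) by simp
  qed
qed

theorem proposition2p2:
  fixes k :: "'a::field_char_0 set" and g :: nat
  assumes "subfield k \<Omega>"
    and "g \<ge> 1"
    and "\<forall>K. curve k K \<and> genus k K = int g \<longrightarrow> BGASC k K"
  shows "\<forall>P. projective_line k P \<longrightarrow> BGASC k P"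
  using BGASC_projective_line assms(3) by blast

end
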